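(* Let $k$ be a commutative ring with unit and $p\ge 0$. Let $C_{p+1}\hookrightarrow\Sigma_{p+1}$ be the cyclic group of order $p+1$ embedded as the subgroup generated by the cycle $\tau_p=(0,p,p-1,\dots,1)$. Then there is a $\Sigma_{p+1}$-isomorphism $H_p(Sym_*^{(p)})\cong AC_{p+1}\uparrow\Sigma_{p+1}$, the alternating representation of the cyclic group induced up to the symmetric group. Moreover, $H_p(Sym_*^{(p)})$ is generated by the elements $\sigma(b_p)$, for the distinct cosets $\sigma C_{p+1}$, where $b_p=\sum_{j=0}^p(-1)^{jp}\tau_p^j(z_0z_1\cdots z_p)$.
   Context: $\Sigma_{p+1}$ is the symmetric group on $\{0,\dots,p\}$. $AC_{p+1}$ is the alternating representation of $C_{p+1}$: the rank one module $k$ on which $g\in C_{p+1}\subseteq\Sigma_{p+1}$ acts by $\mathrm{sgn}(g)$ (for $p$ even this is the trivial representation). The complex $Sym_*^{(p)}$ of $k$-modules: consider formal tensors $Z_0\otimes\cdots\otimes Z_q$ of non-empty words in non-commuting variables $z_0,\dots,z_p$ in which each variable occurs exactly once. For a word $Z$ let $\deg(Z)$ be its length minus one, and $\deg(Z_0\otimes\cdots\otimes Z_t)=\sum_i\deg(Z_i)$. $Sym_i^{(p)}$ is the free $k$-module on such tensors with $p-i+1$ tensor factors, modulo the relations $\cdots\otimes Z_j\otimes Z_{j+1}\otimes\cdots\approx(-1)^{\deg(Z_j)\deg(Z_{j+1})}\cdots\otimes Z_{j+1}\otimes Z_j\otimes\cdots$. On words, $d_i(z_{j_0}\cdots z_{j_s})=z_{j_0}\cdots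 z_{j_i}\otimes z_{j_{i+1}}\cdots z_{j_s}$ for $0\le i<s$ and $0$ otherwise; on tensors, $d_i(W\otimes V)=d_i(W)\otimes V+W\otimes d_{i-\deg(W)}(V)$. The differential $Sym_n^{(p)}\to Sym_{n-1}^{(p)}$ is $d=\sum_{i=0}^{n-1}(-1)^id_i$. $\Sigma_{p+1}$ acts on the left by permuting the indices of the $z_i$, compatibly with $d$. *)

theory Defs
  imports "HOL-Algebra.Module" "HOL-Algebra.AbelCoset" "HOL-Algebra.Left_Coset" "HOL-Algebra.Sym_Groups"
begin

section \<open>Modules over a commutative ring\<close>

definition module_span ::
  "('k, 'c) ring_scheme \<Rightarrow> ('k, 'm, 'd) module_scheme \<Rightarrow> 'm set \<Rightarrow> 'm set"
  where "module_span R M S = \<Inter>{N. submodule N R M \<and> S \<subseteq> N}"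

definition module_homs ::
  "('k, 'c) ring_scheme \<Rightarrow> ('k, 'm, 'd) module_scheme \<Rightarrow> ('k, 'n, 'e) module_scheme \<Rightarrow> ('m \<Rightarrow> 'n) set"
  where "module_homs R M N =
    {f \<in> carrier M \<rightarrow> carrier N.
       (\<forall>x\<in>carrier M. \<forall>y\<in>carrier M. f (x \<oplus>\<^bsub>M\<^esub> y) = f x \<oplus>\<^bsub>N\<^esub> f y) \<and>
       (\<forall>a\<in>carrier R. \<forall>x\<in>carrier M. f (a \<odot>\<^bsub>M\<^esub> x) = a \<odot>\<^bsub>N\<^esub> f x)}"

text \<open>The ring multiplication that a module record carries plays no role for modules; it is
  left unspecified in the records below.\<close>

definition regular_module :: "('k, 'c) ring_scheme \<Rightarrow> ('k, 'k) module"
  where "regular_module R =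
    \<lparr>carrier = carrier R, monoid.mult = undefined, one = undefined,
     zero = \<zero>\<^bsub>R\<^esub>, add = add R, smult = monoid.mult R\<rparr>"

text \<open>The free module on \<open>X\<close>: finitely supported functions that vanish outside \<open>X\<close>.\<close>

definition free_module :: "('k, 'c) ring_scheme \<Rightarrow> 'a set \<Rightarrow> ('k, 'a \<Rightarrow> 'k) module"
  where "free_module R X =
    \<lparr>carrier = {f. range f \<subseteq> carrier R \<and> (\<forall>x. x \<notin> X \<longrightarrow> f x = \<zero>\<^bsub>R\<^esub>) \<and> finite {x. f x \<noteq> \<zero>\<^bsub>R\<^esub>}},
     monoid.mult = undefined, one = undefined,
     zero = (\<lambda>_. \<zero>\<^bsub>R\<^esub>), add = (\<lambda>f g x. f x \<oplus>\<^bsub>R\<^esub> g x), smult = (\<lambda>a f x. a \<otimes>\<^bsub>R\<^esub> f x)\<rparr>"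

definition free_gen :: "('k, 'c) ring_scheme \<Rightarrow> 'a \<Rightarrow> 'a \<Rightarrow> 'k"
  where "free_gen R x = (\<lambda>y. if y = x then \<one>\<^bsub>R\<^esub> else \<zero>\<^bsub>R\<^esub>)"

text \<open>The linear map from a free module to \<open>M\<close> that sends the generator at \<open>x\<close> to \<open>f x\<close>.\<close>

definition lin_ext ::
  "('k, 'c) ring_scheme \<Rightarrow> ('k, 'm, 'd) module_scheme \<Rightarrow> ('a \<Rightarrow> 'm) \<Rightarrow> ('a \<Rightarrow> 'k) \<Rightarrow> 'm"
  where "lin_ext R M f v = (\<Oplus>\<^bsub>M\<^esub>x\<in>{x. v x \<noteq> \<zero>\<^bsub>R\<^esub>}. v x \<odot>\<^bsub>M\<^esub> f x)"

definition quot_module ::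
  "('k, 'm, 'd) module_scheme \<Rightarrow> 'm set \<Rightarrow> ('k, 'm set) module"
  where "quot_module M N =
    \<lparr>carrier = a_rcosets\<^bsub>M\<^esub> N, monoid.mult = undefined, one = undefined,
     zero = N, add = set_add M, smult = (\<lambda>a X. \<Union>x\<in>X. N +>\<^bsub>M\<^esub> (a \<odot>\<^bsub>M\<^esub> x))\<rparr>"

text \<open>The map into the quotient of \<open>M\<close> by \<open>N\<close> induced by \<open>f\<close>, on cosets of the source. When \<open>f\<close>
  respects the submodules, the cosets in the union are all equal.\<close>

definition quot_map ::
  "('k, 'm, 'd) module_scheme \<Rightarrow> 'm set \<Rightarrow> ('l \<Rightarrow> 'm) \<Rightarrow> 'l set \<Rightarrow> 'm set"
  where "quot_map M N f X = (\<Union>x\<in>X. N +>\<^bsub>M\<^esub> f x)"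


section \<open>Representations and induction\<close>

locale representation = module R M + grp: group G
  for R (structure) and G (structure) and M (structure) +
  fixes \<rho> :: "'g \<Rightarrow> 'm \<Rightarrow> 'm"
  assumes linear: "g \<in> carrier G \<Longrightarrow> \<rho> g \<in> module_homs R M M"
    and action_one: "x \<in> carrier M \<Longrightarrow> \<rho> \<one>\<^bsub>G\<^esub> x = x"
    and action_mult: "\<lbrakk>g \<in> carrier G; h \<in> carrier G; x \<in> carrier M\<rbrakk>
      \<Longrightarrow> \<rho> (g \<otimes>\<^bsub>G\<^esub> h) x = \<rho> g (\<rho> h x)"

definition rep_isomorphic ::
  "('k, 'c) ring_scheme \<Rightarrow> ('g, 'f) monoid_scheme \<Rightarrow>
   ('k, 'm, 'd) module_scheme \<Rightarrow> ('g \<Rightarrow> 'm \<Rightarrow> 'm) \<Rightarrow>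
   ('k, 'n, 'e) module_scheme \<Rightarrow> ('g \<Rightarrow> 'n \<Rightarrow> 'n) \<Rightarrow> bool"
  where "rep_isomorphic R G M \<rho> N \<sigma> \<longleftrightarrow>
    representation R G M \<rho> \<and> representation R G N \<sigma> \<and>
    (\<exists>\<phi> \<in> module_homs R M N. bij_betw \<phi> (carrier M) (carrier N) \<and>
      (\<forall>g\<in>carrier G. \<forall>x\<in>carrier M. \<phi> (\<rho> g x) = \<sigma> g (\<phi> x)))"

text \<open>The induced module, that is, the tensor product of \<open>R[G]\<close> with \<open>M\<close> over \<open>R[H]\<close>, where \<open>H\<close>
  is a subgroup of \<open>G\<close> acting on \<open>M\<close> by \<open>\<rho>\<close>. Since \<open>R[G]\<close> is free on \<open>G\<close>, this tensor product
  has generators \<open>(g, x)\<close> (standing for \<open>g\<close> tensor \<open>x\<close>), linear in \<open>x\<close> and balanced over \<open>H\<close>.\<close>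

definition induced_relations ::
  "('k, 'c) ring_scheme \<Rightarrow> ('g, 'f) monoid_scheme \<Rightarrow> 'g set \<Rightarrow>
   ('k, 'm, 'd) module_scheme \<Rightarrow> ('g \<Rightarrow> 'm \<Rightarrow> 'm) \<Rightarrow> ('g \<times> 'm \<Rightarrow> 'k) set"
  where "induced_relations R G H M \<rho> = (let F = free_module R (carrier G \<times> carrier M) in
    module_span R F
      ({free_gen R (g, x \<oplus>\<^bsub>M\<^esub> y) \<ominus>\<^bsub>F\<^esub> (free_gen R (g, x) \<oplus>\<^bsub>F\<^esub> free_gen R (g, y)) | g x y.
          g \<in> carrier G \<and> x \<in> carrier M \<and> y \<in> carrier M} \<union>
       {free_gen R (g, a \<odot>\<^bsub>M\<^esub> x) \<ominus>\<^bsub>F\<^esub> a \<odot>\<^bsub>F\<^esub> free_gen R (g, x) | g a x.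
          g \<in> carrier G \<and> a \<in> carrier R \<and> x \<in> carrier M} \<union>
       {free_gen R (g \<otimes>\<^bsub>G\<^esub> h, x) \<ominus>\<^bsub>F\<^esub> free_gen R (g, \<rho> h x) | g h x.
          g \<in> carrier G \<and> h \<in> H \<and> x \<in> carrier M}))"

definition induced_module ::
  "('k, 'c) ring_scheme \<Rightarrow> ('g, 'f) monoid_scheme \<Rightarrow> 'g set \<Rightarrow>
   ('k, 'm, 'd) module_scheme \<Rightarrow> ('g \<Rightarrow> 'm \<Rightarrow> 'm) \<Rightarrow> ('k, ('g \<times> 'm \<Rightarrow> 'k) set) module"
  where "induced_module R G H M \<rho> =
    quot_module (free_module R (carrier G \<times> carrier M)) (induced_relations R G H M \<rho>)"

definition induced_action ::
  "('k, 'c) ring_scheme \<Rightarrow> ('g, 'f) monoid_scheme \<Rightarrow> 'g set \<Rightarrow>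
   ('k, 'm, 'd) module_scheme \<Rightarrow> ('g \<Rightarrow> 'm \<Rightarrow> 'm) \<Rightarrow>
   'g \<Rightarrow> ('g \<times> 'm \<Rightarrow> 'k) set \<Rightarrow> ('g \<times> 'm \<Rightarrow> 'k) set"
  where "induced_action R G H M \<rho> g = (let F = free_module R (carrier G \<times> carrier M) in
    quot_map F (induced_relations R G H M \<rho>)
      (lin_ext R F (\<lambda>(g', x). free_gen R (g \<otimes>\<^bsub>G\<^esub> g', x))))"


section \<open>The symmetric group on \<open>{0..p}\<close> and its cyclic subgroup\<close>

definition Sigma_group :: "nat \<Rightarrow> (nat \<Rightarrow> nat) monoid"
  where "Sigma_group p = \<lparr>carrier = {\<sigma>. \<sigma> permutes {0..p}}, monoid.mult = (\<circ>), one = id\<rparr>"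

text \<open>\<open>cycle_of_list\<close> sends each entry to the next one: \<open>0\<close> to \<open>p\<close>, \<open>p\<close> to \<open>p - 1\<close>, ..., \<open>1\<close> to \<open>0\<close>.\<close>

definition tau :: "nat \<Rightarrow> nat \<Rightarrow> nat"
  where "tau p = cycle_of_list (0 # rev [1..<Suc p])"

definition cyclic_subgroup :: "nat \<Rightarrow> (nat \<Rightarrow> nat) set"
  where "cyclic_subgroup p = generate (Sigma_group p) {tau p}"

definition sign_action :: "('k, 'c) ring_scheme \<Rightarrow> (nat \<Rightarrow> nat) \<Rightarrow> 'k \<Rightarrow> 'k"
  where "sign_action R g a = [sign g] \<cdot>\<^bsub>R\<^esub> a"

definition left_transversal :: "('g, 'f) monoid_scheme \<Rightarrow> 'g set \<Rightarrow> 'g set \<Rightarrow> bool"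
  where "left_transversal G H T \<longleftrightarrow>
    T \<subseteq> carrier G \<and> (\<forall>X \<in> lcosets\<^bsub>G\<^esub> H. \<exists>!t. t \<in> T \<inter> X)"


section \<open>The complex\<close>

text \<open>The variable \<open>z_i\<close> is represented by \<open>i\<close>, a word by a list of variables, and a formal tensor
  of words by the list of its factors.\<close>

type_synonym word = "nat list"
type_synonym tensor = "word list"

definition deg :: "word \<Rightarrow> nat"
  where "deg w = length w - 1"

definition tensors :: "nat \<Rightarrow> nat \<Rightarrow> tensor set"
  where "tensors p n =
    {Z. length Z + n = p + 1 \<and> [] \<notin> set Z \<and> distinct (concat Z) \<and> set (concat Z) = {0..p}}"

definition sym_free :: "('k, 'c) ring_scheme \<Rightarrow> nat \<Rightarrow> nat \<Rightarrow> ('k, tensor \<Rightarrow> 'k) module"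
  where "sym_free R p n = free_module R (tensors p n)"

definition sym_relations :: "('k, 'c) ring_scheme \<Rightarrow> nat \<Rightarrow> nat \<Rightarrow> (tensor \<Rightarrow> 'k) set"
  where "sym_relations R p n = (let F = sym_free R p n in
    module_span R F
      {free_gen R (A @ [U, V] @ B) \<ominus>\<^bsub>F\<^esub>
         ((\<ominus>\<^bsub>R\<^esub> \<one>\<^bsub>R\<^esub>) [^]\<^bsub>R\<^esub> (deg U * deg V)) \<odot>\<^bsub>F\<^esub> free_gen R (A @ [V, U] @ B) | A U V B.
         A @ [U, V] @ B \<in> tensors p n})"

definition sym_module :: "('k, 'c) ring_scheme \<Rightarrow> nat \<Rightarrow> nat \<Rightarrow> ('k, (tensor \<Rightarrow> 'k) set) module"
  where "sym_module R p n = quot_module (sym_free R p n) (sym_relations R p n)"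

text \<open>The tensor product of linear combinations of formal tensors: the bilinear extension of
  concatenation.\<close>

definition tensor_mult ::
  "('k, 'c) ring_scheme \<Rightarrow> (tensor \<Rightarrow> 'k) \<Rightarrow> (tensor \<Rightarrow> 'k) \<Rightarrow> tensor \<Rightarrow> 'k"
  where "tensor_mult R x y =
    (\<lambda>Z. \<Oplus>\<^bsub>R\<^esub>i\<in>{..length Z}. x (take i Z) \<otimes>\<^bsub>R\<^esub> y (drop i Z))"

text \<open>The index of a face is an integer, because the index \<open>i - deg W\<close> in the product rule may be
  negative, in which case the face is zero.\<close>

definition word_face :: "('k, 'c) ring_scheme \<Rightarrow> int \<Rightarrow> word \<Rightarrow> tensor \<Rightarrow> 'k"
  where "word_face R i w =
    (if 0 \<le> i \<and> i < int (deg w)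
     then free_gen R [take (nat i + 1) w, drop (nat i + 1) w]
     else (\<lambda>_. \<zero>\<^bsub>R\<^esub>))"

fun face :: "('k, 'c) ring_scheme \<Rightarrow> int \<Rightarrow> tensor \<Rightarrow> tensor \<Rightarrow> 'k"
  where
    "face R i [] = (\<lambda>_. \<zero>\<^bsub>R\<^esub>)"
  | "face R i (W # V) = (\<lambda>Z.
       tensor_mult R (word_face R i W) (free_gen R V) Z \<oplus>\<^bsub>R\<^esub>
       tensor_mult R (free_gen R [W]) (face R (i - int (deg W)) V) Z)"

text \<open>The differential from degree \<open>n\<close> to degree \<open>n - 1\<close>. For \<open>n = 0\<close> the sum is empty, so the map
  is zero and its target is immaterial.\<close>

definition sym_diff ::
  "('k, 'c) ring_scheme \<Rightarrow> nat \<Rightarrow> nat \<Rightarrow> (tensor \<Rightarrow> 'k) set \<Rightarrow> (tensor \<Rightarrow> 'k) set"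
  where "sym_diff R p n = (let F = sym_free R p (n - 1) in
    quot_map F (sym_relations R p (n - 1))
      (lin_ext R F (\<lambda>Z. \<Oplus>\<^bsub>F\<^esub>i\<in>{..<n}. ((\<ominus>\<^bsub>R\<^esub> \<one>\<^bsub>R\<^esub>) [^]\<^bsub>R\<^esub> i) \<odot>\<^bsub>F\<^esub> face R (int i) Z)))"

definition sym_action ::
  "('k, 'c) ring_scheme \<Rightarrow> nat \<Rightarrow> nat \<Rightarrow> (nat \<Rightarrow> nat) \<Rightarrow> (tensor \<Rightarrow> 'k) set \<Rightarrow> (tensor \<Rightarrow> 'k) set"
  where "sym_action R p n \<sigma> = (let F = sym_free R p n in
    quot_map F (sym_relations R p n) (lin_ext R F (\<lambda>Z. free_gen R (map (map \<sigma>) Z))))"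


section \<open>Homology\<close>

definition sym_cycles ::
  "('k, 'c) ring_scheme \<Rightarrow> nat \<Rightarrow> nat \<Rightarrow> ('k, (tensor \<Rightarrow> 'k) set) module"
  where "sym_cycles R p n = sym_module R p n
    \<lparr>carrier := {x \<in> carrier (sym_module R p n).
       sym_diff R p n x = \<zero>\<^bsub>sym_module R p (n - 1)\<^esub>}\<rparr>"

definition sym_boundaries ::
  "('k, 'c) ring_scheme \<Rightarrow> nat \<Rightarrow> nat \<Rightarrow> (tensor \<Rightarrow> 'k) set set"
  where "sym_boundaries R p n = sym_diff R p (n + 1) ` carrier (sym_module R p (n + 1))"

definition sym_homology ::
  "('k, 'c) ring_scheme \<Rightarrow> nat \<Rightarrow> nat \<Rightarrow> ('k, (tensor \<Rightarrow> 'k) set set) module"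
  where "sym_homology R p n = quot_module (sym_cycles R p n) (sym_boundaries R p n)"

definition sym_class ::
  "('k, 'c) ring_scheme \<Rightarrow> nat \<Rightarrow> nat \<Rightarrow> (tensor \<Rightarrow> 'k) set \<Rightarrow> (tensor \<Rightarrow> 'k) set set"
  where "sym_class R p n x = sym_boundaries R p n +>\<^bsub>sym_cycles R p n\<^esub> x"

definition homology_action ::
  "('k, 'c) ring_scheme \<Rightarrow> nat \<Rightarrow> nat \<Rightarrow> (nat \<Rightarrow> nat) \<Rightarrow>
   (tensor \<Rightarrow> 'k) set set \<Rightarrow> (tensor \<Rightarrow> 'k) set set"
  where "homology_action R p n \<sigma> =
    quot_map (sym_cycles R p n) (sym_boundaries R p n) (sym_action R p n \<sigma>)"

text \<open>\<open>top_word\<close> is the class of the tensor with the single factor \<open>z_0 z_1 ... z_p\<close>.\<close>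

definition top_word :: "('k, 'c) ring_scheme \<Rightarrow> nat \<Rightarrow> (tensor \<Rightarrow> 'k) set"
  where "top_word R p = sym_relations R p p +>\<^bsub>sym_free R p p\<^esub> free_gen R [[0..<Suc p]]"

definition b_elem :: "('k, 'c) ring_scheme \<Rightarrow> nat \<Rightarrow> (tensor \<Rightarrow> 'k) set"
  where "b_elem R p = (\<Oplus>\<^bsub>sym_module R p p\<^esub>j\<in>{0..p}.
    ((\<ominus>\<^bsub>R\<^esub> \<one>\<^bsub>R\<^esub>) [^]\<^bsub>R\<^esub> (j * p)) \<odot>\<^bsub>sym_module R p p\<^esub>
      sym_action R p p (tau p ^^ j) (top_word R p))"

end

theory Submission
  imports Defs
begin

text \<open>
  In degree \<open>p\<close> a formal tensor is a single word \<open>z_{\<pi>(0)} ... z_{\<pi>(p)}\<close>, that is, a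
  permutation \<open>\<pi>\<close> of \<open>{0..p}\<close>. No two factors can be exchanged and there is nothing in degree
  \<open>p + 1\<close>, so the homology is the module of cycles among the functions \<open>f\<close> on permutations. Formally
  a class is the doubly nested singleton \<open>{{f}}\<close>, one layer for each of the two trivial quotients.

  For \<open>p > 0\<close>, a tensor in degree \<open>p - 1\<close> is a pair \<open>U \<otimes> V\<close> of words, identified up to sign with
  \<open>V \<otimes> U\<close>. As \<open>U\<close> and \<open>V\<close> have no letter in common, they are different, so these
  relations never force an element to equal its own negative, and the relation module consists exactly of the
  functions with the corresponding antisymmetry (\<open>pair_relations_iff\<close>). The coefficient of \<open>d f\<close>
  at \<open>U \<otimes> V\<close> is \<open>(-1)^(deg U) f(U V)\<close> (\<open>top_diff_apply\<close>), because there is only one way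
  to cut a word into \<open>U\<close> and \<open>V\<close>. Hence \<open>f\<close> is a cycle if and only if
  \<open>f(V U) = (-1)^(|U| p) f(U V)\<close> for all \<open>U\<close> and \<open>V\<close>. All these conditions follow from
  the one with \<open>|U| = 1\<close>: moving the first letter of a word to its end multiplies \<open>f\<close> by
  \<open>(-1)^p\<close> (\<open>top_cycle_iff_rotate\<close>).

  Rotating the word of a permutation amounts to multiplying the permutation on the right by a power of
  \<open>\<tau>_p\<close>, a \<open>(p+1)\<close>-cycle of sign \<open>(-1)^p\<close>. So the cycles are the functions with
  \<open>f(\<pi> c) = sgn(c) f(\<pi>)\<close> for \<open>c\<close> in the cyclic group \<open>C\<close>
  (\<open>top_cycles_cyclic\<close>). The element \<open>b_p\<close> is the function that equals the sign on \<open>C\<close>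
  and vanishes elsewhere (\<open>cyclic_sum_apply\<close>). Its translates \<open>t b_p\<close>, for \<open>t\<close> in a
  transversal of \<open>C\<close>, are supported on the different cosets \<open>t C\<close>, and every cycle is the sum of
  the \<open>f(t) (t b_p)\<close> (\<open>top_cycles_decomposition\<close>), which gives the generators.

  The group \<open>C\<close> acts on the line spanned by \<open>b_p\<close> by the sign character
  (\<open>relabel_cyclic_sum\<close>), and the module of cycles is the direct sum of the translates of this line. A
  representation that is the direct sum of the translates of an \<open>H\<close>-stable submodule along \<open>G/H\<close>
  is induced from that submodule (\<open>rep_isomorphic_induced\<close>).
\<close>

section \<open>Linear maps and transport of structure\<close>

lemma module_homsI:
  assumes "\<And>x. x \<in> carrier M \<Longrightarrow> f x \<in> carrier N"
    and "\<And>x y. x \<in> carrier M \<Longrightarrow> y \<in> carrier M \<Longrightarrow> f (x \<oplus>\<^bsub>M\<^esub> y) = f x \<oplus>\<^bsub>N\<^esub> f y"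
    and "\<And>a x. a \<in> carrier R \<Longrightarrow> x \<in> carrier M \<Longrightarrow> f (a \<odot>\<^bsub>M\<^esub> x) = a \<odot>\<^bsub>N\<^esub> f x"
  shows "f \<in> module_homs R M N"
  using assms by (auto simp: module_homs_def)

lemma
  assumes "f \<in> module_homs R M N"
  shows module_homs_closed: "x \<in> carrier M \<Longrightarrow> f x \<in> carrier N"
    and module_homs_add: "x \<in> carrier M \<Longrightarrow> y \<in> carrier M \<Longrightarrow> f (x \<oplus>\<^bsub>M\<^esub> y) = f x \<oplus>\<^bsub>N\<^esub> f y"
    and module_homs_smult: "a \<in> carrier R \<Longrightarrow> x \<in> carrier M \<Longrightarrow> f (a \<odot>\<^bsub>M\<^esub> x) = a \<odot>\<^bsub>N\<^esub> f x"
  using assms by (auto simp: module_homs_def)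

lemma module_homs_compose:
  assumes "f \<in> module_homs R L M" "g \<in> module_homs R M N"
  shows "(\<lambda>x. g (f x)) \<in> module_homs R L N"
  using assms by (auto simp: module_homs_def Pi_iff)

context
  fixes R (structure) and M (structure) and N (structure) and f
  assumes M: "module R M" and N: "module R N" and f: "f \<in> module_homs R M N"
begin

interpretation M: module R M by (rule M)
interpretation N: module R N by (rule N)

lemma module_homs_zero: "f \<zero>\<^bsub>M\<^esub> = \<zero>\<^bsub>N\<^esub>"
proof -
  have "f (\<zero> \<odot>\<^bsub>M\<^esub> \<zero>\<^bsub>M\<^esub>) = \<zero> \<odot>\<^bsub>N\<^esub> f \<zero>\<^bsub>M\<^esub>"
    by (rule module_homs_smult[OF f]) simp_all
  then show ?thesis
    using module_homs_closed[OF f, of "\<zero>\<^bsub>M\<^esub>"] by simp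
qed

lemma module_homs_uminus:
  assumes "x \<in> carrier M" shows "f (\<ominus>\<^bsub>M\<^esub> x) = \<ominus>\<^bsub>N\<^esub> f x"
proof -
  have "f ((\<ominus> \<one>) \<odot>\<^bsub>M\<^esub> x) = (\<ominus> \<one>) \<odot>\<^bsub>N\<^esub> f x"
    by (rule module_homs_smult[OF f]) (simp_all add: assms)
  then show ?thesis
    using assms module_homs_closed[OF f assms] by (simp add: M.smult_l_minus N.smult_l_minus)
qed

lemma module_homs_diff:
  assumes "x \<in> carrier M" "y \<in> carrier M" shows "f (x \<ominus>\<^bsub>M\<^esub> y) = f x \<ominus>\<^bsub>N\<^esub> f y"
  using assms by (simp add: a_minus_def module_homs_add[OF f] module_homs_uminus)

lemma module_homs_finsum:
  assumes "finite A" "g \<in> A \<rightarrow> carrier M"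
  shows "f (\<Oplus>\<^bsub>M\<^esub>x\<in>A. g x) = (\<Oplus>\<^bsub>N\<^esub>x\<in>A. f (g x))"
  using assms
proof (induction A)
  case empty
  then show ?case by (simp add: module_homs_zero)
next
  case (insert a A)
  then show ?case
    using module_homs_closed[OF f]
    by (simp add: M.finsum_insert N.finsum_insert module_homs_add[OF f] Pi_iff)
qed

lemma submodule_vimage:
  assumes "submodule H R N"
  shows "submodule {x \<in> carrier M. f x \<in> H} R M"
proof (rule M.submoduleI)
  note H = N.submoduleE[OF assms]
  obtain h where h: "h \<in> H" using H(2) by blast
  then have "\<zero>\<^bsub>N\<^esub> \<in> H" using H(1) H(4)[OF M.R.zero_closed h] by auto
  then show "\<zero>\<^bsub>M\<^esub> \<in> {x \<in> carrier M. f x \<in> H}" by (simp add: module_homs_zero)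
qed (use N.submoduleE[OF assms] in \<open>auto simp: module_homs_uminus module_homs_add[OF f] module_homs_smult[OF f]\<close>)

end

text \<open>A structure onto which a module maps compatibly with all operations is itself a module: the
  equations among the axioms carry over, and so do negatives. This covers quotients as well as renamings of elements. The zero has to be
  mentioned because the target is not yet known to be a group.\<close>

lemma module_onto:
  assumes M: "module R M"
    and onto: "\<phi> ` carrier M = carrier N"
    and add: "\<And>x y. x \<in> carrier M \<Longrightarrow> y \<in> carrier M \<Longrightarrow> \<phi> (x \<oplus>\<^bsub>M\<^esub> y) = \<phi> x \<oplus>\<^bsub>N\<^esub> \<phi> y"
    and smult: "\<And>a x. a \<in> carrier R \<Longrightarrow> x \<in> carrier M \<Longrightarrow> \<phi> (a \<odot>\<^bsub>M\<^esub> x) = a \<odot>\<^bsub>N\<^esub> \<phi> x"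
    and zero: "\<phi> \<zero>\<^bsub>M\<^esub> = \<zero>\<^bsub>N\<^esub>"
  shows "module R N"
proof -
  interpret M: module R M by (rule M)
  have ex: "\<exists>x'. x' \<in> carrier M \<and> x = \<phi> x'" if "x \<in> carrier N" for x
    using that onto by auto
  have cl: "\<phi> x \<in> carrier N" if "x \<in> carrier M" for x
    using that onto by auto
  show ?thesis
  proof (intro moduleI abelian_groupI)
    show "cring R" by (rule M.R.is_cring)
    show "\<zero>\<^bsub>N\<^esub> \<in> carrier N" using cl[OF M.M.zero_closed] zero by simp
  next
    fix x assume "x \<in> carrier N"
    then obtain x' where x: "x' \<in> carrier M" "x = \<phi> x'" using ex by blast
    show "\<zero>\<^bsub>N\<^esub> \<oplus>\<^bsub>N\<^esub> x = x"
      using add[OF M.M.zero_closed x(1)] x by (simp add: zero)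
    show "\<exists>y\<in>carrier N. y \<oplus>\<^bsub>N\<^esub> x = \<zero>\<^bsub>N\<^esub>"
      using add[of "\<ominus>\<^bsub>M\<^esub> x'" x'] x cl[of "\<ominus>\<^bsub>M\<^esub> x'"]
      by (intro bexI[of _ "\<phi> (\<ominus>\<^bsub>M\<^esub> x')"]) (simp_all add: M.M.l_neg zero)
    show "\<one>\<^bsub>R\<^esub> \<odot>\<^bsub>N\<^esub> x = x"
      using smult[OF M.R.one_closed x(1)] x by simp
    fix y assume "y \<in> carrier N"
    then obtain y' where y: "y' \<in> carrier M" "y = \<phi> y'" using ex by blast
    show "x \<oplus>\<^bsub>N\<^esub> y \<in> carrier N"
      using cl[of "x' \<oplus>\<^bsub>M\<^esub> y'"] x y by (simp add: add)
    show "x \<oplus>\<^bsub>N\<^esub> y = y \<oplus>\<^bsub>N\<^esub> x"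
      using add[OF x(1) y(1)] add[OF y(1) x(1)] x y by (simp add: M.M.add.m_comm)
    fix z assume "z \<in> carrier N"
    then obtain z' where z: "z' \<in> carrier M" "z = \<phi> z'" using ex by blast
    have "\<phi> (x' \<oplus>\<^bsub>M\<^esub> y' \<oplus>\<^bsub>M\<^esub> z') = \<phi> (x' \<oplus>\<^bsub>M\<^esub> (y' \<oplus>\<^bsub>M\<^esub> z'))"
      using x y z by (simp add: M.M.add.m_assoc)
    then show "x \<oplus>\<^bsub>N\<^esub> y \<oplus>\<^bsub>N\<^esub> z = x \<oplus>\<^bsub>N\<^esub> (y \<oplus>\<^bsub>N\<^esub> z)"
      using x y z by (simp add: add)
  next
    fix a x assume a: "a \<in> carrier R" and "x \<in> carrier N"
    then obtain x' where x: "x' \<in> carrier M" "x = \<phi> x'" using ex by blast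
    show "a \<odot>\<^bsub>N\<^esub> x \<in> carrier N"
      using cl[of "a \<odot>\<^bsub>M\<^esub> x'"] a x by (simp add: smult)
    show "a \<odot>\<^bsub>N\<^esub> (x \<oplus>\<^bsub>N\<^esub> y) = a \<odot>\<^bsub>N\<^esub> x \<oplus>\<^bsub>N\<^esub> a \<odot>\<^bsub>N\<^esub> y" if "y \<in> carrier N" for y
    proof -
      from ex[OF that] obtain y' where y: "y' \<in> carrier M" "y = \<phi> y'" by blast
      have "\<phi> (a \<odot>\<^bsub>M\<^esub> (x' \<oplus>\<^bsub>M\<^esub> y')) = \<phi> (a \<odot>\<^bsub>M\<^esub> x' \<oplus>\<^bsub>M\<^esub> a \<odot>\<^bsub>M\<^esub> y')"
        using a x y by (simp add: M.smult_r_distr)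
      then show ?thesis using a x y by (simp add: add smult)
    qed
    fix b assume b: "b \<in> carrier R"
    have "\<phi> ((a \<oplus>\<^bsub>R\<^esub> b) \<odot>\<^bsub>M\<^esub> x') = \<phi> (a \<odot>\<^bsub>M\<^esub> x' \<oplus>\<^bsub>M\<^esub> b \<odot>\<^bsub>M\<^esub> x')"
      using a b x by (simp add: M.smult_l_distr)
    then show "(a \<oplus>\<^bsub>R\<^esub> b) \<odot>\<^bsub>N\<^esub> x = a \<odot>\<^bsub>N\<^esub> x \<oplus>\<^bsub>N\<^esub> b \<odot>\<^bsub>N\<^esub> x"
      using a b x by (simp add: add smult)
    have "\<phi> ((a \<otimes>\<^bsub>R\<^esub> b) \<odot>\<^bsub>M\<^esub> x') = \<phi> (a \<odot>\<^bsub>M\<^esub> (b \<odot>\<^bsub>M\<^esub> x'))"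
      using a b x by (simp add: M.smult_assoc1)
    then show "(a \<otimes>\<^bsub>R\<^esub> b) \<odot>\<^bsub>N\<^esub> x = a \<odot>\<^bsub>N\<^esub> (b \<odot>\<^bsub>N\<^esub> x)"
      using a b x by (simp add: smult)
  qed
qed

text \<open>The same principle for representations. It saves a separate verification of the action axioms for
  induced modules and for homology.\<close>

lemma representation_onto:
  assumes M: "representation R G M \<rho>" and N: "module R N"
    and \<phi>: "\<phi> \<in> module_homs R M N"
    and onto: "\<phi> ` carrier M = carrier N"
    and equiv: "\<And>g x. g \<in> carrier G \<Longrightarrow> x \<in> carrier M \<Longrightarrow> \<sigma> g (\<phi> x) = \<phi> (\<rho> g x)"
  shows "representation R G N \<sigma>"
proof -
  interpret M: representation R G M \<rho> by (rule M)
  interpret N: module R N by (rule N)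
  have ex: "\<exists>x'. x' \<in> carrier M \<and> x = \<phi> x'" if "x \<in> carrier N" for x
    using that onto by auto
  note cl = module_homs_closed[OF \<phi>]
  show ?thesis
  proof (intro representation.intro representation_axioms.intro N M.grp.is_group module_homsI)
    fix g x y a
    assume g: "g \<in> carrier G"
    note lin = M.linear[OF g]
    assume "x \<in> carrier N"
    then obtain x' where x: "x' \<in> carrier M" "x = \<phi> x'" using ex by blast
    note gx = module_homs_closed[OF lin x(1)]
    show "\<sigma> g x \<in> carrier N"
      using x g cl[OF gx] by (simp add: equiv)
    show "\<sigma> g (x \<oplus>\<^bsub>N\<^esub> y) = \<sigma> g x \<oplus>\<^bsub>N\<^esub> \<sigma> g y" if y: "y \<in> carrier N"
    proof -
      from ex[OF y] obtain y' where y: "y' \<in> carrier M" "y = \<phi> y'" by blast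
      have "\<sigma> g (x \<oplus>\<^bsub>N\<^esub> y) = \<phi> (\<rho> g (x' \<oplus>\<^bsub>M\<^esub> y'))"
        using x y g by (simp add: equiv flip: module_homs_add[OF \<phi>])
      also have "\<dots> = \<phi> (\<rho> g x') \<oplus>\<^bsub>N\<^esub> \<phi> (\<rho> g y')"
        using x y module_homs_closed[OF lin]
        by (simp add: module_homs_add[OF \<phi>] module_homs_add[OF lin])
      finally show ?thesis using x y g by (simp add: equiv)
    qed
    show "\<sigma> g (a \<odot>\<^bsub>N\<^esub> x) = a \<odot>\<^bsub>N\<^esub> \<sigma> g x" if a: "a \<in> carrier R"
    proof -
      have "\<sigma> g (a \<odot>\<^bsub>N\<^esub> x) = \<phi> (\<rho> g (a \<odot>\<^bsub>M\<^esub> x'))"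
        using x a g by (simp add: equiv flip: module_homs_smult[OF \<phi>])
      also have "\<dots> = a \<odot>\<^bsub>N\<^esub> \<phi> (\<rho> g x')"
        using x a module_homs_closed[OF lin]
        by (simp add: module_homs_smult[OF \<phi>] module_homs_smult[OF lin])
      finally show ?thesis using x g by (simp add: equiv)
    qed
  next
    show "\<sigma> \<one>\<^bsub>G\<^esub> x = x" if "x \<in> carrier N" for x
      using ex[OF that] by (auto simp: equiv M.action_one)
    show "\<sigma> (g \<otimes>\<^bsub>G\<^esub> h) x = \<sigma> g (\<sigma> h x)" if "g \<in> carrier G" "h \<in> carrier G" "x \<in> carrier N" for g h x
    proof -
      from ex[OF that(3)] obtain x' where x: "x' \<in> carrier M" "x = \<phi> x'" by blast
      have "\<rho> h x' \<in> carrier M" by (rule module_homs_closed[OF M.linear[OF that(2)] x(1)])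
      then show ?thesis using x that(1,2) by (simp add: equiv M.action_mult)
    qed
  qed
qed

lemma subrepresentation:
  assumes M: "representation R G M \<rho>" and K: "submodule K R M"
    and stable: "\<And>g x. g \<in> carrier G \<Longrightarrow> x \<in> K \<Longrightarrow> \<rho> g x \<in> K"
  shows "representation R G (M\<lparr>carrier := K\<rparr>) \<rho>"
proof -
  interpret M: representation R G M \<rho> by (rule M)
  have sub: "x \<in> carrier M" if "x \<in> K" for x
    using M.submoduleE(1)[OF K] that by blast
  show ?thesis
  proof (intro representation.intro representation_axioms.intro submodule.submodule_is_module[OF K]
      M.module_axioms M.grp.is_group module_homsI)
    fix g x y a assume g: "g \<in> carrier G"
    note lin = M.linear[OF g]
    show "\<rho> g (x \<oplus>\<^bsub>M\<lparr>carrier := K\<rparr>\<^esub> y) = \<rho> g x \<oplus>\<^bsub>M\<lparr>carrier := K\<rparr>\<^esub> \<rho> g y"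
      if "x \<in> carrier (M\<lparr>carrier := K\<rparr>)" "y \<in> carrier (M\<lparr>carrier := K\<rparr>)"
      using that by (simp add: sub module_homs_add[OF lin])
    show "\<rho> g (a \<odot>\<^bsub>M\<lparr>carrier := K\<rparr>\<^esub> x) = a \<odot>\<^bsub>M\<lparr>carrier := K\<rparr>\<^esub> \<rho> g x"
      if "a \<in> carrier R" "x \<in> carrier (M\<lparr>carrier := K\<rparr>)"
      using that by (simp add: sub module_homs_smult[OF lin])
  qed (simp_all add: stable sub M.action_one M.action_mult)
qed

lemma rep_isomorphic_along:
  assumes iso: "rep_isomorphic R G M \<rho> N \<sigma>"
    and M': "module R M'" and q: "q \<in> module_homs R M M'"
    and bij: "bij_betw q (carrier M) (carrier M')"
    and equiv: "\<And>g x. g \<in> carrier G \<Longrightarrow> x \<in> carrier M \<Longrightarrow> \<rho>' g (q x) = q (\<rho> g x)"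
  shows "rep_isomorphic R G M' \<rho>' N \<sigma>"
proof -
  from iso obtain \<phi> where rep: "representation R G M \<rho>" "representation R G N \<sigma>"
    and \<phi>: "\<phi> \<in> module_homs R M N" "bij_betw \<phi> (carrier M) (carrier N)"
      "\<And>g x. g \<in> carrier G \<Longrightarrow> x \<in> carrier M \<Longrightarrow> \<phi> (\<rho> g x) = \<sigma> g (\<phi> x)"
    by (auto simp: rep_isomorphic_def)
  interpret M: representation R G M \<rho> by (rule rep)
  interpret M': module R M' by (rule M')
  define r where "r = inv_into (carrier M) q"
  have onto: "q ` carrier M = carrier M'" using bij by (simp add: bij_betw_def)
  have rq: "r (q x) = x" if "x \<in> carrier M" for x
    using bij that by (simp add: r_def bij_betw_inv_into_left)
  have ex: "\<exists>x'. x' \<in> carrier M \<and> x = q x'" if "x \<in> carrier M'" for x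
    using that onto by auto
  have r: "r \<in> module_homs R M' M"
  proof (rule module_homsI)
    fix a x y assume x: "x \<in> carrier M'"
    from ex[OF x] obtain x' where x: "x' \<in> carrier M" "x = q x'" by blast
    then show "r x \<in> carrier M" by (simp add: rq)
    show "r (x \<oplus>\<^bsub>M'\<^esub> y) = r x \<oplus>\<^bsub>M\<^esub> r y" if "y \<in> carrier M'"
    proof -
      from ex[OF that] obtain y' where y: "y' \<in> carrier M" "y = q y'" by blast
      have "r (x \<oplus>\<^bsub>M'\<^esub> y) = r (q (x' \<oplus>\<^bsub>M\<^esub> y'))"
        using x y by (simp add: module_homs_add[OF q])
      then show ?thesis using x y by (simp add: rq)
    qed
    show "r (a \<odot>\<^bsub>M'\<^esub> x) = a \<odot>\<^bsub>M\<^esub> r x" if "a \<in> carrier R"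
    proof -
      have "r (a \<odot>\<^bsub>M'\<^esub> x) = r (q (a \<odot>\<^bsub>M\<^esub> x'))"
        using x that by (simp add: module_homs_smult[OF q])
      then show ?thesis using x that by (simp add: rq)
    qed
  qed
  have "bij_betw (\<lambda>x. \<phi> (r x)) (carrier M') (carrier N)"
    using bij_betw_trans[OF bij_betw_inv_into[OF bij] \<phi>(2)] by (simp add: r_def comp_def)
  moreover have "\<forall>g\<in>carrier G. \<forall>x\<in>carrier M'. \<phi> (r (\<rho>' g x)) = \<sigma> g (\<phi> (r x))"
  proof (intro ballI)
    fix g x assume g: "g \<in> carrier G" and "x \<in> carrier M'"
    from ex[OF this(2)] obtain x' where x: "x' \<in> carrier M" "x = q x'" by blast
    have "\<rho> g x' \<in> carrier M" by (rule module_homs_closed[OF M.linear[OF g] x(1)])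
    then show "\<phi> (r (\<rho>' g x)) = \<sigma> g (\<phi> (r x))"
      using x g by (simp add: equiv rq \<phi>(3))
  qed
  ultimately have "\<exists>\<psi>\<in>module_homs R M' N. bij_betw \<psi> (carrier M') (carrier N) \<and>
      (\<forall>g\<in>carrier G. \<forall>x\<in>carrier M'. \<psi> (\<rho>' g x) = \<sigma> g (\<psi> x))"
    by (intro bexI[OF _ module_homs_compose[OF r \<phi>(1)]] conjI)
  moreover have "representation R G M' \<rho>'"
    by (rule representation_onto[OF rep(1) M' q onto]) (rule equiv)
  ultimately show ?thesis
    using rep(2) unfolding rep_isomorphic_def by (intro conjI)
qed

section \<open>Quotients by submodules\<close>

lemma submodule_imp_abelian_subgroup:
  assumes "module R M" "submodule N R M" shows "abelian_subgroup N M"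
proof -
  interpret module R M by fact
  show ?thesis
    by (intro abelian_subgroupI3 additive_subgroupI submodule.axioms(1)[OF assms(2)] abelian_group_axioms)
qed

context
  fixes R (structure) and M (structure) and N
  assumes M: "module R M" and N: "submodule N R M"
begin

interpretation M: module R M by (rule M)
interpretation N: abelian_subgroup N M by (rule submodule_imp_abelian_subgroup[OF M N])

lemma coset_eq_iff:
  assumes "x \<in> carrier M" "y \<in> carrier M"
  shows "N +>\<^bsub>M\<^esub> x = N +>\<^bsub>M\<^esub> y \<longleftrightarrow> x \<ominus>\<^bsub>M\<^esub> y \<in> N"
proof
  assume "N +>\<^bsub>M\<^esub> x = N +>\<^bsub>M\<^esub> y"
  then have "x \<in> N +>\<^bsub>M\<^esub> y"
    using N.a_rcos_self[OF assms(1)] by simp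
  then show "x \<ominus>\<^bsub>M\<^esub> y \<in> N"
    using assms by (simp add: a_minus_def N.a_rcos_module_imp)
next
  assume "x \<ominus>\<^bsub>M\<^esub> y \<in> N"
  then have "x \<in> N +>\<^bsub>M\<^esub> y"
    using assms by (simp add: a_minus_def N.a_rcos_module_rev)
  then show "N +>\<^bsub>M\<^esub> x = N +>\<^bsub>M\<^esub> y"
    using assms N.a_repr_independence'  by blast
qed


lemma coset_eq_self_iff:
  assumes x: "x \<in> carrier M" shows "N +>\<^bsub>M\<^esub> x = N \<longleftrightarrow> x \<in> N"
  using N.a_rcos_self[OF x] M.M.a_coset_join2[OF x submodule.axioms(1)[OF N]] by blast

lemma quot_module_ops:
  assumes "x \<in> carrier M"
  shows "y \<in> carrier M \<Longrightarrow>
      (N +>\<^bsub>M\<^esub> x) \<oplus>\<^bsub>quot_module M N\<^esub> (N +>\<^bsub>M\<^esub> y) = N +>\<^bsub>M\<^esub> (x \<oplus>\<^bsub>M\<^esub> y)"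
    and "a \<in> carrier R \<Longrightarrow> a \<odot>\<^bsub>quot_module M N\<^esub> (N +>\<^bsub>M\<^esub> x) = N +>\<^bsub>M\<^esub> (a \<odot>\<^bsub>M\<^esub> x)"
proof -
  show "(N +>\<^bsub>M\<^esub> x) \<oplus>\<^bsub>quot_module M N\<^esub> (N +>\<^bsub>M\<^esub> y) = N +>\<^bsub>M\<^esub> (x \<oplus>\<^bsub>M\<^esub> y)" if "y \<in> carrier M"
    using assms that by (simp add: quot_module_def N.a_rcos_sum)
  assume a: "a \<in> carrier R"
  have "N +>\<^bsub>M\<^esub> (a \<odot>\<^bsub>M\<^esub> x') = N +>\<^bsub>M\<^esub> (a \<odot>\<^bsub>M\<^esub> x)" if "x' \<in> N +>\<^bsub>M\<^esub> x" for x'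
  proof -
    have x': "x' \<in> carrier M" using that assms by (rule N.a_elemrcos_carrier[rotated 1])
    have "N +>\<^bsub>M\<^esub> x' = N +>\<^bsub>M\<^esub> x"
      using that assms N.a_repr_independence' by metis
    then have "x' \<ominus>\<^bsub>M\<^esub> x \<in> N" using x' assms by (simp add: coset_eq_iff)
    then have "a \<odot>\<^bsub>M\<^esub> (x' \<ominus>\<^bsub>M\<^esub> x) \<in> N" by (rule submodule.smult_closed[OF N a])
    then show ?thesis
      using a x' assms
      by (simp add: coset_eq_iff a_minus_def M.smult_r_distr M.smult_r_minus)
  qed
  then have "(\<Union>x'\<in>N +>\<^bsub>M\<^esub> x. N +>\<^bsub>M\<^esub> (a \<odot>\<^bsub>M\<^esub> x')) = (\<Union>x'\<in>N +>\<^bsub>M\<^esub> x. N +>\<^bsub>M\<^esub> (a \<odot>\<^bsub>M\<^esub> x))"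
    by (intro SUP_cong refl)
  then show "a \<odot>\<^bsub>quot_module M N\<^esub> (N +>\<^bsub>M\<^esub> x) = N +>\<^bsub>M\<^esub> (a \<odot>\<^bsub>M\<^esub> x)"
    using N.a_rcos_self[OF assms] by (simp add: quot_module_def) blast
qed

lemma quot_module_carrier: "(\<lambda>x. N +>\<^bsub>M\<^esub> x) ` carrier M = carrier (quot_module M N)"
  by (auto simp: quot_module_def A_RCOSETS_def')

lemma coset_hom: "(\<lambda>x. N +>\<^bsub>M\<^esub> x) \<in> module_homs R M (quot_module M N)"
  using quot_module_carrier by (intro module_homsI) (auto simp: quot_module_ops)

lemma module_quot_module: "module R (quot_module M N)"
proof (rule module_onto[OF M quot_module_carrier])
  show "N +>\<^bsub>M\<^esub> \<zero>\<^bsub>M\<^esub> = \<zero>\<^bsub>quot_module M N\<^esub>"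
    using N.a_subset by (simp add: quot_module_def)
qed (simp_all add: quot_module_ops)

end

text \<open>The union in the definition of \<open>quot_map\<close> is taken over equal cosets as soon as the map
  respects the submodules.\<close>

lemma quot_map_coset:
  fixes R (structure) and M (structure)
  assumes M: "module R M" and N: "submodule N R M"
    and N': "module R M'" "submodule N' R M'" and f: "f \<in> module_homs R M M'"
    and fN: "\<And>x. x \<in> N \<Longrightarrow> f x \<in> N'" and x: "x \<in> carrier M"
  shows "quot_map M' N' f (N +>\<^bsub>M\<^esub> x) = N' +>\<^bsub>M'\<^esub> f x"
proof -
  interpret N: abelian_subgroup N M by (rule submodule_imp_abelian_subgroup[OF M N])
  have "N' +>\<^bsub>M'\<^esub> f x' = N' +>\<^bsub>M'\<^esub> f x" if "x' \<in> N +>\<^bsub>M\<^esub> x" for x'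
  proof -
    have x': "x' \<in> carrier M" using that x by (rule N.a_elemrcos_carrier[rotated 1])
    have "N +>\<^bsub>M\<^esub> x' = N +>\<^bsub>M\<^esub> x"
      using that x N.a_repr_independence' by metis
    then have "x' \<ominus>\<^bsub>M\<^esub> x \<in> N" using x' x by (simp add: coset_eq_iff[OF M N])
    then have "f x' \<ominus>\<^bsub>M'\<^esub> f x \<in> N'"
      using fN x x' by (simp flip: module_homs_diff[OF M N'(1) f])
    then show ?thesis
      using x x' module_homs_closed[OF f] by (simp add: coset_eq_iff[OF N'])
  qed
  then have "(\<Union>x'\<in>N +>\<^bsub>M\<^esub> x. N' +>\<^bsub>M'\<^esub> f x') = (\<Union>x'\<in>N +>\<^bsub>M\<^esub> x. N' +>\<^bsub>M'\<^esub> f x)"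
    by (intro SUP_cong refl)
  then show ?thesis using N.a_rcos_self[OF x] unfolding quot_map_def by auto
qed


text \<open>Quotients by the zero submodule: the cosets are singletons, so dividing by nothing only wraps the
  elements into braces.\<close>

lemma singleton_coset:
  fixes R (structure) and M (structure)
  assumes M: "module R M" and x: "x \<in> carrier M" shows "{\<zero>\<^bsub>M\<^esub>} +>\<^bsub>M\<^esub> x = {x}"
proof -
  interpret module R M by (rule M)
  show ?thesis using x by (simp add: a_r_coset_def')
qed

lemma submodule_trivial:
  fixes R (structure) and M (structure)
  assumes M: "module R M" shows "submodule {\<zero>\<^bsub>M\<^esub>} R M"
proof -
  interpret module R M by (rule M)
  show ?thesis by (rule submoduleI) auto
qed

lemma
  fixes R (structure) and M (structure)
  assumes M: "module R M"
  shows quot_trivial_hom: "(\<lambda>x. {x}) \<in> module_homs R M (quot_module M {\<zero>\<^bsub>M\<^esub>})"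
    and quot_trivial_carrier: "carrier (quot_module M {\<zero>\<^bsub>M\<^esub>}) = (\<lambda>x. {x}) ` carrier M"
proof -
  interpret module R M by (rule M)
  note S = submodule_trivial[OF M]
  have eq: "{\<zero>\<^bsub>M\<^esub>} +>\<^bsub>M\<^esub> x = {x}" if "x \<in> carrier M" for x by (rule singleton_coset[OF M that])
  show "carrier (quot_module M {\<zero>\<^bsub>M\<^esub>}) = (\<lambda>x. {x}) ` carrier M"
    unfolding quot_module_carrier[OF M S, symmetric] by (intro image_cong refl eq)
  show "(\<lambda>x. {x}) \<in> module_homs R M (quot_module M {\<zero>\<^bsub>M\<^esub>})"
    using coset_hom[OF M S] by (simp add: module_homs_def Pi_iff eq)
qed

section \<open>Spans\<close>

lemma span_superset: "S \<subseteq> module_span R M S"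
  by (auto simp: module_span_def)

lemma span_minimal: "submodule N R M \<Longrightarrow> S \<subseteq> N \<Longrightarrow> module_span R M S \<subseteq> N"
  by (auto simp: module_span_def)

lemma span_subset_carrier:
  assumes "module R M" "S \<subseteq> carrier M" shows "module_span R M S \<subseteq> carrier M"
  using assms by (intro span_minimal module.carrier_is_submodule)

lemma submodule_zero:
  fixes R (structure) and M (structure)
  assumes "module R M" "submodule N R M" shows "\<zero>\<^bsub>M\<^esub> \<in> N"
proof -
  interpret abelian_subgroup N M by (rule submodule_imp_abelian_subgroup[OF assms])
  show ?thesis by simp
qed

lemma submodule_span:
  fixes R (structure) and M (structure)
  assumes M: "module R M" and S: "S \<subseteq> carrier M"
  shows "submodule (module_span R M S) R M"
proof -
  interpret module R M by (rule M)
  show ?thesis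
  proof (rule submoduleI)
    show "module_span R M S \<subseteq> carrier M" by (rule span_subset_carrier[OF M S])
  qed (auto simp: module_span_def submodule_zero[OF M] submoduleE submodule.smult_closed)
qed

lemma span_empty:
  fixes R (structure) and M (structure)
  assumes M: "module R M" shows "module_span R M {} = {\<zero>\<^bsub>M\<^esub>}"
proof -
  interpret module R M by (rule M)
  have "submodule {\<zero>\<^bsub>M\<^esub>} R M" by (rule submoduleI) auto
  then show ?thesis
    using span_minimal[of "{\<zero>\<^bsub>M\<^esub>}" R M "{}"] submodule_zero[OF M submodule_span[OF M, of "{}"]] by auto
qed

lemma hom_image_span:
  assumes M: "module R M" and N: "module R N" and f: "f \<in> module_homs R M N"
    and H: "submodule H R N" and S: "S \<subseteq> carrier M" "\<And>x. x \<in> S \<Longrightarrow> f x \<in> H"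
    and x: "x \<in> module_span R M S"
  shows "f x \<in> H"
  using span_minimal[OF submodule_vimage[OF M N f H], of S] S x by blast

lemma submodule_finsum:
  assumes M: "module R M" and N: "submodule N R M" and "finite A" "\<And>x. x \<in> A \<Longrightarrow> g x \<in> N"
  shows "(\<Oplus>\<^bsub>M\<^esub>x\<in>A. g x) \<in> N"
proof -
  interpret module R M by (rule M)
  note sub = submoduleE[OF N]
  show ?thesis using assms(3,4)
  proof (induction A)
    case empty
    then show ?case by (simp add: submodule_zero[OF M N])
  next
    case (insert a A)
    have "g a \<in> carrier M" "g \<in> A \<rightarrow> carrier M" using insert.prems sub(1) by auto
    then show ?case using insert sub(5) by (simp add: M.finsum_insert)
  qed
qed

section \<open>Free modules\<close>

context
  fixes R (structure)
  assumes R: "cring R"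
begin

interpretation R: cring R by (rule R)

lemma free_module_carrier_iff:
  "f \<in> carrier (free_module R X) \<longleftrightarrow>
    (\<forall>x. f x \<in> carrier R) \<and> (\<forall>x. x \<notin> X \<longrightarrow> f x = \<zero>) \<and> finite {x. f x \<noteq> \<zero>}"
  by (auto simp: free_module_def)

lemma free_module_value: "f \<in> carrier (free_module R X) \<Longrightarrow> f x \<in> carrier R"
  by (simp add: free_module_carrier_iff)

lemma free_module_ops:
  "\<zero>\<^bsub>free_module R X\<^esub> = (\<lambda>x. \<zero>)"
  "f \<oplus>\<^bsub>free_module R X\<^esub> g = (\<lambda>x. f x \<oplus> g x)"
  "a \<odot>\<^bsub>free_module R X\<^esub> f = (\<lambda>x. a \<otimes> f x)"
  by (simp_all add: free_module_def)

lemma module_free_module: "module R (free_module R X)"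
proof (intro moduleI abelian_groupI)
  fix f g assume f: "f \<in> carrier (free_module R X)" and g: "g \<in> carrier (free_module R X)"
  have "finite {x. f x \<oplus> g x \<noteq> \<zero>}"
    using f g by (rule_tac finite_subset[of _ "{x. f x \<noteq> \<zero>} \<union> {x. g x \<noteq> \<zero>}"])
      (auto simp: free_module_carrier_iff)
  then show "f \<oplus>\<^bsub>free_module R X\<^esub> g \<in> carrier (free_module R X)"
    using f g by (auto simp: free_module_carrier_iff free_module_ops)
next
  fix f assume f: "f \<in> carrier (free_module R X)"
  show "\<exists>g\<in>carrier (free_module R X). g \<oplus>\<^bsub>free_module R X\<^esub> f = \<zero>\<^bsub>free_module R X\<^esub>"
  proof
    have "finite {x. \<ominus> f x \<noteq> \<zero>}"
      using f by (rule_tac finite_subset[of _ "{x. f x \<noteq> \<zero>}"])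
        (auto simp: free_module_carrier_iff)
    then show "(\<lambda>x. \<ominus> f x) \<in> carrier (free_module R X)"
      using f by (auto simp: free_module_carrier_iff)
  qed (use f in \<open>auto simp: free_module_ops free_module_carrier_iff R.l_neg\<close>)
next
  fix a f assume a: "a \<in> carrier R" and f: "f \<in> carrier (free_module R X)"
  have "finite {x. a \<otimes> f x \<noteq> \<zero>}"
    using f a by (rule_tac finite_subset[of _ "{x. f x \<noteq> \<zero>}"]) (auto simp: free_module_carrier_iff)
  then show "a \<odot>\<^bsub>free_module R X\<^esub> f \<in> carrier (free_module R X)"
    using f a by (auto simp: free_module_carrier_iff free_module_ops)
qed (auto simp: free_module_carrier_iff free_module_ops R.a_assoc R.a_comm R.a_lcomm R.l_distr R.r_distr
      R.m_assoc R.is_cring)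

lemma free_gen_closed: "x \<in> X \<Longrightarrow> free_gen R x \<in> carrier (free_module R X)"
proof -
  assume "x \<in> X"
  moreover have "finite {y. free_gen R x y \<noteq> \<zero>}"
    by (rule finite_subset[of _ "{x}"]) (auto simp: free_gen_def)
  ultimately show ?thesis by (auto simp: free_module_carrier_iff free_gen_def)
qed

lemma free_module_eval_hom: "(\<lambda>f. f x) \<in> module_homs R (free_module R X) (regular_module R)"
  by (intro module_homsI) (auto simp: free_module_ops regular_module_def free_module_value)

lemma module_regular_module: "module R (regular_module R)"
  by (intro moduleI abelian_groupI)
     (auto simp: regular_module_def R.a_assoc R.a_comm R.a_lcomm R.l_distr R.r_distr R.m_assoc R.is_cring R.l_neg
       intro: R.l_neg exI[of _ "\<ominus> _"])

lemma finsum_regular_module: "finsum (regular_module R) f A = finsum R f A"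
  by (simp add: finsum_def finprod_def regular_module_def)

lemma finsum_free_module:
  assumes "finite A" "g \<in> A \<rightarrow> carrier (free_module R X)"
  shows "(\<Oplus>\<^bsub>free_module R X\<^esub>i\<in>A. g i) x = (\<Oplus>i\<in>A. g i x)"
  using module_homs_finsum[OF module_free_module module_regular_module free_module_eval_hom assms]
  by (simp add: finsum_regular_module)

lemma free_module_minus:
  assumes "f \<in> carrier (free_module R X)" "g \<in> carrier (free_module R X)"
  shows "(f \<ominus>\<^bsub>free_module R X\<^esub> g) x = f x \<ominus> g x"
proof -
  have "h x \<ominus>\<^bsub>regular_module R\<^esub> h' x = h x \<ominus> h' x" for h h'
    by (simp add: a_minus_def a_inv_def m_inv_def regular_module_def)
  then show ?thesis
  using module_homs_diff[OF module_free_module module_regular_module free_module_eval_hom assms]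
  by simp
qed

text \<open>Sums against a Kronecker delta. The factor \<open>f x\<close> is kept outside of the case distinction,
  because this is the form in which values of free generators occur.\<close>

lemma finsum_delta:
  assumes "finite A" "\<And>x. x \<in> A \<Longrightarrow> f x \<in> carrier R"
  shows "(\<Oplus>x\<in>A. f x \<otimes> (if x = y then \<one> else \<zero>)) = (if y \<in> A then f y else \<zero>)"
proof -
  have "(\<Oplus>x\<in>A. f x \<otimes> (if x = y then \<one> else \<zero>)) = (\<Oplus>x\<in>A. if x = y then f x else \<zero>)"
    using assms by (intro R.finsum_cong') auto
  also have "\<dots> = (if y \<in> A then f y else \<zero>)"
  proof (cases "y \<in> A")
    case True
    then show ?thesis
      using R.finsum_singleton[of y A f] assms by (auto simp: Pi_iff eq_commute[of _ y])
  next
    case False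
    have "(\<Oplus>x\<in>A. if x = y then f x else \<zero>) = \<zero>"
      by (rule R.add.finprod_one_eqI) (use False in auto)
    with False show ?thesis by simp
  qed
  finally show ?thesis .
qed

lemma free_module_expansion:
  assumes "f \<in> carrier (free_module R X)"
  shows "f = (\<Oplus>\<^bsub>free_module R X\<^esub>x\<in>{x. f x \<noteq> \<zero>}. f x \<odot>\<^bsub>free_module R X\<^esub> free_gen R x)"
proof
  interpret F: module R "free_module R X" by (rule module_free_module)
  have S: "finite {x. f x \<noteq> \<zero>}" "{x. f x \<noteq> \<zero>} \<subseteq> X"
    using assms by (auto simp: free_module_carrier_iff)
  fix y
  have "(\<Oplus>\<^bsub>free_module R X\<^esub>x\<in>{x. f x \<noteq> \<zero>}. f x \<odot>\<^bsub>free_module R X\<^esub> free_gen R x) y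
      = (\<Oplus>x\<in>{x. f x \<noteq> \<zero>}. (f x \<odot>\<^bsub>free_module R X\<^esub> free_gen R x) y)"
    using S assms by (intro finsum_free_module)
      (auto intro!: F.smult_closed free_gen_closed simp: free_module_value)
  also have "\<dots> = (\<Oplus>x\<in>{x. f x \<noteq> \<zero>}. f x \<otimes> (if x = y then \<one> else \<zero>))"
    by (simp add: free_module_ops free_gen_def eq_commute)
  also have "\<dots> = f y"
    using S assms by (subst finsum_delta) (auto simp: free_module_value)
  finally show "f y = (\<Oplus>\<^bsub>free_module R X\<^esub>x\<in>{x. f x \<noteq> \<zero>}. f x \<odot>\<^bsub>free_module R X\<^esub> free_gen R x) y" ..
qed

text \<open>Linear maps on a free module are determined by the generators. Applied to evaluations at a point,
  this replaces most computations with sums over supports below.\<close>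

lemma hom_free_module_eqI:
  assumes N: "module R N"
    and f: "f \<in> module_homs R (free_module R X) N" and g: "g \<in> module_homs R (free_module R X) N"
    and eq: "\<And>x. x \<in> X \<Longrightarrow> f (free_gen R x) = g (free_gen R x)"
    and v: "v \<in> carrier (free_module R X)"
  shows "f v = g v"
proof -
  let ?F = "free_module R X" and ?S = "{x. v x \<noteq> \<zero>}"
  interpret F: module R ?F by (rule module_free_module)
  interpret N: module R N by (rule N)
  have S: "finite ?S" "?S \<subseteq> X" using v by (auto simp: free_module_carrier_iff)
  have expand: "h v = (\<Oplus>\<^bsub>N\<^esub>x\<in>?S. v x \<odot>\<^bsub>N\<^esub> h (free_gen R x))" if h: "h \<in> module_homs R ?F N" for h
  proof -
    have c: "(\<lambda>x. v x \<odot>\<^bsub>?F\<^esub> free_gen R x) \<in> ?S \<rightarrow> carrier ?F"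
      using S v by (auto intro!: F.smult_closed free_gen_closed simp: free_module_value)
    have "h v = h (\<Oplus>\<^bsub>?F\<^esub>x\<in>?S. v x \<odot>\<^bsub>?F\<^esub> free_gen R x)"
      by (subst free_module_expansion[OF v]) (rule refl)
    also have "\<dots> = (\<Oplus>\<^bsub>N\<^esub>x\<in>?S. h (v x \<odot>\<^bsub>?F\<^esub> free_gen R x))"
      by (rule module_homs_finsum[OF F.module_axioms N h S(1) c])
    also have "\<dots> = (\<Oplus>\<^bsub>N\<^esub>x\<in>?S. v x \<odot>\<^bsub>N\<^esub> h (free_gen R x))"
      using S v free_gen_closed[of _ X]
      by (intro N.finsum_cong' N.smult_closed Pi_I module_homs_smult[OF h] module_homs_closed[OF h])
         (auto simp: free_module_value)
    finally show ?thesis .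
  qed
  show ?thesis
    unfolding expand[OF f] expand[OF g]
    using S v eq free_gen_closed[of _ X]
    by (intro N.finsum_cong' N.smult_closed Pi_I module_homs_closed[OF g]) (auto simp: free_module_value)
qed

context
  fixes M (structure) and f X
  assumes M: "module R M" and f: "\<And>x. x \<in> X \<Longrightarrow> f x \<in> carrier M"
begin

interpretation M: module R M by (rule M)

text \<open>The sum that defines \<open>lin_ext\<close> runs over the support, which depends on the argument. To
  compare the values at two arguments, both sums are taken over a common larger set.\<close>

lemma lin_ext_support:
  assumes "v \<in> carrier (free_module R X)" "finite S" "S \<subseteq> X" "\<And>x. x \<notin> S \<Longrightarrow> v x = \<zero>"
  shows "lin_ext R M f v = (\<Oplus>\<^bsub>M\<^esub>x\<in>S. v x \<odot>\<^bsub>M\<^esub> f x)"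
  unfolding lin_ext_def
  using assms f by (intro M.add.finprod_mono_neutral_cong_left) (auto simp: free_module_value)

lemma lin_ext_hom: "lin_ext R M f \<in> module_homs R (free_module R X) M"
proof (rule module_homsI)
  let ?F = "free_module R X"
  interpret F: module R ?F by (rule module_free_module)
  have supp: "finite {x. v x \<noteq> \<zero>}" "{x. v x \<noteq> \<zero>} \<subseteq> X" if "v \<in> carrier ?F" for v
    using that by (auto simp: free_module_carrier_iff)
  fix v w a assume v: "v \<in> carrier ?F"
  show "lin_ext R M f v \<in> carrier M"
    unfolding lin_ext_def using v supp[OF v] f
    by (intro M.finsum_closed) (auto simp: free_module_value)
  show "lin_ext R M f (v \<oplus>\<^bsub>?F\<^esub> w) = lin_ext R M f v \<oplus>\<^bsub>M\<^esub> lin_ext R M f w" if w: "w \<in> carrier ?F"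
  proof -
    define S where "S = {x. v x \<noteq> \<zero>} \<union> {x. w x \<noteq> \<zero>}"
    have S: "finite S" "S \<subseteq> X" using supp[OF v] supp[OF w] by (auto simp: S_def)
    have vw: "v \<oplus>\<^bsub>?F\<^esub> w \<in> carrier ?F" using v w by simp
    have "lin_ext R M f (v \<oplus>\<^bsub>?F\<^esub> w) = (\<Oplus>\<^bsub>M\<^esub>x\<in>S. (v x \<oplus> w x) \<odot>\<^bsub>M\<^esub> f x)"
      by (subst lin_ext_support[OF vw S]) (auto simp: S_def free_module_ops)
    also have "\<dots> = (\<Oplus>\<^bsub>M\<^esub>x\<in>S. v x \<odot>\<^bsub>M\<^esub> f x \<oplus>\<^bsub>M\<^esub> w x \<odot>\<^bsub>M\<^esub> f x)"
      using S f v w by (intro M.finsum_cong') (auto simp: free_module_value M.smult_l_distr)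
    also have "\<dots> = (\<Oplus>\<^bsub>M\<^esub>x\<in>S. v x \<odot>\<^bsub>M\<^esub> f x) \<oplus>\<^bsub>M\<^esub> (\<Oplus>\<^bsub>M\<^esub>x\<in>S. w x \<odot>\<^bsub>M\<^esub> f x)"
      using S f v w by (intro M.finsum_addf) (auto simp: free_module_value)
    also have "\<dots> = lin_ext R M f v \<oplus>\<^bsub>M\<^esub> lin_ext R M f w"
      by (subst (1 2) lin_ext_support[OF _ S]) (auto simp: S_def v w)
    finally show ?thesis .
  qed
  show "lin_ext R M f (a \<odot>\<^bsub>?F\<^esub> v) = a \<odot>\<^bsub>M\<^esub> lin_ext R M f v" if a: "a \<in> carrier R"
  proof -
    have av: "a \<odot>\<^bsub>?F\<^esub> v \<in> carrier ?F" using v a by simp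
    have "lin_ext R M f (a \<odot>\<^bsub>?F\<^esub> v) = (\<Oplus>\<^bsub>M\<^esub>x\<in>{x. v x \<noteq> \<zero>}. (a \<otimes> v x) \<odot>\<^bsub>M\<^esub> f x)"
      by (subst lin_ext_support[OF av supp[OF v]]) (auto simp: free_module_ops a)
    also have "\<dots> = (\<Oplus>\<^bsub>M\<^esub>x\<in>{x. v x \<noteq> \<zero>}. a \<odot>\<^bsub>M\<^esub> (v x \<odot>\<^bsub>M\<^esub> f x))"
      using supp[OF v] f v a by (intro M.finsum_cong') (auto simp: free_module_value M.smult_assoc1)
    also have "\<dots> = a \<odot>\<^bsub>M\<^esub> (\<Oplus>\<^bsub>M\<^esub>x\<in>{x. v x \<noteq> \<zero>}. v x \<odot>\<^bsub>M\<^esub> f x)"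
      using supp[OF v] f v a by (intro M.finsum_smult_ldistr[symmetric]) (auto simp: free_module_value)
    finally show ?thesis by (simp add: lin_ext_def)
  qed
qed

lemma lin_ext_free_gen:
  assumes "x \<in> X" shows "lin_ext R M f (free_gen R x) = f x"
  using assms f by (subst lin_ext_support[OF free_gen_closed, of x "{x}"])
    (auto simp: free_gen_def M.finsum_insert)

end

lemma representation_free_module:
  assumes G: "group G"
    and cl: "\<And>g x. g \<in> carrier G \<Longrightarrow> x \<in> X \<Longrightarrow> \<beta> g x \<in> X"
    and one: "\<And>x. x \<in> X \<Longrightarrow> \<beta> \<one>\<^bsub>G\<^esub> x = x"
    and mult: "\<And>g h x. g \<in> carrier G \<Longrightarrow> h \<in> carrier G \<Longrightarrow> x \<in> X \<Longrightarrow> \<beta> (g \<otimes>\<^bsub>G\<^esub> h) x = \<beta> g (\<beta> h x)"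
  shows "representation R G (free_module R X)
    (\<lambda>g. lin_ext R (free_module R X) (\<lambda>x. free_gen R (\<beta> g x)))"
proof -
  let ?F = "free_module R X" and ?A = "\<lambda>g. lin_ext R (free_module R X) (\<lambda>x. free_gen R (\<beta> g x))"
  interpret G: group G by (rule G)
  have hom: "?A g \<in> module_homs R ?F ?F" if "g \<in> carrier G" for g
    by (intro lin_ext_hom module_free_module free_gen_closed cl that)
  have gen: "?A g (free_gen R x) = free_gen R (\<beta> g x)" if "g \<in> carrier G" "x \<in> X" for g x
    by (intro lin_ext_free_gen[where X = X] module_free_module free_gen_closed cl that)
  have id: "(\<lambda>v. v) \<in> module_homs R ?F ?F" by (rule module_homsI) simp_all
  show ?thesis
  proof (intro representation.intro representation_axioms.intro module_free_module G hom)
    show "?A \<one>\<^bsub>G\<^esub> v = v" if "v \<in> carrier ?F" for v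
      using hom_free_module_eqI[OF module_free_module hom[OF G.one_closed] id _ that]
      by (simp add: gen one)
    show "?A (g \<otimes>\<^bsub>G\<^esub> h) v = ?A g (?A h v)"
      if g: "g \<in> carrier G" and h: "h \<in> carrier G" and v: "v \<in> carrier ?F" for g h v
      by (rule hom_free_module_eqI[OF module_free_module hom[OF G.m_closed[OF g h]]
            module_homs_compose[OF hom[OF h] hom[OF g]] _ v])
         (simp add: gen mult cl g h)
  qed
qed

end

section \<open>Recognizing an induced representation\<close>

lemma left_transversal_exists:
  assumes G: "group G" and H: "subgroup H G"
  shows "\<exists>T. left_transversal G H T"
proof
  interpret G: group G by (rule G)
  let ?r = "\<lambda>X. SOME x. x \<in> X"
  have r: "?r X \<in> X" if "X \<in> lcosets\<^bsub>G\<^esub> H" for X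
  proof -
    from that obtain a where "a \<in> carrier G" "X = a <#\<^bsub>G\<^esub> H" by (auto simp: LCOSETS_def)
    then have "a \<in> X" using G.lcos_self[OF _ H] by simp
    then show ?thesis by (rule someI)
  qed
  show "left_transversal G H (?r ` (lcosets\<^bsub>G\<^esub> H))"
    unfolding left_transversal_def
  proof (intro conjI ballI)
    show "?r ` (lcosets\<^bsub>G\<^esub> H) \<subseteq> carrier G"
      using r subgroup.lcosets_carrier[OF H G] by blast
    fix X assume X: "X \<in> lcosets\<^bsub>G\<^esub> H"
    show "\<exists>!t. t \<in> ?r ` (lcosets\<^bsub>G\<^esub> H) \<inter> X"
    proof (rule ex1I[of _ "?r X"])
      show "?r X \<in> ?r ` (lcosets\<^bsub>G\<^esub> H) \<inter> X" using X r by blast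
      fix t assume "t \<in> ?r ` (lcosets\<^bsub>G\<^esub> H) \<inter> X"
      then obtain Y where Y: "Y \<in> lcosets\<^bsub>G\<^esub> H" "t = ?r Y" "t \<in> X" by blast
      then have "Y = X" using G.lcos_disjoint[OF H Y(1) X] r[OF Y(1)] by blast
      then show "t = ?r X" using Y by simp
    qed
  qed
qed

text \<open>The representative \<open>t\<close> of the coset of \<open>g\<close> is described by \<open>t\<inverse> g \<in> H\<close>,
  the form in which translates of functions on the group produce it.\<close>

lemma left_transversal_unique:
  assumes G: "group G" and H: "subgroup H G" and T: "left_transversal G H T" and g: "g \<in> carrier G"
  shows "\<exists>!t. t \<in> T \<and> inv\<^bsub>G\<^esub> t \<otimes>\<^bsub>G\<^esub> g \<in> H"
proof -
  interpret G: group G by (rule G)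
  interpret H: subgroup H G by (rule H)
  have "t \<in> g <#\<^bsub>G\<^esub> H \<longleftrightarrow> inv\<^bsub>G\<^esub> t \<otimes>\<^bsub>G\<^esub> g \<in> H" if t: "t \<in> T" for t
  proof -
    have tG: "t \<in> carrier G" using t T by (auto simp: left_transversal_def)
    have "t \<in> g <#\<^bsub>G\<^esub> H \<longleftrightarrow> g <#\<^bsub>G\<^esub> H = t <#\<^bsub>G\<^esub> H"
      using G.lcos_self[OF tG H] G.l_repr_independence[OF _ g H] by blast
    also have "\<dots> \<longleftrightarrow> g \<in> t <#\<^bsub>G\<^esub> H"
      using G.lcos_self[OF g H] G.l_repr_independence[OF _ tG H] by blast
    also have "\<dots> \<longleftrightarrow> inv\<^bsub>G\<^esub> t \<otimes>\<^bsub>G\<^esub> g \<in> H"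
      using H.lcos_module_imp[OF G tG] H.lcos_module_rev[OF G tG g] by blast
    finally show ?thesis .
  qed
  moreover have "g <#\<^bsub>G\<^esub> H \<in> lcosets\<^bsub>G\<^esub> H" using g by (auto simp: LCOSETS_def)
  ultimately show ?thesis
    using T unfolding left_transversal_def by (metis Int_iff)
qed

locale induction_data =
  fixes R (structure) and G (structure) and W (structure) and H and \<omega>
  assumes R: "cring R" and G: "group G" and H: "subgroup H G" and W: "module R W"
    and \<omega>: "\<And>h x. h \<in> H \<Longrightarrow> x \<in> carrier W \<Longrightarrow> \<omega> h x \<in> carrier W"
begin

interpretation R: cring R by (rule R)
interpretation G: group G by (rule G)
interpretation H: subgroup H G by (rule H)
interpretation W: module R W by (rule W)

abbreviation "F \<equiv> free_module R (carrier G \<times> carrier W)"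
abbreviation "N \<equiv> induced_relations R G H W \<omega>"
abbreviation "I \<equiv> induced_module R G H W \<omega>"
abbreviation "gen g x \<equiv> free_gen R (g, x)"
abbreviation "pure g x \<equiv> N +>\<^bsub>F\<^esub> gen g x"
abbreviation "act g \<equiv> lin_ext R F (\<lambda>x. free_gen R (g \<otimes>\<^bsub>G\<^esub> fst x, snd x))"

interpretation F: module R F by (rule module_free_module[OF R])

lemma gen_closed: "g \<in> carrier G \<Longrightarrow> x \<in> carrier W \<Longrightarrow> gen g x \<in> carrier F"
  by (rule free_gen_closed[OF R]) simp

lemma induced_relations_submodule: "submodule N R F"
  unfolding induced_relations_def Let_def
  by (rule submodule_span[OF F.module_axioms])
     (auto intro!: F.M.minus_closed F.M.add.m_closed F.smult_closed gen_closed \<omega>)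

lemma gen_relations:
  assumes "g \<in> carrier G" "x \<in> carrier W"
  shows gen_add: "y \<in> carrier W \<Longrightarrow> gen g (x \<oplus>\<^bsub>W\<^esub> y) \<ominus>\<^bsub>F\<^esub> (gen g x \<oplus>\<^bsub>F\<^esub> gen g y) \<in> N"
    and gen_smult: "a \<in> carrier R \<Longrightarrow> gen g (a \<odot>\<^bsub>W\<^esub> x) \<ominus>\<^bsub>F\<^esub> a \<odot>\<^bsub>F\<^esub> gen g x \<in> N"
    and gen_balanced: "h \<in> H \<Longrightarrow> gen (g \<otimes>\<^bsub>G\<^esub> h) x \<ominus>\<^bsub>F\<^esub> gen g (\<omega> h x) \<in> N"
  unfolding induced_relations_def Let_def
  by (rule subsetD[OF span_superset]; use assms in blast)+

text \<open>The universal property of the induced module, relative to a submodule \<open>K\<close> of the target. With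
  \<open>K = 0\<close> it yields maps out of the induced module; with \<open>K\<close> the relations themselves it shows
  that the group acts on the quotient.\<close>

lemma hom_induced_relations:
  assumes V: "module R V" and f: "f \<in> module_homs R F V" and K: "submodule K R V"
    and add: "\<And>g x y. g \<in> carrier G \<Longrightarrow> x \<in> carrier W \<Longrightarrow> y \<in> carrier W \<Longrightarrow>
      f (gen g (x \<oplus>\<^bsub>W\<^esub> y)) \<ominus>\<^bsub>V\<^esub> (f (gen g x) \<oplus>\<^bsub>V\<^esub> f (gen g y)) \<in> K"
    and smult: "\<And>g a x. g \<in> carrier G \<Longrightarrow> a \<in> carrier R \<Longrightarrow> x \<in> carrier W \<Longrightarrow>
      f (gen g (a \<odot>\<^bsub>W\<^esub> x)) \<ominus>\<^bsub>V\<^esub> a \<odot>\<^bsub>V\<^esub> f (gen g x) \<in> K"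
    and balanced: "\<And>g h x. g \<in> carrier G \<Longrightarrow> h \<in> H \<Longrightarrow> x \<in> carrier W \<Longrightarrow>
      f (gen (g \<otimes>\<^bsub>G\<^esub> h) x) \<ominus>\<^bsub>V\<^esub> f (gen g (\<omega> h x)) \<in> K"
    and v: "v \<in> N"
  shows "f v \<in> K"
proof (rule hom_image_span[OF F.module_axioms V f K _ _ v[unfolded induced_relations_def Let_def]])
  note [simp] = module_homs_diff[OF F.module_axioms V f] module_homs_add[OF f] module_homs_smult[OF f]
    gen_closed \<omega>
  fix u
  assume "u \<in> {gen g (x \<oplus>\<^bsub>W\<^esub> y) \<ominus>\<^bsub>F\<^esub> (gen g x \<oplus>\<^bsub>F\<^esub> gen g y) | g x y.
          g \<in> carrier G \<and> x \<in> carrier W \<and> y \<in> carrier W} \<union>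
       {gen g (a \<odot>\<^bsub>W\<^esub> x) \<ominus>\<^bsub>F\<^esub> a \<odot>\<^bsub>F\<^esub> gen g x | g a x.
          g \<in> carrier G \<and> a \<in> carrier R \<and> x \<in> carrier W} \<union>
       {gen (g \<otimes>\<^bsub>G\<^esub> h) x \<ominus>\<^bsub>F\<^esub> gen g (\<omega> h x) | g h x. g \<in> carrier G \<and> h \<in> H \<and> x \<in> carrier W}"
  then show "f u \<in> K"
    by (elim UnE CollectE exE conjE) (simp_all add: add smult balanced)
qed (auto intro!: F.M.minus_closed F.M.add.m_closed F.smult_closed gen_closed \<omega>)

lemma module_induced_module: "module R I"
  unfolding induced_module_def by (rule module_quot_module[OF F.module_axioms induced_relations_submodule])

interpretation I: module R I by (rule module_induced_module)

lemma coset_hom_induced: "(\<lambda>v. N +>\<^bsub>F\<^esub> v) \<in> module_homs R F I"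
  unfolding induced_module_def by (rule coset_hom[OF F.module_axioms induced_relations_submodule])

lemma act_representation: "representation R G F act"
  by (rule representation_free_module[OF R G]) (auto simp: G.m_assoc)

lemma act_hom: "g \<in> carrier G \<Longrightarrow> act g \<in> module_homs R F F"
  by (rule representation.linear[OF act_representation])

lemma act_gen:
  assumes "g \<in> carrier G" "g' \<in> carrier G" "x \<in> carrier W"
  shows "act g (gen g' x) = gen (g \<otimes>\<^bsub>G\<^esub> g') x"
  using assms gen_closed
  by (subst lin_ext_free_gen[OF R F.module_axioms, where X = "carrier G \<times> carrier W"]) auto

lemma induced_action_coset:
  assumes g: "g \<in> carrier G" and v: "v \<in> carrier F"
  shows "induced_action R G H W \<omega> g (N +>\<^bsub>F\<^esub> v) = N +>\<^bsub>F\<^esub> act g v"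
proof -
  have "act g u \<in> N" if u: "u \<in> N" for u
    by (rule hom_induced_relations[OF F.module_axioms act_hom[OF g] induced_relations_submodule _ _ _ u])
       (simp_all add: act_gen g \<omega> gen_relations flip: G.m_assoc)
  then show ?thesis
    unfolding induced_action_def Let_def case_prod_beta
    by (intro quot_map_coset[OF F.module_axioms induced_relations_submodule F.module_axioms
          induced_relations_submodule act_hom[OF g] _ v])
qed

lemma representation_induced: "representation R G I (induced_action R G H W \<omega>)"
proof (rule representation_onto[OF act_representation module_induced_module coset_hom_induced])
  show "(\<lambda>v. N +>\<^bsub>F\<^esub> v) ` carrier F = carrier I"
    unfolding induced_module_def by (rule quot_module_carrier[OF F.module_axioms induced_relations_submodule])
qed (rule induced_action_coset)

text \<open>The defining relations of the tensor product for the pure tensors \<open>g \<otimes> x\<close>.\<close>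

lemma pure_relations:
  assumes "g \<in> carrier G" "x \<in> carrier W"
  shows pure_add: "y \<in> carrier W \<Longrightarrow> pure g (x \<oplus>\<^bsub>W\<^esub> y) = pure g x \<oplus>\<^bsub>I\<^esub> pure g y"
    and pure_smult: "a \<in> carrier R \<Longrightarrow> pure g (a \<odot>\<^bsub>W\<^esub> x) = a \<odot>\<^bsub>I\<^esub> pure g x"
    and pure_balanced: "h \<in> H \<Longrightarrow> pure (g \<otimes>\<^bsub>G\<^esub> h) x = pure g (\<omega> h x)"
  using assms
  by (simp_all add: coset_eq_iff[OF F.module_axioms induced_relations_submodule] gen_relations gen_closed \<omega>
      flip: module_homs_add[OF coset_hom_induced] module_homs_smult[OF coset_hom_induced])

lemma pure_hom: "g \<in> carrier G \<Longrightarrow> (\<lambda>x. pure g x) \<in> module_homs R W I"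
  by (intro module_homsI module_homs_closed[OF coset_hom_induced] gen_closed)
     (simp_all add: pure_relations)

text \<open>If \<open>V\<close> is the direct sum of the translates \<open>t j(W)\<close> over a transversal, where
  \<open>j\<close> is \<open>H\<close>-equivariant, then \<open>V\<close> is induced from \<open>W\<close>. The maps \<open>c t\<close>
  are the projections to the summands, read in \<open>W\<close>. Frobenius reciprocity gives \<open>\<Theta>\<close>, which sends
  \<open>g \<otimes> x\<close> to \<open>g j(x)\<close>, from the free module to \<open>V\<close>, and \<open>\<Phi>\<close>, which
  sends \<open>v\<close> to the sum of the \<open>t \<otimes> c_t(v)\<close>, goes back. On generators, \<open>\<Phi> \<circ> \<Theta>\<close> is the
  projection to the induced module because \<open>g = t h\<close> can be moved across the tensor sign; this makes
  \<open>\<Phi>\<close> surjective and equivariant. Injectivity holds because \<open>\<Theta>\<close> kills the relations and the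
  lift \<open>s\<close> of \<open>\<Phi>\<close> to the free module satisfies \<open>\<Theta> \<circ> s = id\<close>.\<close>

theorem rep_isomorphic_induced:
  fixes V (structure) and \<rho> and j and c and T
  assumes V: "representation R G V \<rho>"
    and j: "j \<in> module_homs R W V"
    and j_equiv: "\<And>h x. h \<in> H \<Longrightarrow> x \<in> carrier W \<Longrightarrow> \<rho> h (j x) = j (\<omega> h x)"
    and T: "left_transversal G H T" "finite T"
    and c: "\<And>t. t \<in> T \<Longrightarrow> c t \<in> module_homs R V W"
    and c_diag: "\<And>t x. t \<in> T \<Longrightarrow> x \<in> carrier W \<Longrightarrow> c t (\<rho> t (j x)) = x"
    and c_off: "\<And>s t x. s \<in> T \<Longrightarrow> t \<in> T \<Longrightarrow> s \<noteq> t \<Longrightarrow> x \<in> carrier W \<Longrightarrow> c s (\<rho> t (j x)) = \<zero>\<^bsub>W\<^esub>"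
    and decomp: "\<And>v. v \<in> carrier V \<Longrightarrow> v = (\<Oplus>\<^bsub>V\<^esub>t\<in>T. \<rho> t (j (c t v)))"
  shows "rep_isomorphic R G V \<rho> I (induced_action R G H W \<omega>)"
proof -
  interpret V: representation R G V \<rho> by (rule V)
  have TG: "t \<in> carrier G" if "t \<in> T" for t using that T(1) by (auto simp: left_transversal_def)
  define \<Theta> where "\<Theta> = lin_ext R V (\<lambda>z. \<rho> (fst z) (j (snd z)))"
  define \<Phi> where "\<Phi> v = (\<Oplus>\<^bsub>I\<^esub>t\<in>T. pure t (c t v))" for v
  note \<rho>_closed = module_homs_closed[OF V.linear] and j_closed = module_homs_closed[OF j]
    and c_closed = module_homs_closed[OF c]
  have \<rho>j: "\<rho> g (j x) \<in> carrier V" if "g \<in> carrier G" "x \<in> carrier W" for g x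
    by (rule \<rho>_closed[OF that(1) j_closed[OF that(2)]])
  have \<Theta>: "\<Theta> \<in> module_homs R F V"
    unfolding \<Theta>_def by (rule lin_ext_hom[OF R V.module_axioms]) (auto intro: \<rho>j)
  have \<Theta>_gen: "\<Theta> (gen g x) = \<rho> g (j x)" if "g \<in> carrier G" "x \<in> carrier W" for g x
    unfolding \<Theta>_def using that
    by (subst lin_ext_free_gen[OF R V.module_axioms, where X = "carrier G \<times> carrier W"])
       (auto intro: \<rho>j)
  have zero: "submodule {\<zero>\<^bsub>V\<^esub>} R V"
    by (rule V.submoduleI) auto
  have \<Theta>_relations: "\<Theta> v = \<zero>\<^bsub>V\<^esub>" if "v \<in> N" for v
  proof -
    have "\<Theta> v \<in> {\<zero>\<^bsub>V\<^esub>}"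
    proof (rule hom_induced_relations[OF V.module_axioms \<Theta> zero _ _ _ that])
    qed (simp_all add: \<Theta>_gen \<omega> module_homs_add[OF j] module_homs_smult[OF j] V.action_mult
          module_homs_add[OF V.linear] module_homs_smult[OF V.linear] \<rho>_closed j_closed j_equiv
          V.M.r_neg a_minus_def)
    then show ?thesis by simp
  qed
  have pure_c: "(\<lambda>v. pure t (c t v)) \<in> module_homs R V I" if "t \<in> T" for t
    by (rule module_homs_compose[OF c[OF that] pure_hom[OF TG[OF that]]])
  have \<Phi>: "\<Phi> \<in> module_homs R V I"
  proof (rule module_homsI)
    fix v w a assume v: "v \<in> carrier V"
    show "\<Phi> v \<in> carrier I"
      unfolding \<Phi>_def using v module_homs_closed[OF pure_c] by (intro I.M.finsum_closed) auto
    show "\<Phi> (v \<oplus>\<^bsub>V\<^esub> w) = \<Phi> v \<oplus>\<^bsub>I\<^esub> \<Phi> w" if w: "w \<in> carrier V"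
    proof -
      have "\<Phi> (v \<oplus>\<^bsub>V\<^esub> w) = (\<Oplus>\<^bsub>I\<^esub>t\<in>T. pure t (c t v) \<oplus>\<^bsub>I\<^esub> pure t (c t w))"
        unfolding \<Phi>_def using v w
        by (intro I.M.finsum_cong' refl module_homs_add[OF pure_c] Pi_I I.M.add.m_closed
            module_homs_closed[OF pure_c])
      also have "\<dots> = \<Phi> v \<oplus>\<^bsub>I\<^esub> \<Phi> w"
        unfolding \<Phi>_def using v w
        by (intro I.M.finsum_addf Pi_I module_homs_closed[OF pure_c])
      finally show ?thesis .
    qed
    show "\<Phi> (a \<odot>\<^bsub>V\<^esub> v) = a \<odot>\<^bsub>I\<^esub> \<Phi> v" if a: "a \<in> carrier R"
    proof -
      have "\<Phi> (a \<odot>\<^bsub>V\<^esub> v) = (\<Oplus>\<^bsub>I\<^esub>t\<in>T. a \<odot>\<^bsub>I\<^esub> pure t (c t v))"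
        unfolding \<Phi>_def using v a
        by (intro I.M.finsum_cong' refl module_homs_smult[OF pure_c] Pi_I I.smult_closed
            module_homs_closed[OF pure_c])
      also have "\<dots> = a \<odot>\<^bsub>I\<^esub> \<Phi> v"
        unfolding \<Phi>_def using v a T(2)
        by (intro I.finsum_smult_ldistr[symmetric] Pi_I module_homs_closed[OF pure_c])
      finally show ?thesis .
    qed
  qed
  have \<Phi>_pure: "\<Phi> (\<rho> t (j x)) = pure t x" if t: "t \<in> T" and x: "x \<in> carrier W" for t x
  proof -
    have "\<Phi> (\<rho> t (j x)) = (\<Oplus>\<^bsub>I\<^esub>s\<in>T. if t = s then pure s x else \<zero>\<^bsub>I\<^esub>)"
      unfolding \<Phi>_def
    proof (rule I.M.finsum_cong')
      show "(\<lambda>s. if t = s then pure s x else \<zero>\<^bsub>I\<^esub>) \<in> T \<rightarrow> carrier I"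
        using x module_homs_closed[OF pure_hom[OF TG]] by auto
      show "pure s (c s (\<rho> t (j x))) = (if t = s then pure s x else \<zero>\<^bsub>I\<^esub>)" if s: "s \<in> T" for s
        using s t x module_homs_zero[OF W module_induced_module pure_hom[OF TG[OF s]]]
        by (simp add: c_diag c_off)
    qed simp
    also have "\<dots> = pure t x"
      using T(2) t x module_homs_closed[OF pure_hom[OF TG]] by (intro I.M.finsum_singleton) auto
    finally show ?thesis .
  qed
  \<comment> \<open>Both sides are linear in \<open>v\<close>, so it is enough to treat \<open>v = g \<otimes> x\<close>.\<close>
  have \<Phi>_\<Theta>: "\<Phi> (\<Theta> v) = N +>\<^bsub>F\<^esub> v" if v: "v \<in> carrier F" for v
  proof (rule hom_free_module_eqI[OF R module_induced_module module_homs_compose[OF \<Theta> \<Phi>] coset_hom_induced _ v])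
    fix z assume "z \<in> carrier G \<times> carrier W"
    then obtain g x where z: "z = (g, x)" and g: "g \<in> carrier G" and x: "x \<in> carrier W" by auto
    have "g <#\<^bsub>G\<^esub> H \<in> lcosets\<^bsub>G\<^esub> H" using g by (auto simp: LCOSETS_def)
    then obtain t where t: "t \<in> T" "t \<in> g <#\<^bsub>G\<^esub> H"
      using T(1) by (auto simp: left_transversal_def)
    then obtain h where h: "h \<in> H" "t = g \<otimes>\<^bsub>G\<^esub> h" by (auto simp: l_coset_def)
    define h' where "h' = inv\<^bsub>G\<^esub> h"
    have h': "h' \<in> H" "g = t \<otimes>\<^bsub>G\<^esub> h'"
      using h g H.subset by (auto simp: h'_def G.m_assoc)
    note tG = TG[OF t(1)]
    have "\<Phi> (\<Theta> (gen g x)) = \<Phi> (\<rho> t (j (\<omega> h' x)))"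
      using h' tG g x by (simp add: \<Theta>_gen V.action_mult j_closed j_equiv)
    also have "\<dots> = pure t (\<omega> h' x)" using t h' x by (simp add: \<Phi>_pure \<omega>)
    also have "\<dots> = pure g x" using h' tG x by (simp add: pure_balanced)
    finally show "\<Phi> (\<Theta> (free_gen R z)) = N +>\<^bsub>F\<^esub> free_gen R z" by (simp add: z)
  qed
  define s where "s v = (\<Oplus>\<^bsub>F\<^esub>t\<in>T. gen t (c t v))" for v
  have s_closed: "s v \<in> carrier F" if "v \<in> carrier V" for v
    unfolding s_def using that by (intro F.M.finsum_closed Pi_I gen_closed c_closed TG)
  have \<Theta>_s: "\<Theta> (s v) = v" if v: "v \<in> carrier V" for v
  proof -
    have "\<Theta> (s v) = (\<Oplus>\<^bsub>V\<^esub>t\<in>T. \<Theta> (gen t (c t v)))"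
      unfolding s_def using v T(2)
      by (intro module_homs_finsum[OF F.module_axioms V.module_axioms \<Theta>] Pi_I gen_closed c_closed TG)
    also have "\<dots> = (\<Oplus>\<^bsub>V\<^esub>t\<in>T. \<rho> t (j (c t v)))"
      using v by (intro V.M.finsum_cong' refl Pi_I \<Theta>_gen TG c_closed \<rho>_closed j_closed)
    also have "\<dots> = v" by (rule decomp[OF v, symmetric])
    finally show ?thesis .
  qed
  have \<Phi>_s: "\<Phi> v = N +>\<^bsub>F\<^esub> s v" if "v \<in> carrier V" for v
    using \<Phi>_\<Theta>[OF s_closed[OF that]] \<Theta>_s[OF that] by simp
  have "inj_on \<Phi> (carrier V)"
  proof (rule inj_onI)
    fix v w assume v: "v \<in> carrier V" and w: "w \<in> carrier V" and "\<Phi> v = \<Phi> w"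
    then have "s v \<ominus>\<^bsub>F\<^esub> s w \<in> N"
      by (simp add: \<Phi>_s s_closed coset_eq_iff[OF F.module_axioms induced_relations_submodule])
    then have "v \<ominus>\<^bsub>V\<^esub> w = \<zero>\<^bsub>V\<^esub>"
      using \<Theta>_relations module_homs_diff[OF F.module_axioms V.module_axioms \<Theta> s_closed[OF v] s_closed[OF w]]
      by (simp add: \<Theta>_s v w)
    then show "v = w" using v w V.M.add.inv_equality[of v "\<ominus>\<^bsub>V\<^esub> w"] by (simp add: a_minus_def)
  qed
  moreover have "\<Phi> ` carrier V = carrier I"
  proof
    show "\<Phi> ` carrier V \<subseteq> carrier I" using module_homs_closed[OF \<Phi>] by auto
    have "carrier I = (\<lambda>v. N +>\<^bsub>F\<^esub> v) ` carrier F"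
      unfolding induced_module_def
      by (rule quot_module_carrier[OF F.module_axioms induced_relations_submodule, symmetric])
    then show "carrier I \<subseteq> \<Phi> ` carrier V"
      using \<Phi>_\<Theta> module_homs_closed[OF \<Theta>] by (metis image_eqI image_subsetI)
  qed
  moreover have "\<Phi> (\<rho> g v) = induced_action R G H W \<omega> g (\<Phi> v)"
    if g: "g \<in> carrier G" and v: "v \<in> carrier V" for g v
  proof -
    have "\<Theta> (act g u) = \<rho> g (\<Theta> u)" if u: "u \<in> carrier F" for u
      using hom_free_module_eqI[OF R V.module_axioms module_homs_compose[OF act_hom[OF g] \<Theta>]
          module_homs_compose[OF \<Theta> V.linear[OF g]] _ u] g
      by (auto simp: act_gen \<Theta>_gen V.action_mult j_closed)
    then have "\<Phi> (\<rho> g v) = \<Phi> (\<Theta> (act g (s v)))" using v by (simp add: \<Theta>_s s_closed)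
    also have "\<dots> = N +>\<^bsub>F\<^esub> act g (s v)"
      by (rule \<Phi>_\<Theta>[OF module_homs_closed[OF act_hom[OF g] s_closed[OF v]]])
    also have "\<dots> = induced_action R G H W \<omega> g (\<Phi> v)"
      using g v by (simp add: induced_action_coset \<Phi>_s s_closed)
    finally show ?thesis .
  qed
  ultimately show ?thesis
    unfolding rep_isomorphic_def bij_betw_def
    by (intro conjI V representation_induced bexI[OF _ \<Phi>] ballI)
qed

end

section \<open>The cyclic subgroup of the symmetric group\<close>

lemma Sigma_group_simps [simp]:
  "carrier (Sigma_group p) = {\<sigma>. \<sigma> permutes {0..p}}"
  "\<sigma> \<otimes>\<^bsub>Sigma_group p\<^esub> \<pi> = \<sigma> \<circ> \<pi>"
  "\<one>\<^bsub>Sigma_group p\<^esub> = id"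
  by (simp_all add: Sigma_group_def)

lemma group_Sigma_group: "group (Sigma_group p)"
  by (rule groupI)
     (auto simp: permutes_compose comp_assoc permutes_id intro: permutes_inv permutes_inv_o(2))

lemma inv_Sigma_group:
  assumes "\<sigma> permutes {0..p}" shows "inv\<^bsub>Sigma_group p\<^esub> \<sigma> = inv' \<sigma>"
  by (rule group.inv_equality[OF group_Sigma_group]) (use assms in \<open>simp_all add: permutes_inv permutes_inv_o\<close>)

lemma pow_Sigma_group: "\<sigma> [^]\<^bsub>Sigma_group p\<^esub> (n::nat) = \<sigma> ^^ n"
proof -
  interpret group "Sigma_group p" by (rule group_Sigma_group)
  show ?thesis
    by (induction n) (simp_all add: nat_pow_def funpow_Suc_right del: funpow.simps(2))
qed

lemma permutation_if_permutes: "\<sigma> permutes {0..p::nat} \<Longrightarrow> permutation \<sigma>"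
  by (auto simp: permutation_permutes)

text \<open>All properties of \<open>\<tau>_p\<close> come from the fact that a cycle rotates the list of its entries. For
  \<open>p = 0\<close> the list has one entry and \<open>\<tau>_0\<close> is the identity.\<close>

lemma tau_permutes: "tau p permutes {0..p}"
proof -
  have "set (0 # rev [1..<Suc p]) = {0..p}" by auto
  then show ?thesis using cycle_permutes[of "0 # rev [1..<Suc p]"] by (simp only: tau_def)
qed

lemma distinct_tau_cycle: "distinct (0 # rev [1..<Suc p])"
  by simp

lemma map_tau: "map (tau p) (0 # rev [1..<Suc p]) = rev [0..<Suc p]"
proof -
  have "map (tau p) (0 # rev [1..<Suc p]) = rotate1 (0 # rev [1..<Suc p])"
    using cyclic_rotation[OF distinct_tau_cycle, of 1 p] by (simp add: tau_def)
  also have "\<dots> = rev (0 # [1..<Suc p])" by simp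
  also have "0 # [1..<Suc p] = [0..<Suc p]" by (simp add: upt_conv_Cons)
  finally show ?thesis .
qed

lemma tau_Suc: "i < p \<Longrightarrow> tau p (Suc i) = i"
proof -
  assume i: "i < p"
  have "map (tau p) (rev [1..<Suc p]) = rev [0..<p]" using map_tau[of p] by simp
  then have "map (tau p) [1..<Suc p] = [0..<p]" by (metis rev_map rev_rev_ident)
  then have "map (tau p) [1..<Suc p] ! i = [0..<p] ! i" by simp
  with i show ?thesis by (simp del: upt_Suc)
qed

lemma tau_funpow_Suc_p: "tau p ^^ Suc p = id"
proof -
  have "length (0 # rev [1..<Suc p]) = Suc p" by simp
  then show ?thesis
    using cycle_is_id_root[OF distinct_tau_cycle, of p] by (simp only: tau_def)
qed

lemma tau_funpow_mod: "tau p ^^ (j mod Suc p) = tau p ^^ j"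
  by (rule ext, rule funpow_mod_eq) (simp add: tau_funpow_Suc_p del: funpow.simps)

text \<open>This makes the powers \<open>\<tau>_p^j\<close> with \<open>j \<le> p\<close> distinct: if \<open>\<tau>_p^i = \<tau>_p^j\<close>
  with \<open>i < j\<close>, then \<open>\<tau>_p^(j - i)\<close> is the identity, but it moves \<open>j - i\<close> to \<open>0\<close>.\<close>

lemma tau_funpow_self: "j \<le> p \<Longrightarrow> (tau p ^^ j) j = 0"
  by (induction j) (simp_all add: funpow_Suc_right tau_Suc del: funpow.simps(2))

lemma tau_funpow_permutes: "tau p ^^ j permutes {0..p}"
  by (rule permutes_funpow[OF tau_permutes])

lemma tau_funpow_inj: "inj_on (\<lambda>j. tau p ^^ j) {0..p}"
proof (rule linorder_inj_onI)
  fix i j assume ij: "i < j" "i \<in> {0..p}" "j \<in> {0..p}"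
  have "tau p ^^ j = tau p ^^ i \<circ> tau p ^^ (j - i)"
    using ij by (simp flip: funpow_add)
  moreover have "(tau p ^^ (j - i)) (j - i) \<noteq> j - i"
    using ij by (simp add: tau_funpow_self)
  moreover have "inj (tau p ^^ i)"
    using tau_funpow_permutes by (rule permutes_inj)
  ultimately show "tau p ^^ i \<noteq> tau p ^^ j"
    by (metis comp_apply injD)
qed auto

lemma cyclic_subgroup_eq: "cyclic_subgroup p = (\<lambda>j. tau p ^^ j) ` {0..p}"
proof -
  interpret group "Sigma_group p" by (rule group_Sigma_group)
  have \<tau>: "tau p \<in> carrier (Sigma_group p)" by (simp add: tau_permutes)
  \<comment> \<open>The generated subgroup consists of the powers with integer exponents, which are reduced
    modulo the order \<open>p + 1\<close>.\<close>
  let ?n = "int (Suc p)"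
  have "tau p [^]\<^bsub>Sigma_group p\<^esub> k = tau p ^^ nat (k mod ?n)" for k :: int
  proof -
    have "tau p [^]\<^bsub>Sigma_group p\<^esub> k
        = tau p [^]\<^bsub>Sigma_group p\<^esub> (?n * (k div ?n)) \<otimes>\<^bsub>Sigma_group p\<^esub> tau p [^]\<^bsub>Sigma_group p\<^esub> (k mod ?n)"
      by (subst int_pow_mult[OF \<tau>, symmetric]) simp
    also have "tau p [^]\<^bsub>Sigma_group p\<^esub> (?n * (k div ?n)) = (tau p [^]\<^bsub>Sigma_group p\<^esub> ?n) [^]\<^bsub>Sigma_group p\<^esub> (k div ?n)"
      by (rule int_pow_pow[OF \<tau>, symmetric])
    also have "tau p [^]\<^bsub>Sigma_group p\<^esub> ?n = \<one>\<^bsub>Sigma_group p\<^esub>"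
      by (simp only: int_pow_int pow_Sigma_group tau_funpow_Suc_p Sigma_group_simps)
    also have "tau p [^]\<^bsub>Sigma_group p\<^esub> (k mod ?n) = tau p ^^ nat (k mod ?n)"
      using int_pow_int[of "Sigma_group p" "tau p" "nat (k mod ?n)"] by (simp add: pow_Sigma_group)
    also have "\<one>\<^bsub>Sigma_group p\<^esub> [^]\<^bsub>Sigma_group p\<^esub> (k div ?n) = \<one>\<^bsub>Sigma_group p\<^esub>"
      by (rule int_pow_one)
    finally show ?thesis by simp
  qed
  then have "cyclic_subgroup p = range (\<lambda>k. tau p ^^ nat (k mod ?n))"
    unfolding cyclic_subgroup_def generate_pow[OF \<tau>] by auto
  moreover have "range (\<lambda>k. tau p ^^ nat (k mod ?n)) = range (\<lambda>j. tau p ^^ j)"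
  proof
    show "range (\<lambda>j. tau p ^^ j) \<subseteq> range (\<lambda>k. tau p ^^ nat (k mod ?n))"
    proof
      fix f assume "f \<in> range (\<lambda>j. tau p ^^ j)"
      then obtain j where "f = tau p ^^ j" by blast
      then have "f = tau p ^^ nat (int j mod ?n)"
        by (simp only: tau_funpow_mod nat_int flip: zmod_int)
      then show "f \<in> range (\<lambda>k. tau p ^^ nat (k mod ?n))" by blast
    qed
  qed blast
  moreover have "tau p ^^ j \<in> (\<lambda>j. tau p ^^ j) ` {0..p}" for j
    by (rule image_eqI[of _ _ "j mod Suc p"]) (simp_all add: tau_funpow_mod less_Suc_eq_le[symmetric] del: funpow.simps)
  ultimately show ?thesis by auto
qed

lemma tau_in_cyclic: "tau p ^^ j \<in> cyclic_subgroup p"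
proof -
  have "tau p ^^ (j mod Suc p) \<in> cyclic_subgroup p"
    unfolding cyclic_subgroup_eq by (intro imageI) (simp add: less_Suc_eq_le[symmetric])
  then show ?thesis by (simp only: tau_funpow_mod)
qed

lemma subgroup_cyclic: "subgroup (cyclic_subgroup p) (Sigma_group p)"
  unfolding cyclic_subgroup_def
  by (rule group.generate_is_subgroup[OF group_Sigma_group]) (simp add: tau_permutes)

lemma sign_cycle_of_list: "distinct cs \<Longrightarrow> sign (cycle_of_list cs) = (-1) ^ (length cs - 1)"
  by (induction cs rule: cycle_of_list.induct)
     (simp_all add: sign_compose permutation_of_cycle permutation_swap_id sign_swap_id)

lemma sign_tau: "sign (tau p) = (-1) ^ p"
proof -
  have "length (0 # rev [1..<Suc p]) - 1 = p" by simp
  then show ?thesis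
    using sign_cycle_of_list[OF distinct_tau_cycle, of p] by (simp only: tau_def)
qed

lemma sign_tau_funpow: "sign (tau p ^^ j) = (-1) ^ (j * p)"
proof (induction j)
  case (Suc j)
  have "sign (tau p ^^ Suc j) = sign (tau p) * sign (tau p ^^ j)"
    unfolding funpow.simps
    by (rule sign_compose[OF permutation_if_permutes[OF tau_permutes] permutation_if_permutes[OF tau_funpow_permutes]])
  then show ?case using Suc by (simp only: sign_tau mult_Suc power_add)
qed simp

section \<open>Words with all letters as permutations\<close>

lemma map_permutation_eq_iff:
  assumes "\<sigma> permutes {0..p}" "\<pi> permutes {0..p}"
  shows "map \<sigma> [0..<Suc p] = map \<pi> [0..<Suc p] \<longleftrightarrow> \<sigma> = \<pi>"
proof
  assume eq: "map \<sigma> [0..<Suc p] = map \<pi> [0..<Suc p]"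
  show "\<sigma> = \<pi>"
  proof
    fix i
    show "\<sigma> i = \<pi> i"
    proof (cases "i \<in> {0..p}")
      case True
      then have "i \<in> set [0..<Suc p]" by auto
      then show ?thesis using eq by (simp only: map_eq_conv)
    next
      case False
      then show ?thesis using assms permutes_not_in by metis
    qed
  qed
qed simp

definition perm_word :: "nat \<Rightarrow> (nat \<Rightarrow> nat) \<Rightarrow> tensor"
  where "perm_word p \<pi> = [map \<pi> [0..<Suc p]]"

lemma perm_word_eq_iff:
  "\<sigma> permutes {0..p} \<Longrightarrow> \<pi> permutes {0..p} \<Longrightarrow> perm_word p \<sigma> = perm_word p \<pi> \<longleftrightarrow> \<sigma> = \<pi>"
  using map_permutation_eq_iff by (auto simp: perm_word_def simp del: upt_Suc)

lemma map_perm_word: "map (map \<sigma>) (perm_word p \<pi>) = perm_word p (\<sigma> \<circ> \<pi>)"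
  by (simp add: perm_word_def)

lemma top_tensors: "tensors p p = {[w] | w. distinct w \<and> set w = {0..p}}"
proof -
  have "Z \<in> tensors p p \<longleftrightarrow> (\<exists>w. Z = [w] \<and> distinct w \<and> set w = {0..p})" for Z
  proof
    assume "Z \<in> tensors p p"
    then have "length Z = 1" "distinct (concat Z)" "set (concat Z) = {0..p}"
      by (simp_all add: tensors_def)
    then show "\<exists>w. Z = [w] \<and> distinct w \<and> set w = {0..p}"
      by (cases Z) simp_all
  next
    assume "\<exists>w. Z = [w] \<and> distinct w \<and> set w = {0..p}"
    then obtain w where Z: "Z = [w]" and w: "distinct w" "set w = {0..p}" by blast
    then have "w \<noteq> []" by auto
    then show "Z \<in> tensors p p" using Z w by (simp add: tensors_def)
  qed
  then show ?thesis by blast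
qed

lemma perm_word_in_tensors: "\<pi> permutes {0..p} \<Longrightarrow> perm_word p \<pi> \<in> tensors p p"
proof -
  assume \<pi>: "\<pi> permutes {0..p}"
  have "set [0..<Suc p] = {0..p}" by auto
  then have "set (map \<pi> [0..<Suc p]) = {0..p}"
    using permutes_image[OF \<pi>] by (simp only: set_map)
  moreover have "distinct (map \<pi> [0..<Suc p])"
    using permutes_inj_on[OF \<pi>] by (simp add: distinct_map del: upt_Suc)
  ultimately show ?thesis by (simp add: top_tensors perm_word_def del: upt_Suc)
qed

lemma top_tensors_eq: "tensors p p = perm_word p ` {\<pi>. \<pi> permutes {0..p}}"
proof
  show "perm_word p ` {\<pi>. \<pi> permutes {0..p}} \<subseteq> tensors p p"
    using perm_word_in_tensors by auto
  show "tensors p p \<subseteq> perm_word p ` {\<pi>. \<pi> permutes {0..p}}"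
  proof
    fix Z assume "Z \<in> tensors p p"
    then obtain w where Z: "Z = [w]" and w: "distinct w" "set w = {0..p}"
      by (auto simp: top_tensors)
    have "mset w = mset [0..<Suc p]"
    proof (rule set_eq_iff_mset_eq_distinct[THEN iffD1, OF w(1) distinct_upt])
      show "set w = set [0..<Suc p]" unfolding w(2) by auto
    qed
    then obtain \<pi> where \<pi>: "\<pi> permutes {..<length [0..<Suc p]}" "permute_list \<pi> [0..<Suc p] = w"
      by (rule mset_eq_permutation)
    have perm: "\<pi> permutes {0..p}"
      using \<pi>(1) by (simp add: atLeast0AtMost lessThan_Suc_atMost del: upt_Suc)
    have "[0..<Suc p] ! \<pi> i = \<pi> i" if "i \<in> set [0..<Suc p]" for i
    proof -
      have "\<pi> i \<in> {0..p}" using that permutes_in_image[OF perm, of i] by auto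
      then show ?thesis using nth_upt[of 0 "\<pi> i" "Suc p"] by simp
    qed
    then have "w = map \<pi> [0..<Suc p]"
      using \<pi>(2) unfolding permute_list_def length_upt diff_zero by (metis (no_types, lifting) map_cong)
    then show "Z \<in> perm_word p ` {\<pi>. \<pi> permutes {0..p}}"
      using perm Z by (auto simp: perm_word_def simp del: upt_Suc)
  qed
qed

text \<open>Rotation of words is right multiplication by the inverse of \<open>\<tau>_p\<close>. It commutes with the
  action of the symmetric group, which relabels letters and so multiplies on the left.\<close>

lemma rotate1_perm_word:
  "rotate1 (map (\<pi> \<circ> tau p) [0..<Suc p]) = map \<pi> [0..<Suc p]"
proof -
  have "rotate1 (map (\<pi> \<circ> tau p) [0..<Suc p]) = map \<pi> (map (tau p) (rotate1 [0..<Suc p]))"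
    by (simp add: rotate1_map del: upt_Suc)
  also have "map (tau p) (rotate1 [0..<Suc p]) = [0..<Suc p]"
  proof -
    have "rotate1 [0..<Suc p] = rev (0 # rev [1..<Suc p])"
      by (simp add: upt_conv_Cons del: upt_Suc)
    then show ?thesis using map_tau[of p] by (metis rev_map rev_rev_ident)
  qed
  finally show ?thesis .
qed

section \<open>The sign character with values in the ring\<close>

definition ring_sign :: "('k, 'c) ring_scheme \<Rightarrow> (nat \<Rightarrow> nat) \<Rightarrow> 'k"
  where "ring_sign R \<sigma> = (if evenperm \<sigma> then \<one>\<^bsub>R\<^esub> else \<ominus>\<^bsub>R\<^esub> \<one>\<^bsub>R\<^esub>)"

context
  fixes R (structure)
  assumes R: "cring R"
begin

interpretation R: cring R by (rule R)

lemma minus_one_pow: "(\<ominus> \<one>) [^] (n::nat) = (if even n then \<one> else \<ominus> \<one>)"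
  by (induction n) (simp_all add: R.l_minus)

lemma ring_sign_closed [simp]: "ring_sign R \<sigma> \<in> carrier R"
  by (simp add: ring_sign_def)

lemma ring_sign_id [simp]: "ring_sign R id = \<one>"
  by (simp add: ring_sign_def)

lemma ring_sign_square: "ring_sign R \<sigma> \<otimes> ring_sign R \<sigma> = \<one>"
  by (simp add: ring_sign_def R.l_minus)

lemma ring_sign_compose:
  assumes "\<sigma> permutes {0..p}" "\<pi> permutes {0..p}"
  shows "ring_sign R (\<sigma> \<circ> \<pi>) = ring_sign R \<sigma> \<otimes> ring_sign R \<pi>"
  using assms by (simp add: ring_sign_def evenperm_comp permutation_if_permutes R.l_minus)

lemma sign_action_eq:
  assumes "a \<in> carrier R" shows "sign_action R \<sigma> a = ring_sign R \<sigma> \<otimes> a"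
  using assms R.add.int_pow_1[of a] R.add.int_pow_neg[of a 1]
  by (simp add: sign_action_def ring_sign_def sign_def R.l_minus)

lemma ring_sign_tau_funpow: "ring_sign R (tau p ^^ j) = (\<ominus> \<one>) [^] (j * p)"
proof -
  have "evenperm (tau p ^^ j) \<longleftrightarrow> even (j * p)"
    using sign_tau_funpow[where p = p and j = j] by (auto simp: sign_def minus_one_power_iff split: if_splits)
  then show ?thesis by (simp add: ring_sign_def minus_one_pow)
qed

end

section \<open>The differential in top degree\<close>

text \<open>The linear map on formal tensors that induces the differential out of degree \<open>p\<close>.\<close>

definition top_diff :: "('k, 'c) ring_scheme \<Rightarrow> nat \<Rightarrow> (tensor \<Rightarrow> 'k) \<Rightarrow> tensor \<Rightarrow> 'k"
  where "top_diff R p = lin_ext R (sym_free R p (p - 1))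
    (\<lambda>Z. \<Oplus>\<^bsub>sym_free R p (p - 1)\<^esub>i\<in>{..<p}.
      ((\<ominus>\<^bsub>R\<^esub> \<one>\<^bsub>R\<^esub>) [^]\<^bsub>R\<^esub> i) \<odot>\<^bsub>sym_free R p (p - 1)\<^esub> face R (int i) Z)"

lemma pair_tensors_iff:
  assumes "0 < p"
  shows "Z \<in> tensors p (p - 1) \<longleftrightarrow>
    (\<exists>U V. Z = [U, V] \<and> U \<noteq> [] \<and> V \<noteq> [] \<and> [U @ V] \<in> tensors p p)" (is "?l \<longleftrightarrow> ?r")
proof
  assume ?l
  then have len: "length Z = 2" and Z: "[] \<notin> set Z" "distinct (concat Z)" "set (concat Z) = {0..p}"
    using assms by (auto simp: tensors_def)
  obtain U V where "Z = [U, V]"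
    using len by (auto simp: numeral_2_eq_2 length_Suc_conv)
  with Z show ?r by (auto simp: top_tensors)
next
  assume ?r
  then obtain U V where "Z = [U, V]" "U \<noteq> []" "V \<noteq> []" "distinct (U @ V)" "set (U @ V) = {0..p}"
    unfolding top_tensors by auto
  then show ?l using assms by (simp add: tensors_def)
qed

lemma pair_tensorsD:
  assumes "0 < p" "[U, V] \<in> tensors p (p - 1)"
  shows "U \<noteq> []" "V \<noteq> []" "[U @ V] \<in> tensors p p"
  using iffD1[OF pair_tensors_iff[OF assms(1)] assms(2)] by simp_all

text \<open>The letter \<open>0\<close> lies in exactly one of the two factors. This selects one of the two orders of
  each pair as its normal form.\<close>

lemma pair_tensors_zero:
  assumes "0 < p" "[U, V] \<in> tensors p (p - 1)" shows "0 \<in> set U \<longleftrightarrow> 0 \<notin> set V"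
proof -
  have "[U @ V] \<in> tensors p p" by (rule pair_tensorsD[OF assms])
  then have "set U \<inter> set V = {}" "set U \<union> set V = {0..p}" by (auto simp: top_tensors)
  then show ?thesis by fastforce
qed

lemma swap_pair_tensors:
  assumes "0 < p" "[U, V] \<in> tensors p (p - 1)" shows "[V, U] \<in> tensors p (p - 1)"
  using assms unfolding pair_tensors_iff[OF assms(1)] top_tensors by auto

lemma length_top_tensor: "[w] \<in> tensors p p \<Longrightarrow> length w = Suc p"
proof -
  assume "[w] \<in> tensors p p"
  then have "distinct w" "set w = {0..p}" by (auto simp: top_tensors)
  then show ?thesis using distinct_card[of w] by simp
qed

context
  fixes R (structure)
  assumes R: "cring R"
begin

interpretation R: cring R by (rule R)

lemma sign_pow_closed [simp]: "(\<ominus> \<one>) [^] (n::nat) \<in> carrier R"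
  by simp

lemma sign_pow_square: "(\<ominus> \<one>) [^] (n::nat) \<otimes> (\<ominus> \<one>) [^] n = \<one>"
  by (simp add: minus_one_pow[OF R] R.l_minus)

lemma sign_pow_add: "(\<ominus> \<one>) [^] (m + n :: nat) = (\<ominus> \<one>) [^] m \<otimes> (\<ominus> \<one>) [^] n"
  by (rule R.nat_pow_mult[symmetric]) simp

lemma module_sym_free: "module R (sym_free R p n)"
  unfolding sym_free_def by (rule module_free_module[OF R])

text \<open>A relation exchanges two factors, so it needs a tensor with at least two of them.\<close>

lemma sym_relations_trivial:
  assumes "\<And>Z. Z \<in> tensors p n \<Longrightarrow> length Z < 2"
  shows "sym_relations R p n = {\<lambda>_. \<zero>}"
proof -
  have "A @ [U, V] @ B \<notin> tensors p n" for A B U V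
    using assms[of "A @ [U, V] @ B"] by auto
  then have "sym_relations R p n = module_span R (sym_free R p n) {}"
    by (simp add: sym_relations_def Let_def)
  then show ?thesis
    by (simp add: span_empty[OF module_sym_free]) (simp add: sym_free_def free_module_ops[OF R])
qed

lemma sym_relations_top: "sym_relations R p p = {\<lambda>_. \<zero>}"
  by (rule sym_relations_trivial) (auto simp: tensors_def)

lemma sym_free_zero: "\<zero>\<^bsub>sym_free R p n\<^esub> = (\<lambda>_. \<zero>)"
  by (simp add: sym_free_def free_module_ops[OF R])

lemma submodule_sym_relations: "submodule (sym_relations R p n) R (sym_free R p n)"
proof -
  interpret F: module R "sym_free R p n" by (rule module_sym_free)
  show ?thesis
    unfolding sym_relations_def Let_def
  proof (intro submodule_span[OF module_sym_free] subsetI, elim CollectE exE conjE)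
    fix x A B U V
    assume AB: "A @ [U, V] @ B \<in> tensors p n"
      and x: "x = free_gen R (A @ [U, V] @ B) \<ominus>\<^bsub>sym_free R p n\<^esub>
         ((\<ominus> \<one>) [^] (deg U * deg V)) \<odot>\<^bsub>sym_free R p n\<^esub> free_gen R (A @ [V, U] @ B)"
    have "A @ [V, U] @ B \<in> tensors p n" using AB by (auto simp: tensors_def)
    then show "x \<in> carrier (sym_free R p n)"
      unfolding x using AB free_gen_closed[OF R, of _ "tensors p n"]
      by (intro F.M.minus_closed F.smult_closed) (simp_all add: sym_free_def)
  qed
qed

text \<open>On a tensor with one factor the recursive definition of the faces reduces to cutting the word: the second
  summand of the product rule is a face of the empty tensor, and multiplication by the empty tensor
  is the identity.\<close>

lemma face_word:
  assumes "length w = Suc p" "i < p"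
  shows "face R (int i) [w] = free_gen R [take (Suc i) w, drop (Suc i) w]"
proof
  fix Z
  have wf: "word_face R (int i) w = free_gen R [take (Suc i) w, drop (Suc i) w]"
    using assms by (simp add: word_face_def deg_def)
  have x: "free_gen R A B \<in> carrier R" for A B :: tensor by (simp add: free_gen_def)
  \<comment> \<open>Only the cut at the end of \<open>Z\<close> leaves the empty tensor as the second factor.\<close>
  have "tensor_mult R (word_face R (int i) w) (free_gen R []) Z
      = (\<Oplus>j\<in>{..length Z}. word_face R (int i) w (take j Z) \<otimes> (if j = length Z then \<one> else \<zero>))"
    unfolding tensor_mult_def wf using x by (intro R.finsum_cong') (auto simp: free_gen_def)
  also have "\<dots> = word_face R (int i) w Z"
    by (subst finsum_delta[OF R]) (simp_all add: wf x)
  finally have "tensor_mult R (word_face R (int i) w) (free_gen R []) Z = word_face R (int i) w Z" .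
  moreover have "tensor_mult R (free_gen R [w]) (\<lambda>_. \<zero>) Z = \<zero>"
    unfolding tensor_mult_def using x by (intro R.add.finprod_one_eqI) simp
  ultimately show "face R (int i) [w] Z = free_gen R [take (Suc i) w, drop (Suc i) w] Z"
    using x by (simp add: wf)
qed

lemma face_top_closed:
  assumes "Z \<in> tensors p p" "i < p"
  shows "face R (int i) Z \<in> carrier (sym_free R p (p - 1))"
proof -
  obtain w where Z: "Z = [w]" and w: "[w] \<in> tensors p p" using assms(1) by (auto simp: top_tensors)
  have len: "length w = Suc p" by (rule length_top_tensor[OF w])
  have "[take (Suc i) w, drop (Suc i) w] \<in> tensors p (p - 1)"
  proof (subst pair_tensors_iff, goal_cases)
    case 2
    have "take (Suc i) w \<noteq> []" "drop (Suc i) w \<noteq> []" using len assms(2) by auto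
    then show ?case using w by auto
  qed (use assms(2) in simp)
  then show ?thesis
    unfolding Z face_word[OF len assms(2)] sym_free_def by (rule free_gen_closed[OF R])
qed

lemma top_diff_gen_closed:
  assumes "Z \<in> tensors p p"
  shows "(\<Oplus>\<^bsub>sym_free R p (p - 1)\<^esub>i\<in>{..<p}. ((\<ominus> \<one>) [^] i) \<odot>\<^bsub>sym_free R p (p - 1)\<^esub> face R (int i) Z)
    \<in> carrier (sym_free R p (p - 1))"
proof -
  interpret F: module R "sym_free R p (p - 1)" by (rule module_sym_free)
  show ?thesis using assms
    by (intro F.M.finsum_closed Pi_I F.smult_closed face_top_closed) auto
qed

lemma top_diff_hom: "top_diff R p \<in> module_homs R (sym_free R p p) (sym_free R p (p - 1))"
  using top_diff_gen_closed unfolding top_diff_def sym_free_def[of R p p]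
  by (intro lin_ext_hom[OF R module_sym_free])

lemma top_diff_gen:
  assumes Z: "Z \<in> tensors p p" and UV: "[U, V] \<in> tensors p (p - 1)" and p: "0 < p"
  shows "top_diff R p (free_gen R Z) [U, V] = (\<ominus> \<one>) [^] deg U \<otimes> free_gen R Z [U @ V]"
proof -
  let ?F = "sym_free R p (p - 1)"
  interpret F: module R ?F by (rule module_sym_free)
  obtain w where w: "Z = [w]" "[w] \<in> tensors p p" using Z by (auto simp: top_tensors)
  have len: "length w = Suc p" by (rule length_top_tensor[OF w(2)])
  have ne: "U \<noteq> []" "V \<noteq> []" "[U @ V] \<in> tensors p p"
    using pair_tensorsD[OF p UV] .
  then have lenUV: "length U + length V = Suc p" using length_top_tensor by fastforce
  have "top_diff R p (free_gen R Z) [U, V] = (\<Oplus>\<^bsub>?F\<^esub>i\<in>{..<p}. ((\<ominus> \<one>) [^] i) \<odot>\<^bsub>?F\<^esub> face R (int i) Z) [U, V]"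
    unfolding top_diff_def
    by (subst lin_ext_free_gen[OF R module_sym_free, where X = "tensors p p"])
       (use top_diff_gen_closed Z in auto)
  also have "\<dots> = (\<Oplus>i\<in>{..<p}. (((\<ominus> \<one>) [^] i) \<odot>\<^bsub>?F\<^esub> face R (int i) Z) [U, V])"
    unfolding sym_free_def
    by (rule finsum_free_module[OF R finite_lessThan],
        intro Pi_I F.smult_closed[unfolded sym_free_def] sign_pow_closed face_top_closed[OF Z, unfolded sym_free_def])
       simp
  also have "\<dots> = (\<Oplus>i\<in>{..<p}. (if w = U @ V then (\<ominus> \<one>) [^] i else \<zero>) \<otimes> (if i = deg U then \<one> else \<zero>))"
  proof (rule R.finsum_cong')
    fix i assume i: "i \<in> {..<p}"
    then have i': "i < p" by simp
    have split: "[U, V] = [take (Suc i) w, drop (Suc i) w] \<longleftrightarrow> w = U @ V \<and> i = deg U"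
    proof
      assume "[U, V] = [take (Suc i) w, drop (Suc i) w]"
      then have UV: "U = take (Suc i) w" "V = drop (Suc i) w" by simp_all
      then have "length U = Suc i" using len i' by simp
      with UV show "w = U @ V \<and> i = deg U" by (simp add: deg_def)
    next
      assume wi: "w = U @ V \<and> i = deg U"
      then have "Suc i = length U" using ne(1) by (simp add: deg_def)
      with wi show "[U, V] = [take (Suc i) w, drop (Suc i) w]" by simp
    qed
    have "face R (int i) Z [U, V] = (if w = U @ V \<and> i = deg U then \<one> else \<zero>)"
      unfolding w(1) face_word[OF len i'] free_gen_def split by (rule refl)
    then show "(((\<ominus> \<one>) [^] i) \<odot>\<^bsub>?F\<^esub> face R (int i) Z) [U, V]
        = (if w = U @ V then (\<ominus> \<one>) [^] i else \<zero>) \<otimes> (if i = deg U then \<one> else \<zero>)"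
      by (simp add: sym_free_def free_module_ops[OF R])
  qed auto
  also have "\<dots> = (if w = U @ V then (\<ominus> \<one>) [^] deg U else \<zero>)"
    using lenUV ne by (subst finsum_delta[OF R]) (auto simp: deg_def neq_Nil_conv)
  also have "\<dots> = (\<ominus> \<one>) [^] deg U \<otimes> free_gen R Z [U @ V]"
    by (auto simp: w free_gen_def)
  finally show ?thesis .
qed

text \<open>A word \<open>w\<close> contributes to the coefficient of \<open>U \<otimes> V\<close> only if \<open>w = U V\<close>, and then
  only through the face with index \<open>deg U\<close>, which has the sign \<open>(-1)^(deg U)\<close>.\<close>

lemma top_diff_apply:
  assumes f: "f \<in> carrier (sym_free R p p)" and UV: "[U, V] \<in> tensors p (p - 1)" and p: "0 < p"
  shows "top_diff R p f [U, V] = (\<ominus> \<one>) [^] deg U \<otimes> f [U @ V]"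
proof (rule hom_free_module_eqI[OF R module_regular_module[OF R],
      where f = "\<lambda>f. top_diff R p f [U, V]" and g = "\<lambda>f. (\<ominus> \<one>) [^] deg U \<otimes> f [U @ V]"])
  show "f \<in> carrier (free_module R (tensors p p))" using f by (simp add: sym_free_def)
  show "(\<lambda>f. top_diff R p f [U, V]) \<in> module_homs R (free_module R (tensors p p)) (regular_module R)"
    using module_homs_compose[OF top_diff_hom[unfolded sym_free_def] free_module_eval_hom[OF R]] .
  show "(\<lambda>f. (\<ominus> \<one>) [^] deg U \<otimes> f [U @ V]) \<in> module_homs R (free_module R (tensors p p)) (regular_module R)"
    by (rule module_homsI)
       (auto simp: regular_module_def free_module_ops[OF R] free_module_value[OF R] R.r_distr R.m_lcomm)
  show "top_diff R p (free_gen R Z) [U, V] = (\<ominus> \<one>) [^] deg U \<otimes> free_gen R Z [U @ V]"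
    if "Z \<in> tensors p p" for Z by (rule top_diff_gen[OF that UV p])
qed

text \<open>The relations in degree \<open>p - 1\<close> are antisymmetric, because \<open>U \<noteq> V\<close> and the square of the sign
  is \<open>1\<close>. Conversely, let \<open>P\<close> be the linear map that sends \<open>U \<otimes> V\<close> to
  \<open>U \<otimes> V - (-1)^(deg U deg V) V \<otimes> U\<close> if \<open>0\<close> occurs in \<open>U\<close>, and to \<open>0\<close>
  otherwise. Its values are relations, and it fixes every antisymmetric element.\<close>

lemma pair_relations_iff:
  assumes x: "x \<in> carrier (sym_free R p (p - 1))" and p: "0 < p"
  shows "x \<in> sym_relations R p (p - 1) \<longleftrightarrow>
    (\<forall>U V. [U, V] \<in> tensors p (p - 1) \<longrightarrow> x [U, V] \<oplus> (\<ominus> \<one>) [^] (deg U * deg V) \<otimes> x [V, U] = \<zero>)"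
    (is "_ \<longleftrightarrow> ?antisym")
proof
  let ?F = "sym_free R p (p - 1)"
  let ?s = "\<lambda>U V. (\<ominus> \<one>) [^] (deg U * deg V)"
  interpret F: module R ?F by (rule module_sym_free)
  have val: "x Z \<in> carrier R" for Z using x by (auto simp: sym_free_def free_module_value[OF R])
  have gen: "free_gen R Z \<in> carrier ?F" if "Z \<in> tensors p (p - 1)" for Z
    unfolding sym_free_def by (rule free_gen_closed[OF R that])
  note ops = free_module_ops[OF R, of "tensors p (p - 1)", folded sym_free_def]
  have rel_apply: "(free_gen R [U, V] \<ominus>\<^bsub>?F\<^esub> ?s U V \<odot>\<^bsub>?F\<^esub> free_gen R [V, U]) Z
      = free_gen R [U, V] Z \<ominus> ?s U V \<otimes> free_gen R [V, U] Z"
    if "[U, V] \<in> tensors p (p - 1)" for U V Z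
    using free_module_minus[OF R, of "free_gen R [U, V]" "tensors p (p - 1)" "?s U V \<odot>\<^bsub>?F\<^esub> free_gen R [V, U]" Z]
      gen[OF that] gen[OF swap_pair_tensors[OF p that]] F.smult_closed
    by (simp add: sym_free_def free_module_ops[OF R])
  {
    assume rel: "x \<in> sym_relations R p (p - 1)"
    show ?antisym
    proof (intro allI impI)
      fix U V assume UV: "[U, V] \<in> tensors p (p - 1)"
      have neq: "U \<noteq> V"
        using pair_tensorsD[OF p UV] by (auto simp: top_tensors)
      let ?\<phi> = "\<lambda>x. x [U, V] \<oplus> ?s U V \<otimes> x [V, U]"
      have \<phi>: "?\<phi> \<in> module_homs R ?F (regular_module R)"
        unfolding sym_free_def
        by (rule module_homsI)
           (simp_all add: regular_module_def free_module_ops[OF R] free_module_value[OF R]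
              R.r_distr R.m_lcomm R.a_assoc R.a_lcomm R.a_comm)
      have "?\<phi> x \<in> {\<zero>\<^bsub>regular_module R\<^esub>}"
      proof (rule hom_image_span[OF module_sym_free module_regular_module[OF R] \<phi>
            submodule_trivial[OF module_regular_module[OF R]] _ _ rel[unfolded sym_relations_def Let_def]])
        show "{free_gen R (A @ [U, V] @ B) \<ominus>\<^bsub>?F\<^esub> ?s U V \<odot>\<^bsub>?F\<^esub> free_gen R (A @ [V, U] @ B) | A U V B.
            A @ [U, V] @ B \<in> tensors p (p - 1)} \<subseteq> carrier ?F"
          using submodule_sym_relations[of p "p - 1"] F.submoduleE(1) span_superset
          unfolding sym_relations_def Let_def by (metis (no_types, lifting) subset_trans)
        fix g
        assume "g \<in> {free_gen R (A @ [U, V] @ B) \<ominus>\<^bsub>?F\<^esub> ?s U V \<odot>\<^bsub>?F\<^esub> free_gen R (A @ [V, U] @ B) | A U V B.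
            A @ [U, V] @ B \<in> tensors p (p - 1)}"
        then obtain A B U' V' where AB: "A @ [U', V'] @ B \<in> tensors p (p - 1)"
          and g: "g = free_gen R (A @ [U', V'] @ B) \<ominus>\<^bsub>?F\<^esub> ?s U' V' \<odot>\<^bsub>?F\<^esub> free_gen R (A @ [V', U'] @ B)"
          by blast
        have "length (A @ [U', V'] @ B) = 2" using AB p by (simp add: tensors_def)
        then have [simp]: "A = []" "B = []" by auto
        have "[U', V'] \<in> tensors p (p - 1)" using AB by simp
        then have g_apply: "g Z = free_gen R [U', V'] Z \<ominus> ?s U' V' \<otimes> free_gen R [V', U'] Z" for Z
          using rel_apply[of U' V' Z] by (simp add: g)
        consider "U' = U" "V' = V" | "U' = V" "V' = U"
          | "[U', V'] \<noteq> [U, V]" "[U', V'] \<noteq> [V, U]" by auto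
        then have "?\<phi> g = \<zero>"
        proof cases
          case 1
          then show ?thesis
            using neq sign_pow_square[of "deg U * deg V"]
            by (simp add: g_apply free_gen_def a_minus_def R.r_minus R.r_neg)
        next
          case 2
          then show ?thesis
            using neq by (simp add: g_apply free_gen_def a_minus_def mult.commute[of "deg V"] R.l_neg)
        next
          case 3
          then have "free_gen R [U', V'] [U, V] = \<zero>" "free_gen R [U', V'] [V, U] = \<zero>"
            "free_gen R [V', U'] [U, V] = \<zero>" "free_gen R [V', U'] [V, U] = \<zero>"
            by (auto simp: free_gen_def)
          then show ?thesis by (simp add: g_apply a_minus_def)
        qed
        then show "?\<phi> g \<in> {\<zero>\<^bsub>regular_module R\<^esub>}" by (simp add: regular_module_def)
      qed
      then show "?\<phi> x = \<zero>" by (simp add: regular_module_def)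
    qed
  }
  assume antisym: ?antisym
  have rel: "free_gen R [U, V] \<ominus>\<^bsub>?F\<^esub> ?s U V \<odot>\<^bsub>?F\<^esub> free_gen R [V, U] \<in> sym_relations R p (p - 1)"
    if "[U, V] \<in> tensors p (p - 1)" for U V
  proof -
    have "\<exists>A U' V' B. free_gen R [U, V] \<ominus>\<^bsub>?F\<^esub> ?s U V \<odot>\<^bsub>?F\<^esub> free_gen R [V, U] =
        free_gen R (A @ [U', V'] @ B) \<ominus>\<^bsub>?F\<^esub> ?s U' V' \<odot>\<^bsub>?F\<^esub> free_gen R (A @ [V', U'] @ B) \<and>
        A @ [U', V'] @ B \<in> tensors p (p - 1)"
      by (rule exI[of _ "[]"], rule exI[of _ U], rule exI[of _ V], rule exI[of _ "[]"]) (use that in simp)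
    then show ?thesis
      unfolding sym_relations_def Let_def by (intro subsetD[OF span_superset] CollectI)
  qed
  let ?c = "\<lambda>Z. if 0 \<in> set (Z ! 0)
    then free_gen R Z \<ominus>\<^bsub>?F\<^esub> ?s (Z ! 0) (Z ! 1) \<odot>\<^bsub>?F\<^esub> free_gen R [Z ! 1, Z ! 0] else \<zero>\<^bsub>?F\<^esub>"
  define P where "P = lin_ext R ?F ?c"
  have pairE: "\<exists>U V. Z = [U, V]" if "Z \<in> tensors p (p - 1)" for Z
    using that unfolding pair_tensors_iff[OF p] by blast
  have c_rel: "?c Z \<in> sym_relations R p (p - 1)" if "Z \<in> tensors p (p - 1)" for Z
  proof -
    from pairE[OF that] obtain U V where Z: "Z = [U, V]" by blast
    show ?thesis
      using rel[OF that[unfolded Z]] submodule_zero[OF module_sym_free submodule_sym_relations] by (simp add: Z)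
  qed
  have c_closed: "?c Z \<in> carrier ?F" if "Z \<in> tensors p (p - 1)" for Z
    using c_rel[OF that] F.submoduleE(1)[OF submodule_sym_relations] by blast
  have P: "P \<in> module_homs R ?F ?F"
    using lin_ext_hom[OF R module_sym_free c_closed] unfolding P_def sym_free_def[of R p "p - 1"] .
  have P_gen: "P (free_gen R Z) = ?c Z" if "Z \<in> tensors p (p - 1)" for Z
    unfolding P_def by (rule lin_ext_free_gen[OF R module_sym_free c_closed that])
  have "P x \<in> sym_relations R p (p - 1)"
    unfolding P_def lin_ext_def
  proof (rule submodule_finsum[OF module_sym_free submodule_sym_relations])
    have fin: "finite {Z. x Z \<noteq> \<zero>}" and sub: "{Z. x Z \<noteq> \<zero>} \<subseteq> tensors p (p - 1)"
      using x by (auto simp: sym_free_def free_module_carrier_iff[OF R])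
    show "finite {Z. x Z \<noteq> \<zero>}" by (rule fin)
    show "x Z \<odot>\<^bsub>?F\<^esub> ?c Z \<in> sym_relations R p (p - 1)" if "Z \<in> {Z. x Z \<noteq> \<zero>}" for Z
      using that sub by (intro submodule.smult_closed[OF submodule_sym_relations] val c_rel) blast
  qed
  moreover have "P x = x"
  proof
    fix Z
    show "P x Z = x Z"
    proof (cases "Z \<in> tensors p (p - 1)")
      case False
      then show ?thesis
        using module_homs_closed[OF P x] x by (simp add: sym_free_def free_module_carrier_iff[OF R])
    next
      case True
      then obtain U V where Z: "Z = [U, V]" and UV: "[U, V] \<in> tensors p (p - 1)"
        using pairE by blast
      note D = pair_tensorsD[OF p UV]
      let ?\<phi> = "\<lambda>x. if 0 \<in> set U then x [U, V] else \<ominus> (?s U V \<otimes> x [V, U])"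
      have "P x [U, V] = ?\<phi> x"
      proof (rule hom_free_module_eqI[OF R module_regular_module[OF R],
            where f = "\<lambda>x. P x [U, V]" and g = ?\<phi>])
        show "x \<in> carrier (free_module R (tensors p (p - 1)))" using x by (simp add: sym_free_def)
        show "(\<lambda>x. P x [U, V]) \<in> module_homs R (free_module R (tensors p (p - 1))) (regular_module R)"
          using module_homs_compose[OF P[unfolded sym_free_def] free_module_eval_hom[OF R]] .
        show "?\<phi> \<in> module_homs R (free_module R (tensors p (p - 1))) (regular_module R)"
          by (rule module_homsI)
             (simp_all add: regular_module_def free_module_ops[OF R] free_module_value[OF R]
                R.r_distr R.m_lcomm R.r_minus R.minus_add)
        show "P (free_gen R Z) [U, V] = ?\<phi> (free_gen R Z)" if Z: "Z \<in> tensors p (p - 1)" for Z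
        proof -
          obtain U' V' where Z': "Z = [U', V']" using pairE[OF Z] by blast
          note D' = pair_tensorsD[OF p Z[unfolded Z']]
          have U'V': "[U', V'] \<in> tensors p (p - 1)" using Z by (simp only: Z')
          have zero: "0 \<in> set U \<longleftrightarrow> 0 \<notin> set V" "0 \<in> set U' \<longleftrightarrow> 0 \<notin> set V'"
            using pair_tensors_zero[OF p UV] pair_tensors_zero[OF p U'V'] by simp_all
          show ?thesis
          proof (cases "0 \<in> set U'")
            case True
            then have "P (free_gen R Z) [U, V] = free_gen R [U', V'] [U, V] \<ominus> ?s U' V' \<otimes> free_gen R [V', U'] [U, V]"
              using P_gen[OF U'V'] rel_apply[OF U'V'] by (simp add: Z')
            moreover have "free_gen R [U', V'] [V, U] = \<zero>" if "0 \<in> set U"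
              using True that zero by (auto simp: free_gen_def)
            moreover have "free_gen R [U', V'] [U, V] = \<zero>" if "0 \<notin> set U"
              using True that by (auto simp: free_gen_def)
            moreover have "?s U' V' \<otimes> free_gen R [V', U'] [U, V] = ?s U V \<otimes> free_gen R [U', V'] [V, U]"
              by (auto simp: free_gen_def mult.commute)
            moreover have "free_gen R Z Y \<in> carrier R" for Y by (simp add: free_gen_def)
            ultimately show ?thesis by (simp add: a_minus_def Z')
          next
            case False
            then have "P (free_gen R Z) [U, V] = \<zero>"
              using P_gen[OF U'V'] by (simp add: Z' sym_free_zero)
            moreover have "free_gen R [U', V'] [U, V] = \<zero>" if "0 \<in> set U"
              using False that by (auto simp: free_gen_def)
            moreover have "free_gen R [U', V'] [V, U] = \<zero>" if "0 \<notin> set U"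
              using False that zero by (auto simp: free_gen_def)
            ultimately show ?thesis by (simp add: Z')
          qed
        qed
      qed
      also have "\<dots> = x [U, V]"
        using antisym UV val R.minus_equality[of "x [U, V]" "?s U V \<otimes> x [V, U]"] by auto
      finally show ?thesis by (simp add: Z)
    qed
  qed
  ultimately show "x \<in> sym_relations R p (p - 1)" by simp
qed


text \<open>The sign in the rotation rule. With \<open>|U| = a + 1\<close> and \<open>|V| = b + 1\<close>, the exponents
  \<open>a\<close>, \<open>a b\<close>, \<open>b\<close> and the minus sign add up to \<open>(a + 1)(b + 1)\<close> modulo \<open>2\<close>,
  and \<open>|U| |V| = |U| (p + 1 - |U|)\<close> has the parity of \<open>|U| p\<close>.\<close>

lemma swap_sign_iff:
  assumes x: "x \<in> carrier R" and y: "y \<in> carrier R" and p: "Suc a + Suc b = Suc p"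
  shows "(\<ominus> \<one>) [^] a \<otimes> x \<oplus> (\<ominus> \<one>) [^] (a * b) \<otimes> ((\<ominus> \<one>) [^] b \<otimes> y) = \<zero>
    \<longleftrightarrow> y = (\<ominus> \<one>) [^] (Suc a * p) \<otimes> x"
proof -
  have 1: "x' \<oplus> y' = \<zero> \<longleftrightarrow> y' = \<ominus> x'" if "x' \<in> carrier R" "y' \<in> carrier R" for x' y'
  proof
    assume "x' \<oplus> y' = \<zero>"
    then have "y' \<oplus> x' = \<zero>" using that by (simp add: R.a_comm)
    then show "y' = \<ominus> x'" using R.minus_equality that by simp
  qed (use that in \<open>simp add: R.r_neg\<close>)
  have 2: "\<ominus> x \<oplus> y = \<zero> \<longleftrightarrow> y = x"
    using 1[of "\<ominus> x" y] x y by simp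
  have 3: "x \<oplus> \<ominus> y = \<zero> \<longleftrightarrow> y = x"
  proof -
    have "x \<oplus> \<ominus> y = \<zero> \<longleftrightarrow> \<ominus> y = \<ominus> x" using 1[of x "\<ominus> y"] x y by simp
    also have "\<dots> \<longleftrightarrow> y = x"
    proof
      assume "\<ominus> y = \<ominus> x"
      then have "\<ominus> (\<ominus> y) = \<ominus> (\<ominus> x)" by simp
      then show "y = x" using x y by simp
    qed simp
    finally show ?thesis .
  qed
  have p': "p = Suc (a + b)" using p by simp
  show ?thesis
    unfolding minus_one_pow[OF R] p'
    using x y by (cases "even a"; cases "even b") (simp_all add: 1 2 3 R.l_minus)
qed

lemma rotate_in_tensors: "[w] \<in> tensors p p \<Longrightarrow> [rotate n w] \<in> tensors p p"
  by (simp add: top_tensors)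

lemma rotate_sign:
  assumes f: "f \<in> carrier (sym_free R p p)"
    and rot: "\<And>w. [w] \<in> tensors p p \<Longrightarrow> f [rotate1 w] = (\<ominus> \<one>) [^] p \<otimes> f [w]"
    and w: "[w] \<in> tensors p p"
  shows "f [rotate n w] = (\<ominus> \<one>) [^] (n * p) \<otimes> f [w]"
proof (induction n)
  case 0
  then show ?case using f by (simp add: sym_free_def free_module_value[OF R])
next
  case (Suc n)
  have "f [rotate (Suc n) w] = (\<ominus> \<one>) [^] p \<otimes> f [rotate n w]"
    using rot[OF rotate_in_tensors[OF w, of n]] by (simp add: rotate_Suc)
  also have "\<dots> = (\<ominus> \<one>) [^] (Suc n * p) \<otimes> f [w]"
    using f by (simp add: Suc sign_pow_add R.m_assoc sym_free_def free_module_value[OF R])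
  finally show ?case .
qed

text \<open>A condition for every cut of every word, equivalent to the one for cuts after the first letter. In
  degree \<open>p = 0\<close> the differential vanishes and rotation does nothing, so both sides hold.\<close>

lemma top_cycle_iff_rotate:
  assumes f: "f \<in> carrier (sym_free R p p)"
  shows "top_diff R p f \<in> sym_relations R p (p - 1) \<longleftrightarrow>
    (\<forall>w. [w] \<in> tensors p p \<longrightarrow> f [rotate1 w] = (\<ominus> \<one>) [^] p \<otimes> f [w])"
proof (cases "p = 0")
  case True
  have val: "f Z \<in> carrier R" for Z using f by (simp add: sym_free_def free_module_value[OF R])
  interpret F: module R "sym_free R 0 0" by (rule module_sym_free)
  have "top_diff R 0 f = \<zero>\<^bsub>sym_free R 0 0\<^esub>"
    by (simp add: top_diff_def lin_ext_def val F.M.finsum_zero)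
  then have "top_diff R p f \<in> sym_relations R p (p - 1)"
    using True sym_relations_top[of 0] by (simp add: sym_free_zero)
  moreover have "f [rotate1 w] = (\<ominus> \<one>) [^] p \<otimes> f [w]" if "[w] \<in> tensors p p" for w
    using length_top_tensor[OF that] True val by (cases w) auto
  ultimately show ?thesis by blast
next
  case False
  then have p: "0 < p" by simp
  have val: "f Z \<in> carrier R" for Z using f by (simp add: sym_free_def free_module_value[OF R])
  let ?rot = "\<forall>w. [w] \<in> tensors p p \<longrightarrow> f [rotate1 w] = (\<ominus> \<one>) [^] p \<otimes> f [w]"
  have "top_diff R p f \<in> sym_relations R p (p - 1) \<longleftrightarrow>
      (\<forall>U V. [U, V] \<in> tensors p (p - 1) \<longrightarrow> f [V @ U] = (\<ominus> \<one>) [^] (length U * p) \<otimes> f [U @ V])"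
    unfolding pair_relations_iff[OF module_homs_closed[OF top_diff_hom f] p]
  proof (intro iff_allI imp_cong refl)
    fix U V assume UV: "[U, V] \<in> tensors p (p - 1)"
    note D = pair_tensorsD[OF p UV]
    have len: "length U = Suc (deg U)" "Suc (deg U) + Suc (deg V) = Suc p"
      using D(1,2) length_top_tensor[OF D(3)] by (auto simp: deg_def neq_Nil_conv)
    show "top_diff R p f [U, V] \<oplus> (\<ominus> \<one>) [^] (deg U * deg V) \<otimes> top_diff R p f [V, U] = \<zero>
        \<longleftrightarrow> f [V @ U] = (\<ominus> \<one>) [^] (length U * p) \<otimes> f [U @ V]"
      unfolding top_diff_apply[OF f UV p] top_diff_apply[OF f swap_pair_tensors[OF p UV] p] len(1)
      by (rule swap_sign_iff[OF val val len(2)])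
  qed
  also have "\<dots> \<longleftrightarrow> ?rot"
  proof (intro iffI allI impI)
    fix w
    assume swap: "\<forall>U V. [U, V] \<in> tensors p (p - 1) \<longrightarrow> f [V @ U] = (\<ominus> \<one>) [^] (length U * p) \<otimes> f [U @ V]"
      and w: "[w] \<in> tensors p p"
    obtain a V where aV: "w = a # V" "V \<noteq> []"
      using length_top_tensor[OF w] p by (cases w) auto
    then have "[[a], V] \<in> tensors p (p - 1)" using w unfolding pair_tensors_iff[OF p] by auto
    then show "f [rotate1 w] = (\<ominus> \<one>) [^] p \<otimes> f [w]" using swap aV by fastforce
  next
    fix U V
    assume rot: ?rot and UV: "[U, V] \<in> tensors p (p - 1)"
    have "f [rotate (length U) (U @ V)] = (\<ominus> \<one>) [^] (length U * p) \<otimes> f [U @ V]"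
      by (rule rotate_sign[OF f _ pair_tensorsD(3)[OF p UV]]) (use rot in blast)
    then show "f [V @ U] = (\<ominus> \<one>) [^] (length U * p) \<otimes> f [U @ V]"
      by (simp add: rotate_append)
  qed
  finally show ?thesis .
qed

end

section \<open>The module of cycles\<close>

text \<open>The cycles and the action, before passing to the cosets of the zero relation module that form
  \<open>sym_module R p p\<close>.\<close>

definition top_cycles :: "('k, 'c) ring_scheme \<Rightarrow> nat \<Rightarrow> (tensor \<Rightarrow> 'k) set"
  where "top_cycles R p =
    {f \<in> carrier (sym_free R p p). top_diff R p f \<in> sym_relations R p (p - 1)}"

abbreviation cycle_module ::
  "('k, 'c) ring_scheme \<Rightarrow> nat \<Rightarrow> ('k, tensor \<Rightarrow> 'k) module"
  where "cycle_module R p \<equiv> sym_free R p p\<lparr>carrier := top_cycles R p\<rparr>"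

definition relabel :: "('k, 'c) ring_scheme \<Rightarrow> nat \<Rightarrow> (nat \<Rightarrow> nat) \<Rightarrow> (tensor \<Rightarrow> 'k) \<Rightarrow> tensor \<Rightarrow> 'k"
  where "relabel R p \<sigma> = lin_ext R (sym_free R p p) (\<lambda>Z. free_gen R (map (map \<sigma>) Z))"

text \<open>The element \<open>b_p\<close> as a function on tensors.\<close>

definition cyclic_sum :: "('k, 'c) ring_scheme \<Rightarrow> nat \<Rightarrow> tensor \<Rightarrow> 'k"
  where "cyclic_sum R p = (\<Oplus>\<^bsub>sym_free R p p\<^esub>j\<in>{0..p}.
    ((\<ominus>\<^bsub>R\<^esub> \<one>\<^bsub>R\<^esub>) [^]\<^bsub>R\<^esub> (j * p)) \<odot>\<^bsub>sym_free R p p\<^esub> free_gen R (perm_word p (tau p ^^ j)))"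

context
  fixes R (structure)
  assumes R: "cring R"
begin

interpretation R: cring R by (rule R)

lemmas [simp] = ring_sign_closed[OF R]

lemma sym_free_value: "f \<in> carrier (sym_free R p n) \<Longrightarrow> f Z \<in> carrier R"
  by (simp add: sym_free_def free_module_value[OF R])

lemma top_cycles_subset: "top_cycles R p \<subseteq> carrier (sym_free R p p)"
  by (auto simp: top_cycles_def)

lemma submodule_top_cycles: "submodule (top_cycles R p) R (sym_free R p p)"
  unfolding top_cycles_def
  by (rule submodule_vimage[OF module_sym_free[OF R] module_sym_free[OF R] top_diff_hom[OF R]
        submodule_sym_relations[OF R]])

text \<open>The word of \<open>\<pi> \<circ> \<tau>_p\<close> rotates to the word of \<open>\<pi>\<close>. Since the sign is its own
  inverse, it does not matter which of the two values is expressed through the other.\<close>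

lemma top_cycles_iff:
  "f \<in> top_cycles R p \<longleftrightarrow> f \<in> carrier (sym_free R p p) \<and>
    (\<forall>\<pi>. \<pi> permutes {0..p} \<longrightarrow>
      f (perm_word p (\<pi> \<circ> tau p)) = (\<ominus> \<one>) [^] p \<otimes> f (perm_word p \<pi>))" (is "_ \<longleftrightarrow> _ \<and> ?equi")
proof -
  have "(\<forall>w. [w] \<in> tensors p p \<longrightarrow> f [rotate1 w] = (\<ominus> \<one>) [^] p \<otimes> f [w]) \<longleftrightarrow> ?equi"
    if f: "f \<in> carrier (sym_free R p p)"
  proof -
    note val = sym_free_value[OF f]
    have invol: "x = (\<ominus> \<one>) [^] p \<otimes> y \<longleftrightarrow> y = (\<ominus> \<one>) [^] p \<otimes> x" if "x \<in> carrier R" "y \<in> carrier R" for x y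
      using that sign_pow_square[OF R, of p] by (metis R.l_one R.m_assoc sign_pow_closed[OF R])
    have "(\<forall>w. [w] \<in> tensors p p \<longrightarrow> f [rotate1 w] = (\<ominus> \<one>) [^] p \<otimes> f [w]) \<longleftrightarrow>
        (\<forall>\<pi>. \<pi> permutes {0..p} \<longrightarrow> f [rotate1 (map \<pi> [0..<Suc p])] = (\<ominus> \<one>) [^] p \<otimes> f (perm_word p \<pi>))"
      unfolding top_tensors_eq by (auto simp: perm_word_def simp del: upt_Suc)
    also have "\<dots> \<longleftrightarrow> (\<forall>\<pi>. \<pi> permutes {0..p} \<longrightarrow>
        f [rotate1 (map (\<pi> \<circ> tau p) [0..<Suc p])] = (\<ominus> \<one>) [^] p \<otimes> f (perm_word p (\<pi> \<circ> tau p)))"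
    proof (intro iffI allI impI)
      fix \<pi>
      assume rot: "\<forall>\<pi>. \<pi> permutes {0..p} \<longrightarrow> f [rotate1 (map (\<pi> \<circ> tau p) [0..<Suc p])]
          = (\<ominus> \<one>) [^] p \<otimes> f (perm_word p (\<pi> \<circ> tau p))" and \<pi>: "\<pi> permutes {0..p}"
      \<comment> \<open>Every permutation is of the form \<open>\<pi>' \<circ> \<tau>_p\<close>.\<close>
      have "(\<pi> \<circ> inv' (tau p)) permutes {0..p}"
        by (intro permutes_compose permutes_inv tau_permutes \<pi>)
      moreover have "\<pi> \<circ> inv' (tau p) \<circ> tau p = \<pi>"
        by (simp add: comp_assoc permutes_inv_o[OF tau_permutes])
      ultimately show "f [rotate1 (map \<pi> [0..<Suc p])] = (\<ominus> \<one>) [^] p \<otimes> f (perm_word p \<pi>)"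
        using rot by metis
    qed (use permutes_compose[OF tau_permutes] in blast)
    also have "\<dots> \<longleftrightarrow> ?equi"
      unfolding rotate1_perm_word perm_word_def[symmetric] by (simp add: invol val)
    finally show ?thesis .
  qed
  then show ?thesis using top_cycle_iff_rotate[OF R] by (auto simp: top_cycles_def)
qed

lemma top_cycles_cyclic:
  assumes f: "f \<in> top_cycles R p" and \<pi>: "\<pi> permutes {0..p}" and c: "c \<in> cyclic_subgroup p"
  shows "f (perm_word p (\<pi> \<circ> c)) = ring_sign R c \<otimes> f (perm_word p \<pi>)"
proof -
  have val: "f Z \<in> carrier R" for Z using f top_cycles_subset sym_free_value by blast
  have "f (perm_word p (\<pi> \<circ> tau p ^^ j)) = (\<ominus> \<one>) [^] (j * p) \<otimes> f (perm_word p \<pi>)" for j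
  proof (induction j)
    case 0
    then show ?case by (simp add: val)
  next
    case (Suc j)
    have step: "f (perm_word p ((\<pi> \<circ> tau p ^^ j) \<circ> tau p)) = (\<ominus> \<one>) [^] p \<otimes> f (perm_word p (\<pi> \<circ> tau p ^^ j))"
      using f permutes_compose[OF tau_funpow_permutes \<pi>] by (simp add: top_cycles_iff)
    have "(\<pi> \<circ> tau p ^^ j) \<circ> tau p = \<pi> \<circ> tau p ^^ Suc j"
      by (simp only: funpow_Suc_right comp_assoc)
    from step[unfolded this] show ?case
      by (simp only: Suc) (simp add: sign_pow_add[OF R] R.m_assoc val)
  qed
  then show ?thesis using c by (auto simp: cyclic_subgroup_eq ring_sign_tau_funpow[OF R])
qed

lemma top_ext:
  assumes f: "f \<in> carrier (sym_free R p p)" and g: "g \<in> carrier (sym_free R p p)"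
    and eq: "\<And>\<pi>. \<pi> permutes {0..p} \<Longrightarrow> f (perm_word p \<pi>) = g (perm_word p \<pi>)"
  shows "f = g"
proof
  fix Z
  show "f Z = g Z"
  proof (cases "Z \<in> tensors p p")
    case True
    then show ?thesis using eq by (auto simp: top_tensors_eq)
  next
    case False
    then show ?thesis using f g by (simp add: sym_free_def free_module_carrier_iff[OF R])
  qed
qed

lemma relabel_in_tensors: "\<sigma> permutes {0..p} \<Longrightarrow> Z \<in> tensors p p \<Longrightarrow> map (map \<sigma>) Z \<in> tensors p p"
  by (auto simp: top_tensors_eq map_perm_word permutes_compose)

lemma representation_relabel: "representation R (Sigma_group p) (sym_free R p p) (relabel R p)"
  unfolding relabel_def sym_free_def
  by (rule representation_free_module[OF R group_Sigma_group]) (simp_all add: relabel_in_tensors)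

lemma relabel_hom: "\<sigma> permutes {0..p} \<Longrightarrow> relabel R p \<sigma> \<in> module_homs R (sym_free R p p) (sym_free R p p)"
  using representation.linear[OF representation_relabel] by simp

lemma relabel_gen:
  assumes "\<sigma> permutes {0..p}" "Z \<in> tensors p p"
  shows "relabel R p \<sigma> (free_gen R Z) = free_gen R (map (map \<sigma>) Z)"
  unfolding relabel_def
  by (rule lin_ext_free_gen[OF R module_sym_free[OF R] _ assms(2)])
     (simp add: sym_free_def free_gen_closed[OF R] relabel_in_tensors assms(1))

lemma relabel_apply:
  assumes f: "f \<in> carrier (sym_free R p p)" and \<sigma>: "\<sigma> permutes {0..p}"
  shows "relabel R p \<sigma> f (map (map \<sigma>) Z) = f Z"
proof (rule hom_free_module_eqI[OF R module_regular_module[OF R],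
    where f = "\<lambda>f. relabel R p \<sigma> f (map (map \<sigma>) Z)" and g = "\<lambda>f. f Z"])
  show "f \<in> carrier (free_module R (tensors p p))" using f by (simp add: sym_free_def)
  show "(\<lambda>f. relabel R p \<sigma> f (map (map \<sigma>) Z)) \<in> module_homs R (free_module R (tensors p p)) (regular_module R)"
    using module_homs_compose[OF relabel_hom[OF \<sigma>, unfolded sym_free_def] free_module_eval_hom[OF R]] .
  show "(\<lambda>f. f Z) \<in> module_homs R (free_module R (tensors p p)) (regular_module R)"
    by (rule free_module_eval_hom[OF R])
  have "inj (map (map \<sigma>))" using permutes_inj[OF \<sigma>] by (intro inj_mapI)
  then show "relabel R p \<sigma> (free_gen R Y) (map (map \<sigma>) Z) = free_gen R Y Z" if "Y \<in> tensors p p" for Y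
    by (simp only: relabel_gen[OF \<sigma> that]) (simp only: free_gen_def inj_eq)
qed

lemma relabel_perm_word:
  assumes "f \<in> carrier (sym_free R p p)" "\<sigma> permutes {0..p}"
  shows "relabel R p \<sigma> f (perm_word p \<pi>) = f (perm_word p (inv' \<sigma> \<circ> \<pi>))"
  using relabel_apply[OF assms, of "perm_word p (inv' \<sigma> \<circ> \<pi>)"] permutes_inv_o(1)[OF assms(2)]
  by (simp add: map_perm_word comp_assoc[symmetric])

lemma relabel_top_cycles:
  assumes \<sigma>: "\<sigma> permutes {0..p}" and f: "f \<in> top_cycles R p"
  shows "relabel R p \<sigma> f \<in> top_cycles R p"
proof -
  have fF: "f \<in> carrier (sym_free R p p)" using f top_cycles_subset by blast
  then show ?thesis
    using f module_homs_closed[OF relabel_hom[OF \<sigma>] fF] permutes_compose[OF _ permutes_inv[OF \<sigma>]]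
    unfolding top_cycles_iff by (simp add: relabel_perm_word[OF fF \<sigma>] comp_assoc[symmetric])
qed

lemma representation_top_cycles:
  "representation R (Sigma_group p) (sym_free R p p\<lparr>carrier := top_cycles R p\<rparr>) (relabel R p)"
  by (rule subrepresentation[OF representation_relabel submodule_top_cycles])
     (simp add: relabel_top_cycles)

lemma cyclic_sum_closed: "cyclic_sum R p \<in> carrier (sym_free R p p)"
proof -
  interpret F: module R "sym_free R p p" by (rule module_sym_free[OF R])
  show ?thesis
    unfolding cyclic_sum_def sym_free_def
    by (intro F.M.finsum_closed[unfolded sym_free_def] Pi_I F.smult_closed[unfolded sym_free_def]
        free_gen_closed[OF R] perm_word_in_tensors tau_funpow_permutes sign_pow_closed[OF R])
qed

lemma cyclic_sum_apply:
  assumes \<pi>: "\<pi> permutes {0..p}"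
  shows "cyclic_sum R p (perm_word p \<pi>) = (if \<pi> \<in> cyclic_subgroup p then ring_sign R \<pi> else \<zero>)"
proof -
  interpret F: module R "sym_free R p p" by (rule module_sym_free[OF R])
  have "cyclic_sum R p (perm_word p \<pi>) = (\<Oplus>j\<in>{0..p}.
      (((\<ominus> \<one>) [^] (j * p)) \<odot>\<^bsub>sym_free R p p\<^esub> free_gen R (perm_word p (tau p ^^ j))) (perm_word p \<pi>))"
    unfolding cyclic_sum_def sym_free_def
    by (rule finsum_free_module[OF R finite_atLeastAtMost])
       (intro Pi_I F.smult_closed[unfolded sym_free_def]
        free_gen_closed[OF R] perm_word_in_tensors tau_funpow_permutes sign_pow_closed[OF R])
  also have "\<dots> = (\<Oplus>j\<in>{0..p}. if \<pi> = tau p ^^ j then ring_sign R \<pi> else \<zero>)"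
    by (intro R.finsum_cong')
       (auto simp: sym_free_def free_module_ops[OF R] free_gen_def ring_sign_tau_funpow[OF R]
         perm_word_eq_iff[OF \<pi> tau_funpow_permutes])
  also have "\<dots> = (if \<pi> \<in> cyclic_subgroup p then ring_sign R \<pi> else \<zero>)"
  proof (cases "\<pi> \<in> cyclic_subgroup p")
    case True
    then obtain i where i: "i \<in> {0..p}" "\<pi> = tau p ^^ i" by (auto simp: cyclic_subgroup_eq)
    have "(\<Oplus>j\<in>{0..p}. if \<pi> = tau p ^^ j then ring_sign R \<pi> else \<zero>)
        = (\<Oplus>j\<in>{0..p}. if i = j then ring_sign R \<pi> else \<zero>)"
      using i inj_onD[OF tau_funpow_inj] by (intro R.finsum_cong') auto
    also have "\<dots> = ring_sign R \<pi>"
      using i by (intro R.finsum_singleton) auto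
    finally show ?thesis using True by simp
  next
    case False
    then have "(\<Oplus>j\<in>{0..p}. if \<pi> = tau p ^^ j then ring_sign R \<pi> else \<zero>) = \<zero>"
      by (intro R.add.finprod_one_eqI) (auto simp: cyclic_subgroup_eq)
    with False show ?thesis by simp
  qed
  finally show ?thesis .
qed

lemma cyclic_mult_iff:
  assumes "c \<in> cyclic_subgroup p" "\<pi> permutes {0..p}"
  shows "\<pi> \<circ> c \<in> cyclic_subgroup p \<longleftrightarrow> \<pi> \<in> cyclic_subgroup p"
    and "inv' c \<circ> \<pi> \<in> cyclic_subgroup p \<longleftrightarrow> \<pi> \<in> cyclic_subgroup p"
proof -
  interpret G: group "Sigma_group p" by (rule group_Sigma_group)
  interpret C: subgroup "cyclic_subgroup p" "Sigma_group p" by (rule subgroup_cyclic)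
  have c: "c permutes {0..p}" using assms(1) C.subset by auto
  have "inv' c \<in> cyclic_subgroup p" using C.m_inv_closed[OF assms(1)] by (simp add: inv_Sigma_group c)
  moreover have "\<pi> \<circ> c \<circ> inv' c = \<pi>" "c \<circ> (inv' c \<circ> \<pi>) = \<pi>"
    using permutes_inv_o[OF c] by (simp add: comp_assoc, simp add: comp_assoc[symmetric])
  ultimately show "\<pi> \<circ> c \<in> cyclic_subgroup p \<longleftrightarrow> \<pi> \<in> cyclic_subgroup p"
    "inv' c \<circ> \<pi> \<in> cyclic_subgroup p \<longleftrightarrow> \<pi> \<in> cyclic_subgroup p"
    using C.m_closed assms(1) by (metis Sigma_group_simps(2))+
qed

lemma cyclic_sum_top_cycle: "cyclic_sum R p \<in> top_cycles R p"
  using tau_in_cyclic[where p = p and j = 1] ring_sign_tau_funpow[OF R, where p = p and j = 1] R.m_comm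
  by (auto simp: top_cycles_iff cyclic_sum_closed cyclic_sum_apply permutes_compose[OF tau_permutes]
      cyclic_mult_iff ring_sign_compose[OF R _ tau_permutes])

text \<open>The cyclic group acts by the sign on the line spanned by \<open>b_p\<close>, because \<open>b_p\<close> is the sign
  character extended by zero: \<open>sgn(c\<inverse> \<pi>) = sgn(c) sgn(\<pi>)\<close>.\<close>

lemma relabel_cyclic_sum:
  assumes c: "c \<in> cyclic_subgroup p"
  shows "relabel R p c (cyclic_sum R p) = ring_sign R c \<odot>\<^bsub>sym_free R p p\<^esub> cyclic_sum R p"
proof (rule top_ext)
  interpret F: module R "sym_free R p p" by (rule module_sym_free[OF R])
  have cp: "c permutes {0..p}"
    using c subgroup.subset[OF subgroup_cyclic] by auto
  show "relabel R p c (cyclic_sum R p) \<in> carrier (sym_free R p p)"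
    by (rule module_homs_closed[OF relabel_hom[OF cp] cyclic_sum_closed])
  show "ring_sign R c \<odot>\<^bsub>sym_free R p p\<^esub> cyclic_sum R p \<in> carrier (sym_free R p p)"
    by (intro F.smult_closed cyclic_sum_closed ring_sign_closed[OF R])
  fix \<pi> assume \<pi>: "\<pi> permutes {0..p}"
  have cpi: "(inv' c \<circ> \<pi>) permutes {0..p}" by (rule permutes_compose[OF \<pi> permutes_inv[OF cp]])
  have "c \<circ> (inv' c \<circ> \<pi>) = \<pi>" using permutes_inv_o(1)[OF cp] by (simp add: comp_assoc[symmetric])
  then have "ring_sign R \<pi> = ring_sign R c \<otimes> ring_sign R (inv' c \<circ> \<pi>)"
    using ring_sign_compose[OF R cp cpi] by simp
  then have "ring_sign R c \<otimes> ring_sign R \<pi> = ring_sign R (inv' c \<circ> \<pi>)"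
    using ring_sign_square[OF R, of c] by (simp add: ring_sign_closed[OF R] flip: R.m_assoc)
  then show "relabel R p c (cyclic_sum R p) (perm_word p \<pi>)
      = (ring_sign R c \<odot>\<^bsub>sym_free R p p\<^esub> cyclic_sum R p) (perm_word p \<pi>)"
    unfolding relabel_perm_word[OF cyclic_sum_closed cp]
    by (simp add: cyclic_sum_apply \<pi> cpi cyclic_mult_iff c sym_free_def free_module_ops[OF R] ring_sign_closed[OF R])
qed


text \<open>At a permutation \<open>\<pi>\<close> only the summand of the representative \<open>t\<close> of the coset of
  \<open>\<pi>\<close> is nonzero. Its value \<open>f(t) sgn(t\<inverse> \<pi>)\<close> is \<open>f(\<pi>)\<close> by the transformation
  rule of cycles.\<close>

lemma top_cycles_decomposition:
  assumes T: "left_transversal (Sigma_group p) (cyclic_subgroup p) T" and f: "f \<in> top_cycles R p"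
  shows "f = (\<Oplus>\<^bsub>cycle_module R p\<^esub>t\<in>T.
    relabel R p t (f (perm_word p t) \<odot>\<^bsub>sym_free R p p\<^esub> cyclic_sum R p))"
proof -
  interpret F: module R "sym_free R p p" by (rule module_sym_free[OF R])
  interpret K: representation R "Sigma_group p" "cycle_module R p" "relabel R p"
    by (rule representation_top_cycles)
  have Tp: "t permutes {0..p}" if "t \<in> T" for t using T that by (auto simp: left_transversal_def)
  then have finT: "finite T"
    by (intro finite_subset[OF _ finite_permutations[of "{0..p}"]]) auto
  have val: "f Z \<in> carrier R" for Z using f top_cycles_subset sym_free_value by blast
  have term_cycle: "relabel R p t (f (perm_word p t) \<odot>\<^bsub>sym_free R p p\<^esub> cyclic_sum R p) \<in> top_cycles R p"
    if "t \<in> T" for t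
    by (intro relabel_top_cycles Tp[OF that] submodule.smult_closed[OF submodule_top_cycles]
        cyclic_sum_top_cycle val)
  have "f = (\<Oplus>\<^bsub>sym_free R p p\<^esub>t\<in>T. relabel R p t (f (perm_word p t) \<odot>\<^bsub>sym_free R p p\<^esub> cyclic_sum R p))"
  proof (rule top_ext)
    show "f \<in> carrier (sym_free R p p)" using f top_cycles_subset by blast
    show "(\<Oplus>\<^bsub>sym_free R p p\<^esub>t\<in>T. relabel R p t (f (perm_word p t) \<odot>\<^bsub>sym_free R p p\<^esub> cyclic_sum R p))
        \<in> carrier (sym_free R p p)"
      using term_cycle top_cycles_subset by (intro F.M.finsum_closed) blast
    fix \<pi> assume \<pi>: "\<pi> permutes {0..p}"
    obtain t where t: "t \<in> T" "inv' t \<circ> \<pi> \<in> cyclic_subgroup p"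
      and uniq: "\<And>s. s \<in> T \<Longrightarrow> inv' s \<circ> \<pi> \<in> cyclic_subgroup p \<Longrightarrow> s = t"
      using left_transversal_unique[OF group_Sigma_group subgroup_cyclic T, of \<pi>] \<pi>
      by (auto simp: inv_Sigma_group Tp)
    have inv_perm: "(inv' s \<circ> \<pi>) permutes {0..p}" if "s \<in> T" for s
      by (rule permutes_compose[OF \<pi> permutes_inv[OF Tp[OF that]]])
    have "(\<Oplus>\<^bsub>sym_free R p p\<^esub>t\<in>T. relabel R p t (f (perm_word p t) \<odot>\<^bsub>sym_free R p p\<^esub> cyclic_sum R p)) (perm_word p \<pi>)
        = (\<Oplus>s\<in>T. relabel R p s (f (perm_word p s) \<odot>\<^bsub>sym_free R p p\<^esub> cyclic_sum R p) (perm_word p \<pi>))"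
      unfolding sym_free_def
      by (rule finsum_free_module[OF R finT])
         (use term_cycle top_cycles_subset in \<open>auto simp: sym_free_def\<close>)
    also have "\<dots> = (\<Oplus>s\<in>T. if t = s then f (perm_word p s) \<otimes> ring_sign R (inv' s \<circ> \<pi>) else \<zero>)"
    proof (rule R.finsum_cong')
      fix s assume s: "s \<in> T"
      have "f (perm_word p s) \<odot>\<^bsub>sym_free R p p\<^esub> cyclic_sum R p \<in> carrier (sym_free R p p)"
        by (intro F.smult_closed val cyclic_sum_closed)
      then have "relabel R p s (f (perm_word p s) \<odot>\<^bsub>sym_free R p p\<^esub> cyclic_sum R p) (perm_word p \<pi>)
          = f (perm_word p s) \<otimes> cyclic_sum R p (perm_word p (inv' s \<circ> \<pi>))"
        by (subst relabel_perm_word[OF _ Tp[OF s]]) (simp_all add: sym_free_def free_module_ops[OF R])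
      then show "relabel R p s (f (perm_word p s) \<odot>\<^bsub>sym_free R p p\<^esub> cyclic_sum R p) (perm_word p \<pi>)
          = (if t = s then f (perm_word p s) \<otimes> ring_sign R (inv' s \<circ> \<pi>) else \<zero>)"
        using t uniq[OF s] by (auto simp: cyclic_sum_apply[OF inv_perm[OF s]] val)
    qed (auto simp: val)
    also have "\<dots> = f (perm_word p t) \<otimes> ring_sign R (inv' t \<circ> \<pi>)"
      using t(1) finT val by (intro R.finsum_singleton) auto
    also have "\<dots> = f (perm_word p (t \<circ> (inv' t \<circ> \<pi>)))"
      using top_cycles_cyclic[OF f Tp[OF t(1)] t(2)] val by (simp add: R.m_comm)
    also have "t \<circ> (inv' t \<circ> \<pi>) = \<pi>"
      using permutes_inv_o(1)[OF Tp[OF t(1)]] by (simp add: comp_assoc[symmetric])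
    finally show "f (perm_word p \<pi>) = (\<Oplus>\<^bsub>sym_free R p p\<^esub>t\<in>T.
        relabel R p t (f (perm_word p t) \<odot>\<^bsub>sym_free R p p\<^esub> cyclic_sum R p)) (perm_word p \<pi>)" ..
  qed
  moreover
  \<comment> \<open>A sum in the submodule is a priori different from the sum in the full module, because
    \<open>finsum\<close> depends on the carrier.\<close>
  have incl: "(\<lambda>x. x) \<in> module_homs R (cycle_module R p) (sym_free R p p)"
    using top_cycles_subset by (intro module_homsI) auto
  have "(\<Oplus>\<^bsub>cycle_module R p\<^esub>t\<in>T. relabel R p t (f (perm_word p t) \<odot>\<^bsub>sym_free R p p\<^esub> cyclic_sum R p))
      = (\<Oplus>\<^bsub>sym_free R p p\<^esub>t\<in>T. relabel R p t (f (perm_word p t) \<odot>\<^bsub>sym_free R p p\<^esub> cyclic_sum R p))"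
    by (rule module_homs_finsum[OF K.module_axioms F.module_axioms incl finT]) (simp add: term_cycle)
  ultimately show ?thesis by simp
qed

text \<open>The projection to the summand of \<open>t\<close> is evaluation at the word of \<open>t\<close>.\<close>

lemma top_cycles_iso_induced:
  "rep_isomorphic R (Sigma_group p) (cycle_module R p) (relabel R p)
    (induced_module R (Sigma_group p) (cyclic_subgroup p) (regular_module R) (sign_action R))
    (induced_action R (Sigma_group p) (cyclic_subgroup p) (regular_module R) (sign_action R))"
proof -
  interpret F: module R "sym_free R p p" by (rule module_sym_free[OF R])
  interpret K: representation R "Sigma_group p" "cycle_module R p" "relabel R p"
    by (rule representation_top_cycles)
  obtain T where T: "left_transversal (Sigma_group p) (cyclic_subgroup p) T"
    using left_transversal_exists[OF group_Sigma_group subgroup_cyclic] by blast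
  have Tp: "t permutes {0..p}" if "t \<in> T" for t using T that by (auto simp: left_transversal_def)
  have reg [simp]: "carrier (regular_module R) = carrier R" "\<zero>\<^bsub>regular_module R\<^esub> = \<zero>"
    "x \<oplus>\<^bsub>regular_module R\<^esub> y = x \<oplus> y" "a \<odot>\<^bsub>regular_module R\<^esub> x = a \<otimes> x" for a x y
    by (simp_all add: regular_module_def)
  have Cp: "c permutes {0..p}" if "c \<in> cyclic_subgroup p" for c
    using that subgroup.subset[OF subgroup_cyclic] by auto
  have multiple: "a \<odot>\<^bsub>sym_free R p p\<^esub> cyclic_sum R p \<in> top_cycles R p" if "a \<in> carrier R" for a
    by (intro submodule.smult_closed[OF submodule_top_cycles] that cyclic_sum_top_cycle)
  have coord: "relabel R p t (a \<odot>\<^bsub>sym_free R p p\<^esub> cyclic_sum R p) (perm_word p s)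
      = a \<otimes> (if inv' t \<circ> s \<in> cyclic_subgroup p then ring_sign R (inv' t \<circ> s) else \<zero>)"
    if "t \<in> T" "s \<in> T" "a \<in> carrier R" for s t a
  proof -
    have "(inv' t \<circ> s) permutes {0..p}"
      by (rule permutes_compose[OF Tp[OF that(2)] permutes_inv[OF Tp[OF that(1)]]])
    then show ?thesis
      using multiple[OF that(3)] top_cycles_subset
      by (subst relabel_perm_word[OF _ Tp[OF that(1)]])
         (auto simp: sym_free_def free_module_ops[OF R] cyclic_sum_apply)
  qed
  have same_coset: "inv' t \<circ> s \<in> cyclic_subgroup p \<longleftrightarrow> s = t" if "s \<in> T" "t \<in> T" for s t
  proof -
    have "inv' r \<circ> r = id" if "r \<in> T" for r using permutes_inv_o(2)[OF Tp[OF that]] .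
    then show ?thesis
      using left_transversal_unique[OF group_Sigma_group subgroup_cyclic T, of s] that Tp
        subgroup.one_closed[OF subgroup_cyclic] by (auto simp: inv_Sigma_group)
  qed
  show ?thesis
  proof (rule induction_data.rep_isomorphic_induced[OF _ representation_top_cycles, where T = T and j = "\<lambda>a. a \<odot>\<^bsub>sym_free R p p\<^esub> cyclic_sum R p"
          and c = "\<lambda>t f. f (perm_word p t)"])
    show "induction_data R (Sigma_group p) (regular_module R) (cyclic_subgroup p) (sign_action R)"
      by (intro induction_data.intro R group_Sigma_group subgroup_cyclic module_regular_module[OF R])
         (simp add: sign_action_eq[OF R])
    show "(\<lambda>a. a \<odot>\<^bsub>sym_free R p p\<^esub> cyclic_sum R p) \<in> module_homs R (regular_module R) (cycle_module R p)"
      by (rule module_homsI) (simp_all add: multiple F.smult_l_distr F.smult_assoc1 cyclic_sum_closed)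
    show "relabel R p h (x \<odot>\<^bsub>sym_free R p p\<^esub> cyclic_sum R p)
        = sign_action R h x \<odot>\<^bsub>sym_free R p p\<^esub> cyclic_sum R p"
      if h: "h \<in> cyclic_subgroup p" and x: "x \<in> carrier (regular_module R)" for h x
      using x by (simp add: module_homs_smult[OF relabel_hom[OF Cp[OF h]]] cyclic_sum_closed
          relabel_cyclic_sum[OF h] sign_action_eq[OF R] R.m_comm[of "ring_sign R h"] F.smult_assoc1)
    show "left_transversal (Sigma_group p) (cyclic_subgroup p) T" by (rule T)
    show "finite T"
      using Tp by (intro finite_subset[OF _ finite_permutations[of "{0..p}"]]) auto
    show "(\<lambda>f. f (perm_word p t)) \<in> module_homs R (cycle_module R p) (regular_module R)" for t
    proof (rule module_homsI)
      show "f (perm_word p t) \<in> carrier (regular_module R)" if "f \<in> carrier (cycle_module R p)" for f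
        using that sym_free_value[OF subsetD[OF top_cycles_subset]] by simp
    qed (simp_all add: sym_free_def free_module_ops[OF R])
    show "relabel R p t (x \<odot>\<^bsub>sym_free R p p\<^esub> cyclic_sum R p) (perm_word p t) = x"
      if "t \<in> T" "x \<in> carrier (regular_module R)" for t x
      using that same_coset[OF that(1) that(1)] permutes_inv_o(2)[OF Tp[OF that(1)]]
      by (simp add: coord ring_sign_id[OF R])
    show "relabel R p t (x \<odot>\<^bsub>sym_free R p p\<^esub> cyclic_sum R p) (perm_word p s) = \<zero>\<^bsub>regular_module R\<^esub>"
      if "s \<in> T" "t \<in> T" "s \<noteq> t" "x \<in> carrier (regular_module R)" for s t x
      using that same_coset[OF that(1,2)] by (simp add: coord)
    show "v = (\<Oplus>\<^bsub>cycle_module R p\<^esub>t\<in>T.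
        relabel R p t (v (perm_word p t) \<odot>\<^bsub>sym_free R p p\<^esub> cyclic_sum R p))"
      if "v \<in> carrier (cycle_module R p)" for v
      using that by (intro top_cycles_decomposition[OF T]) simp
  qed
qed

section \<open>Homology in top degree\<close>

lemma sym_module_top:
  "carrier (sym_module R p p) = (\<lambda>f. {f}) ` carrier (sym_free R p p)"
  "(\<lambda>f. {f}) \<in> module_homs R (sym_free R p p) (sym_module R p p)"
  using quot_trivial_carrier[OF module_sym_free[OF R], of p p] quot_trivial_hom[OF module_sym_free[OF R], of p p]
  by (simp_all add: sym_module_def sym_relations_top[OF R] sym_free_zero[OF R])

lemma module_sym_module: "module R (sym_module R p n)"
  unfolding sym_module_def by (rule module_quot_module[OF module_sym_free[OF R] submodule_sym_relations[OF R]])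

lemma top_zero: "\<zero>\<^bsub>sym_module R p p\<^esub> = {\<zero>\<^bsub>sym_free R p p\<^esub>}"
  by (simp add: sym_module_def quot_module_def sym_relations_top[OF R] sym_free_zero[OF R])

lemma top_singleton_coset:
  "x \<in> carrier (sym_free R p p) \<Longrightarrow> sym_relations R p p +>\<^bsub>sym_free R p p\<^esub> x = {x}"
  using singleton_coset[OF module_sym_free[OF R]] by (simp add: sym_relations_top[OF R] sym_free_zero[OF R])

lemma sym_action_top:
  assumes "f \<in> carrier (sym_free R p p)" "\<sigma> permutes {0..p}"
  shows "sym_action R p p \<sigma> {f} = {relabel R p \<sigma> f}"
  using top_singleton_coset[OF module_homs_closed[OF relabel_hom[OF assms(2)] assms(1)]]
  by (simp add: sym_action_def Let_def quot_map_def relabel_def)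

lemma sym_cycles_top: "carrier (sym_cycles R p p) = (\<lambda>f. {f}) ` top_cycles R p"
proof -
  have "sym_diff R p p {f} = \<zero>\<^bsub>sym_module R p (p - 1)\<^esub> \<longleftrightarrow> f \<in> top_cycles R p"
    if f: "f \<in> carrier (sym_free R p p)" for f
  proof -
    let ?F = "sym_free R p (p - 1)" and ?N = "sym_relations R p (p - 1)"
    have d: "top_diff R p f \<in> carrier ?F" by (rule module_homs_closed[OF top_diff_hom[OF R] f])
    have "sym_diff R p p {f} = ?N +>\<^bsub>?F\<^esub> top_diff R p f"
      by (simp add: sym_diff_def Let_def quot_map_def top_diff_def)
    moreover have "\<zero>\<^bsub>sym_module R p (p - 1)\<^esub> = ?N"
      by (simp add: sym_module_def quot_module_def)
    moreover have "?N +>\<^bsub>?F\<^esub> top_diff R p f = ?N \<longleftrightarrow> top_diff R p f \<in> ?N"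
      by (rule coset_eq_self_iff[OF module_sym_free[OF R] submodule_sym_relations[OF R] d])
    ultimately show ?thesis using f by (simp add: top_cycles_def)
  qed
  then show ?thesis
    using subsetD[OF top_cycles_subset] by (auto simp: sym_cycles_def sym_module_top)
qed

lemma sym_boundaries_top: "sym_boundaries R p p = {\<zero>\<^bsub>sym_cycles R p p\<^esub>}"
proof -
  have empty: "tensors p (p + 1) = {}" by (auto simp: tensors_def)
  have zero: "sym_relations R p (p + 1) = {\<lambda>_. \<zero>}"
    by (rule sym_relations_trivial[OF R]) (use empty in blast)
  have "carrier (sym_free R p (p + 1)) = {\<lambda>_. \<zero>}"
    unfolding sym_free_def empty by (auto simp: free_module_carrier_iff[OF R])
  then have "carrier (sym_module R p (p + 1)) = {{\<lambda>_. \<zero>}}"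
    using quot_trivial_carrier[OF module_sym_free[OF R], of p "p + 1"]
    by (simp add: sym_module_def zero[unfolded Suc_eq_plus1[symmetric]] sym_free_zero[OF R])
  moreover have "sym_diff R p (p + 1) {\<lambda>_. \<zero>} = {\<zero>\<^bsub>sym_free R p p\<^esub>}"
  proof -
    interpret F: module R "sym_free R p p" by (rule module_sym_free[OF R])
    show ?thesis
      using top_singleton_coset[OF F.M.zero_closed]
      by (simp add: sym_diff_def Let_def quot_map_def lin_ext_def)
  qed
  ultimately show ?thesis
    using top_zero by (simp add: sym_boundaries_def sym_cycles_def)
qed

lemma singleton_hom_cycles: "(\<lambda>f. {f}) \<in> module_homs R (cycle_module R p) (sym_cycles R p p)"
proof -
  have sub: "f \<in> carrier (sym_free R p p)" if "f \<in> top_cycles R p" for f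
    using that top_cycles_subset by blast
  show ?thesis
    using module_homs_add[OF sym_module_top(2)[of p]] module_homs_smult[OF sym_module_top(2)[of p]]
    by (intro module_homsI) (simp_all add: sym_cycles_top sub, simp_all add: sym_cycles_def)
qed

lemma module_sym_cycles: "module R (sym_cycles R p p)"
proof (rule module_onto)
  show "module R (cycle_module R p)"
    using representation_top_cycles by (simp add: representation_def)
  show "(\<lambda>f. {f}) ` carrier (cycle_module R p) = carrier (sym_cycles R p p)"
    by (simp add: sym_cycles_top)
  show "{\<zero>\<^bsub>cycle_module R p\<^esub>} = \<zero>\<^bsub>sym_cycles R p p\<^esub>"
    using top_zero by (simp add: sym_cycles_def)
qed (rule module_homs_add[OF singleton_hom_cycles] module_homs_smult[OF singleton_hom_cycles], assumption+)+

lemma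
  shows module_top_homology: "module R (sym_homology R p p)"
    and top_homology_hom: "(\<lambda>f. {{f}}) \<in> module_homs R (cycle_module R p) (sym_homology R p p)"
    and top_homology_carrier: "carrier (sym_homology R p p) = (\<lambda>f. {{f}}) ` top_cycles R p"
proof -
  note triv = sym_homology_def[of R p p] sym_boundaries_top
  show "module R (sym_homology R p p)"
    unfolding triv by (rule module_quot_module[OF module_sym_cycles submodule_trivial[OF module_sym_cycles]])
  show "(\<lambda>f. {{f}}) \<in> module_homs R (cycle_module R p) (sym_homology R p p)"
    unfolding triv by (rule module_homs_compose[OF singleton_hom_cycles quot_trivial_hom[OF module_sym_cycles]])
  show "carrier (sym_homology R p p) = (\<lambda>f. {{f}}) ` top_cycles R p"
    unfolding triv by (simp add: quot_trivial_carrier[OF module_sym_cycles] sym_cycles_top image_image)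
qed

lemma sym_class_top:
  assumes "f \<in> top_cycles R p" shows "sym_class R p p {f} = {{f}}"
  unfolding sym_class_def sym_boundaries_top
  by (rule singleton_coset[OF module_sym_cycles]) (simp add: sym_cycles_top assms)

lemma homology_action_top:
  assumes f: "f \<in> top_cycles R p" and \<sigma>: "\<sigma> permutes {0..p}"
  shows "homology_action R p p \<sigma> {{f}} = {{relabel R p \<sigma> f}}"
proof -
  have "f \<in> carrier (sym_free R p p)" using f top_cycles_subset by blast
  then show ?thesis
    using sym_class_top[OF relabel_top_cycles[OF \<sigma> f]] \<sigma>
    by (simp add: homology_action_def quot_map_def sym_action_top sym_class_def)
qed

lemma b_elem_eq: "b_elem R p = {cyclic_sum R p}"
proof -
  interpret F: module R "sym_free R p p" by (rule module_sym_free[OF R])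
  interpret S: module R "sym_module R p p" by (rule module_sym_module)
  note hom = sym_module_top(2)[of p]
  let ?w = "\<lambda>j. free_gen R (perm_word p (tau p ^^ j))"
  have gen: "free_gen R (perm_word p \<pi>) \<in> carrier (sym_free R p p)" if "\<pi> permutes {0..p}" for \<pi>
    unfolding sym_free_def by (rule free_gen_closed[OF R perm_word_in_tensors[OF that]])
  have top: "top_word R p = {free_gen R (perm_word p id)}"
    using top_singleton_coset[OF gen[OF permutes_id]] by (simp add: top_word_def perm_word_def)
  have act: "sym_action R p p (tau p ^^ j) (top_word R p) = {?w j}" for j
    unfolding top
    by (subst sym_action_top[OF gen[OF permutes_id] tau_funpow_permutes])
       (simp add: relabel_gen[OF tau_funpow_permutes perm_word_in_tensors[OF permutes_id]] map_perm_word)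
  have w: "?w j \<in> carrier (sym_free R p p)" for j by (rule gen[OF tau_funpow_permutes])
  have "{cyclic_sum R p} = (\<Oplus>\<^bsub>sym_module R p p\<^esub>j\<in>{0..p}.
      {((\<ominus> \<one>) [^] (j * p)) \<odot>\<^bsub>sym_free R p p\<^esub> ?w j})"
    unfolding cyclic_sum_def
    by (rule module_homs_finsum[OF F.module_axioms S.module_axioms hom]) (simp_all add: w)
  also have "\<dots> = (\<Oplus>\<^bsub>sym_module R p p\<^esub>j\<in>{0..p}. ((\<ominus> \<one>) [^] (j * p)) \<odot>\<^bsub>sym_module R p p\<^esub> {?w j})"
    by (rule S.M.finsum_cong', simp)
       (use module_homs_closed[OF hom] in \<open>simp_all add: w module_homs_smult[OF hom]\<close>)
  also have "\<dots> = b_elem R p" unfolding b_elem_def act by (rule refl)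
  finally show ?thesis ..
qed

text \<open>The classes of the translates of \<open>b_p\<close> generate, because the decomposition of cycles expresses
  every cycle through them.\<close>

lemma top_homology_span:
  assumes T: "left_transversal (Sigma_group p) (cyclic_subgroup p) T"
  shows "module_span R (sym_homology R p p)
      {sym_class R p p (sym_action R p p \<sigma> (b_elem R p)) | \<sigma>. \<sigma> \<in> T}
    = carrier (sym_homology R p p)"
proof -
  let ?q = "\<lambda>f. {{f}} :: (tensor \<Rightarrow> 'a) set set"
  interpret F: module R "sym_free R p p" by (rule module_sym_free[OF R])
  interpret K: representation R "Sigma_group p" "cycle_module R p" "relabel R p"
    by (rule representation_top_cycles)
  have Tp: "t permutes {0..p}" if "t \<in> T" for t using T that by (auto simp: left_transversal_def)
  then have finT: "finite T"
    by (intro finite_subset[OF _ finite_permutations[of "{0..p}"]]) auto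
  have orbit: "relabel R p t (cyclic_sum R p) \<in> top_cycles R p" if "t \<in> T" for t
    by (rule relabel_top_cycles[OF Tp[OF that] cyclic_sum_top_cycle])
  have cls: "sym_class R p p (sym_action R p p t (b_elem R p)) = ?q (relabel R p t (cyclic_sum R p))"
    if "t \<in> T" for t
    by (simp add: b_elem_eq sym_action_top[OF cyclic_sum_closed Tp[OF that]] sym_class_top[OF orbit[OF that]])
  let ?S = "{sym_class R p p (sym_action R p p \<sigma> (b_elem R p)) | \<sigma>. \<sigma> \<in> T}"
  have S: "?S \<subseteq> carrier (sym_homology R p p)"
    using orbit by (auto simp: cls top_homology_carrier)
  have "?q f \<in> module_span R (sym_homology R p p) ?S" if f: "f \<in> top_cycles R p" for f
  proof -
    let ?M = "{f \<in> carrier (cycle_module R p). ?q f \<in> module_span R (sym_homology R p p) ?S}"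
    have M: "submodule ?M R (cycle_module R p)"
      by (rule submodule_vimage[OF K.module_axioms module_top_homology top_homology_hom
            submodule_span[OF module_top_homology S]])
    have val: "f Z \<in> carrier R" for Z using f top_cycles_subset sym_free_value by blast
    have "relabel R p t (f (perm_word p t) \<odot>\<^bsub>sym_free R p p\<^esub> cyclic_sum R p) \<in> ?M" if t: "t \<in> T" for t
    proof -
      have "?q (relabel R p t (cyclic_sum R p)) \<in> module_span R (sym_homology R p p) ?S"
        using span_superset[of ?S R "sym_homology R p p"] cls[OF t, symmetric] t by blast
      then have "relabel R p t (cyclic_sum R p) \<in> ?M" using orbit[OF t] by simp
      then have "f (perm_word p t) \<odot>\<^bsub>cycle_module R p\<^esub> relabel R p t (cyclic_sum R p) \<in> ?M"
        by (rule submodule.smult_closed[OF M val])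
      then show ?thesis
        by (simp add: module_homs_smult[OF relabel_hom[OF Tp[OF t]] val cyclic_sum_closed])
    qed
    then have "(\<Oplus>\<^bsub>cycle_module R p\<^esub>t\<in>T. relabel R p t (f (perm_word p t) \<odot>\<^bsub>sym_free R p p\<^esub> cyclic_sum R p)) \<in> ?M"
      by (rule submodule_finsum[OF K.module_axioms M finT])
    then show ?thesis by (simp flip: top_cycles_decomposition[OF T f])
  qed
  then show ?thesis
    using span_subset_carrier[OF module_top_homology S] by (auto simp: top_homology_carrier)
qed

lemma top_homology_iso_induced:
  "rep_isomorphic R (Sigma_group p) (sym_homology R p p) (homology_action R p p)
    (induced_module R (Sigma_group p) (cyclic_subgroup p) (regular_module R) (sign_action R))
    (induced_action R (Sigma_group p) (cyclic_subgroup p) (regular_module R) (sign_action R))"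
proof (rule rep_isomorphic_along[OF top_cycles_iso_induced module_top_homology top_homology_hom])
  show "bij_betw (\<lambda>f. {{f}}) (carrier (cycle_module R p)) (carrier (sym_homology R p p))"
    by (simp add: bij_betw_def inj_on_def top_homology_carrier)
qed (simp add: homology_action_top)

end

theorem proposition69:
  fixes k :: "('k, 'c) ring_scheme" and p :: nat
  assumes "cring k"
  shows "rep_isomorphic k (Sigma_group p)
           (sym_homology k p p) (homology_action k p p)
           (induced_module k (Sigma_group p) (cyclic_subgroup p) (regular_module k) (sign_action k))
           (induced_action k (Sigma_group p) (cyclic_subgroup p) (regular_module k) (sign_action k))
       \<and> (\<forall>T. left_transversal (Sigma_group p) (cyclic_subgroup p) T \<longrightarrow>
            module_span k (sym_homology k p p)
              {sym_class k p p (sym_action k p p \<sigma> (b_elem k p)) | \<sigma>. \<sigma> \<in> T}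
            = carrier (sym_homology k p p))"
  using top_homology_iso_induced[OF assms] top_homology_span[OF assms] by blast

end
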